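(* Let $L\subset L'$, $H=L'/L$, and $a_1,\dots,a_d\in L'$ ($d\ge1$) with all coordinates strictly positive, and consider the polytopes $P^{(l')}$ and the chamber decomposition of $L\otimes\mathbb R$ of the context. (a) For each relatively open cone $\mathcal C_{op}$ of $L\otimes\mathbb R$, $P^{(l')}$ is combinatorially stable, that is, the polytopes $\{P^{(l')}\}_{l'\in\mathcal C_{op}}$ have the same combinatorial type. Therefore, for any fixed $h\in H$, the restrictions $\mathcal L_h^{\mathcal C_{op}}(\mathbf A,\mathcal T)$ and $\mathcal L_h^{\mathcal C_{op}}(\mathbf A,\mathcal F\setminus\mathcal T)$ to $\mathcal C_{op}$ of $\mathcal L_h(\mathbf A,\mathcal T)$ and $\mathcal L_h(\mathbf A,\mathcal F\setminus\mathcal T)$ respectively are quasipolynomials. (b) These quasipolynomials have a continuous extension to the closure of $\mathcal C_{op}$. Namely, if $\mathcal C'_{op}$ is in the closure of $\mathcal C_{op}$, then $\mathcal L_h^{\mathcal C'_{op}}(\mathbf A,\mathcal T)$ is the restriction to $\mathcal C'_{op}$ of the (abstract) quasipolynomial $\mathcal L_h^{\mathcal C_{op}}(\mathbf A,\mathcal T)$ (and similarly for $\mathcal F\setminus\mathcal T$). In particular, for any chamber $\mathcal C$ one has a well defined quasipolynomial $\mathcal L_h^{\mathcal C}(\mathbf A,\mathcal T)$, defined as $\mathcal L_h^{\mathcal C_{op}}(\mathbf A,\mathcal T)$ where $\mathcal C_{op}$ is the interior of $\mathcal C$, which equals $\mathcal L_h(\mathbf A,\mathcal T)$ at all points of $\mathcal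 C$. This also shows that for any two chambers $\mathcal C_1$ and $\mathcal C_2$ one has the continuity property $$\mathcal L_h^{\mathcal C_1}(\mathbf A,\mathcal T)|_{\mathcal C_1\cap\mathcal C_2}=\mathcal L_h^{\mathcal C_2}(\mathbf A,\mathcal T)|_{\mathcal C_1\cap\mathcal C_2}.$$ (c) $\mathcal L_h^{\mathcal C}(\mathbf A,\mathcal T)$ and $\mathcal L_{-h}^{\mathcal C}(\mathbf A,\mathcal F\setminus\mathcal T)$, as abstract quasipolynomials associated with a fixed chamber $\mathcal C$, satisfy the reciprocity $$\mathcal L_h^{\mathcal C}(\mathbf A,\mathcal T,l')=(-1)^d\cdot\mathcal L_{-h}^{\mathcal C}(\mathbf A,\mathcal F\setminus\mathcal T,-l').$$
   Context: $L$ is a lattice of rank $s$ with fixed basis $\{E_v\}_{v=1}^s$, $L'\subset L\otimes\mathbb Q$ an overlattice of the same rank, $H=L'/L$ (finite), $[l']$ the class of $l'$. $l_1\ge l_2$ means that all $E_v$-coordinates of $l_1-l_2$ are $\ge0$. All $E_v$-coordinates of all $a_i\in L'$ are strictly positive. For $l'\in L'$: $P^{(l'),\triangleleft}=\{x\in(\mathbb R_{\ge0})^d:\sum_ix_ia_i\not\ge l'\}$ and $P^{(l')}$ is its closure, a union of $s$ simplicial polytopes (one for each coordinate $v$). $\mathcal F$ is the set of facets of $P^{(l')}$; the coordinate facets are $F_i=P^{(l')}\cap\{x_i=0\}$, and $\mathcal T$ denotes the collection of all the other facets, so that $P^{(l'),\triangleleft}=P^{(l')}\setminus\bigcup_{F\in\mathcal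 T}F$. The counting functions (where $\mathbf A$ refers to the vectors $a_i$) are $$\mathcal L_h(\mathbf A,\mathcal T,l')=\#\{x\in\mathbb Z^d\cap P^{(l'),\triangleleft}:[\textstyle\sum_ix_ia_i]=h\},\quad\mathcal L_h(\mathbf A,\mathcal F\setminus\mathcal T,l')=\#\{x\in\mathbb Z^d\cap(P^{(l')}\setminus\bigcup_iF_i):[\textstyle\sum_ix_ia_i]=h\}.$$ Chambers: consider the vectors $a_1,\dots,a_d,-E_1,\dots,-E_s$. For each subset forming a basis of $L\otimes\mathbb R$ take the closed positive cone generated by it. The common refinement of all these cones is a polyhedral subdivision of $L\otimes\mathbb R$; a chamber is a closed cone of this subdivision with non-empty interior. The relatively open cones $\mathcal C_{op}$ are the relative interiors of the intersections of subfamilies of chambers; they give a disjoint decomposition of $L\otimes\mathbb R$. Two polytopes have the same combinatorial type if there is a bijection between their faces preserving inclusions. A quasipolynomial is a function which is polynomial on each coset of a finite index sublattice; a quasipolynomial given on the lattice points of a cone is regarded also as an abstract quasipolynomial, which for a full dimensional cone can be evaluated at all points of $L'$. *)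

theory Defs
  imports "HOL-Analysis.Analysis"
begin

section \<open>Lattices and the quotient group\<close>

text \<open>
  \<open>L \<otimes> \<real>\<close> is \<open>real ^ 's\<close>, with \<open>E\<^sub>v = axis v 1\<close>, so \<open>L\<close> and \<open>L \<otimes> \<rat>\<close> are the vectors with
  integral and with rational coordinates. The componentwise order \<open>\<le>\<close> of \<open>real ^ 's\<close>
  is the partial order of the \<open>E\<^sub>v\<close>-coordinates.
\<close>

definition int_vecs :: "(real ^ 'n) set" where
  "int_vecs = {x. \<forall>i. x $ i \<in> \<int>}"

definition rat_vecs :: "(real ^ 'n) set" where
  "rat_vecs = {x. \<forall>i. x $ i \<in> \<rat>}"

definition add_subgroup :: "'a::ab_group_add set \<Rightarrow> bool" where
  "add_subgroup N \<longleftrightarrow> 0 \<in> N \<and> (\<forall>x\<in>N. \<forall>y\<in>N. x - y \<in> N)"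

definition cosets :: "'a::ab_group_add set \<Rightarrow> 'a set \<Rightarrow> 'a set set" where
  "cosets M N = (\<lambda>m. (+) m ` N) ` M"

definition finite_index_subgroup :: "'a::ab_group_add set \<Rightarrow> 'a set \<Rightarrow> bool" where
  "finite_index_subgroup N M \<longleftrightarrow> add_subgroup N \<and> N \<subseteq> M \<and> finite (cosets M N)"

definition overlattice :: "(real ^ 's) set \<Rightarrow> bool" where
  "overlattice L' \<longleftrightarrow>
     add_subgroup L' \<and> L' \<subseteq> rat_vecs \<and> finite_index_subgroup int_vecs L'"

text \<open>The elements of \<open>H = L'/L\<close> are cosets of \<open>L\<close>; the inverse of \<open>h\<close> is \<open>uminus ` h\<close>.\<close>

definition cls :: "real ^ 's \<Rightarrow> (real ^ 's) set" where
  "cls l = (+) l ` int_vecs"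

abbreviation quotient_group :: "(real ^ 's) set \<Rightarrow> (real ^ 's) set set" where
  "quotient_group L' \<equiv> cosets L' int_vecs"


section \<open>The polytopes and their counting functions\<close>

definition lin_comb :: "('d::finite \<Rightarrow> real ^ 's) \<Rightarrow> real ^ 'd \<Rightarrow> real ^ 's" where
  "lin_comb a x = (\<Sum>i\<in>UNIV. x $ i *\<^sub>R a i)"

definition polytope_open :: "('d::finite \<Rightarrow> real ^ 's) \<Rightarrow> real ^ 's \<Rightarrow> (real ^ 'd) set" where
  "polytope_open a l = {x. 0 \<le> x \<and> \<not> l \<le> lin_comb a x}"

definition polytope_closed :: "('d::finite \<Rightarrow> real ^ 's) \<Rightarrow> real ^ 's \<Rightarrow> (real ^ 'd) set" where
  "polytope_closed a l = closure (polytope_open a l)"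

definition coord_facet ::
    "('d::finite \<Rightarrow> real ^ 's) \<Rightarrow> real ^ 's \<Rightarrow> 'd \<Rightarrow> (real ^ 'd) set" where
  "coord_facet a l i = polytope_closed a l \<inter> {x. x $ i = 0}"

text \<open>
  \<open>count_T a h\<close> is \<open>\<L>\<^sub>h(A, \<T>)\<close>, the number of lattice points off the non-coordinate facets,
  and \<open>count_FT a h\<close> is \<open>\<L>\<^sub>h(A, \<F> \<setminus> \<T>)\<close>, the number of those off the coordinate facets.
  The sets counted are bounded as soon as all coordinates of all \<open>a i\<close> are positive.
\<close>

definition count_T ::
    "('d::finite \<Rightarrow> real ^ 's) \<Rightarrow> (real ^ 's) set \<Rightarrow> real ^ 's \<Rightarrow> real" where
  "count_T a h l = real (card {x \<in> int_vecs \<inter> polytope_open a l. cls (lin_comb a x) = h})"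

definition count_FT ::
    "('d::finite \<Rightarrow> real ^ 's) \<Rightarrow> (real ^ 's) set \<Rightarrow> real ^ 's \<Rightarrow> real" where
  "count_FT a h l =
     real (card {x \<in> int_vecs \<inter> (polytope_closed a l - (\<Union>i. coord_facet a l i)).
                   cls (lin_comb a x) = h})"


section \<open>Faces and combinatorial type\<close>

text \<open>
  The polytopes above are finite unions of simplices and in general not convex, so
  \<^const>\<open>face_of\<close> does not apply. Their faces are those of general polyhedra (Nef, Bieri):
  two points lie in the same relatively open face if the set has the same
  germ at both, up to translation, and a face is the closure of a relatively open one. On a
  convex polytope these are its nonempty faces, the polytope itself included. On the polytopes
  above they are, besides the polytope itself, the nonempty intersections of facets.
\<close>

definition same_germ :: "'a::real_normed_vector set \<Rightarrow> 'a \<Rightarrow> 'a \<Rightarrow> bool" where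
  "same_germ P x y \<longleftrightarrow> (\<exists>e>0. \<forall>u. norm u < e \<longrightarrow> (x + u \<in> P \<longleftrightarrow> y + u \<in> P))"

definition poly_faces :: "'a::real_normed_vector set \<Rightarrow> 'a set set" where
  "poly_faces P = (\<lambda>x. closure {y \<in> P. same_germ P x y}) ` P"

definition same_combinatorial_type ::
    "'a::real_normed_vector set \<Rightarrow> 'a set \<Rightarrow> bool" where
  "same_combinatorial_type P Q \<longleftrightarrow>
     (\<exists>\<phi>. bij_betw \<phi> (poly_faces P) (poly_faces Q) \<and>
          (\<forall>F\<in>poly_faces P. \<forall>G\<in>poly_faces P. F \<subseteq> G \<longleftrightarrow> \<phi> F \<subseteq> \<phi> G))"


section \<open>Chambers\<close>

definition chamber_vectors :: "('d::finite \<Rightarrow> real ^ 's) \<Rightarrow> (real ^ 's) set" where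
  "chamber_vectors a = range a \<union> range (\<lambda>v. - axis v 1)"

definition basis_cones :: "('d::finite \<Rightarrow> real ^ 's) \<Rightarrow> (real ^ 's) set set" where
  "basis_cones a =
     {convex_cone hull B | B. B \<subseteq> chamber_vectors a \<and> independent B \<and> span B = UNIV}"

text \<open>
  The full dimensional cells of the common refinement are the regions into which the boundaries
  of all the basis cones cut the space.
\<close>

definition chambers :: "('d::finite \<Rightarrow> real ^ 's) \<Rightarrow> (real ^ 's) set set" where
  "chambers a = closure ` components (UNIV - (\<Union>K\<in>basis_cones a. frontier K))"

definition open_cones :: "('d::finite \<Rightarrow> real ^ 's) \<Rightarrow> (real ^ 's) set set" where
  "open_cones a = {rel_interior (\<Inter>\<K>) | \<K>. \<K> \<subseteq> chambers a \<and> \<K> \<noteq> {}}"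


section \<open>Quasipolynomials\<close>

definition quasipolynomial_on :: "(real ^ 's) set \<Rightarrow> (real ^ 's \<Rightarrow> real) \<Rightarrow> bool" where
  "quasipolynomial_on M q \<longleftrightarrow>
     (\<exists>N. finite_index_subgroup N M \<and>
          (\<forall>K\<in>cosets M N. \<exists>p. real_polynomial_function p \<and> (\<forall>x\<in>K. q x = p x)))"

text \<open>
  The abstract quasipolynomial of a function \<open>f\<close> on the lattice points of a cone \<open>C\<close> lives on
  the lattice points of the linear span of \<open>C\<close>, hence on all of \<open>L'\<close> if \<open>C\<close> is full
  dimensional. Off its domain it is \<^const>\<open>undefined\<close>, which makes it unique as a function.
\<close>

definition is_abstract_quasipoly ::
    "(real ^ 's) set \<Rightarrow> (real ^ 's) set \<Rightarrow> (real ^ 's \<Rightarrow> real) \<Rightarrow> (real ^ 's \<Rightarrow> real) \<Rightarrow> bool" where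
  "is_abstract_quasipoly L' C f q \<longleftrightarrow>
     q \<in> extensional (L' \<inter> span C) \<and> quasipolynomial_on (L' \<inter> span C) q \<and>
     (\<forall>l\<in>L' \<inter> C. q l = f l)"

definition abstract_quasipoly ::
    "(real ^ 's) set \<Rightarrow> (real ^ 's) set \<Rightarrow> (real ^ 's \<Rightarrow> real) \<Rightarrow> real ^ 's \<Rightarrow> real" where
  "abstract_quasipoly L' C f = (THE q. is_abstract_quasipoly L' C f q)"

end

theory Submission
  imports Defs
begin

text \<open>
  With \<open>z = (x, \<Sum>\<^sub>i x\<^sub>i a\<^sub>i - l)\<close> the points \<open>x\<close> become the solutions of \<open>comb z = l\<close> for the
  configuration of the vectors \<open>a\<^sub>i\<close> and \<open>- E\<^sub>v\<close>. For \<open>l\<close> in a closed chamber \<open>C\<close> the indicator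
  function of \<open>z \<ge> 0\<close> is a signed sum of indicator functions of half-open simplicial cones, one for
  each basis whose cone contains \<open>C\<close>: this is the Lawrence--Varchenko decomposition, with edges
  polarized by a generic positive functional \<open>\<xi>\<close> of \<open>x\<close>. Truncation at \<open>\<xi> \<le> R\<close> turns the cones into
  half-open simplices, whose lattice point counts are quasipolynomials in \<open>l\<close> and \<open>R\<close> satisfying
  reciprocity. Their signed sum does not depend on \<open>R\<close> when \<open>R\<close> is large, hence, being a
  quasipolynomial, not at all. So the count is a single quasipolynomial up to the boundary of \<open>C\<close>, and
  it inherits the reciprocity of simplices.

  The faces of the polytopes correspond to the sets of tight inequalities that occur. These can be
  read off from the relatively open cones of subconfigurations that contain \<open>l\<close>, and they are constant
  on the cells because each cone spanned by generators meets each chamber in a face of the chamber.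
\<close>

section \<open>Quasipolynomials in one variable\<close>

text \<open>The sets to be counted are differences: an orthant of points x minus the polyhedron on
  which all slacks are admissible. Both are infinite, which forces the truncation; the orthant
  enters as the polarized cone of the basis of the vectors -E_v. The functional has natural
  coefficients, so lattice points have integral weights and R can be an integer. The obstacle to
  continuity is degeneracy: for l on the boundary of a chamber vertices collide, yet the list of
  bases must remain that of the chamber. Half-open cones cope with this, because vanishing
  coordinates receive a sign from an infinitesimal shift into the chamber. Shifting with all
  coordinates positive or all negative yields the two counting functions from one argument, which is
  therefore carried through with a Boolean flag. Reciprocity of simplices exchanges the flag and
  sends R to -R - 1. As the signed sum does not depend on R over its chamber, the levels 0 and -1
  can be fixed for the two functions. Uniqueness of the abstract quasipolynomials rests on an
  integral point in each relatively open cone.\<close>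

definition int_quasipoly :: "nat \<Rightarrow> (int \<Rightarrow> real) \<Rightarrow> bool" where
  "int_quasipoly m f \<longleftrightarrow> 0 < m \<and> (\<forall>r. \<exists>p. \<forall>k. f (r + int m * k) = poly p (of_int k))"

lemma int_quasipoly_mult:
  assumes "int_quasipoly m f" "0 < n"
  shows "int_quasipoly (m * n) f"
  unfolding int_quasipoly_def
proof (intro conjI allI)
  fix r
  obtain p where p: "f (r + int m * k) = poly p (of_int k)" for k
    using assms unfolding int_quasipoly_def by meson
  have "f (r + int (m * n) * k) = poly (pcompose p [:0, of_nat n:]) (of_int k)" for k
    using p[of "int n * k"] by (simp add: poly_pcompose mult.assoc mult.commute mult.left_commute)
  then show "\<exists>p. \<forall>k. f (r + int (m * n) * k) = poly p (of_int k)" by blast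
qed (use assms in \<open>auto simp: int_quasipoly_def\<close>)

lemma int_quasipoly_add_same:
  assumes "int_quasipoly m f" "int_quasipoly m g"
  shows "int_quasipoly m (\<lambda>n. f n + g n)"
  unfolding int_quasipoly_def
proof (intro conjI allI)
  fix r
  obtain p q where "f (r + int m * k) = poly p (of_int k)" "g (r + int m * k) = poly q (of_int k)" for k
    using assms unfolding int_quasipoly_def by meson
  then have "\<forall>k. f (r + int m * k) + g (r + int m * k) = poly (p + q) (of_int k)" by simp
  then show "\<exists>p. \<forall>k. f (r + int m * k) + g (r + int m * k) = poly p (of_int k)" by blast
qed (use assms in \<open>auto simp: int_quasipoly_def\<close>)

lemma int_quasipoly_cmult:
  assumes "int_quasipoly m f"
  shows "int_quasipoly m (\<lambda>n. c * f n)"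
  unfolding int_quasipoly_def
proof (intro conjI allI)
  fix r
  obtain p where "f (r + int m * k) = poly p (of_int k)" for k
    using assms unfolding int_quasipoly_def by meson
  then have "\<forall>k. c * f (r + int m * k) = poly (smult c p) (of_int k)" by simp
  then show "\<exists>p. \<forall>k. c * f (r + int m * k) = poly p (of_int k)" by blast
qed (use assms in \<open>auto simp: int_quasipoly_def\<close>)

lemma int_quasipoly_shift:
  assumes "int_quasipoly m f"
  shows "int_quasipoly m (\<lambda>n. f (n + c))"
  unfolding int_quasipoly_def
proof (intro conjI allI)
  fix r
  obtain p where "f ((r + c) + int m * k) = poly p (of_int k)" for k
    using assms unfolding int_quasipoly_def by meson
  then have "\<forall>k. f (r + int m * k + c) = poly p (of_int k)" by (simp add: algebra_simps)
  then show "\<exists>p. \<forall>k. f (r + int m * k + c) = poly p (of_int k)" by blast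
qed (use assms in \<open>auto simp: int_quasipoly_def\<close>)

lemma int_quasipoly_const: "0 < m \<Longrightarrow> int_quasipoly m (\<lambda>_. c)"
  unfolding int_quasipoly_def by (auto intro!: exI[of _ "[:c:]"])

lemma int_quasipoly_sum_same:
  assumes "0 < m" "\<And>i. i \<in> A \<Longrightarrow> int_quasipoly m (f i)"
  shows "int_quasipoly m (\<lambda>n. \<Sum>i\<in>A. f i n)"
  using assms(2)
proof (induction A rule: infinite_finite_induct)
  case (insert x F)
  then show ?case using int_quasipoly_add_same[of m "f x" "\<lambda>n. \<Sum>i\<in>F. f i n"] by simp
qed (use assms(1) int_quasipoly_const in auto)

lemma int_quasipoly_sum:
  assumes "\<And>i. i \<in> A \<Longrightarrow> \<exists>m. int_quasipoly m (f i)"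
  shows "\<exists>m. int_quasipoly m (\<lambda>n. \<Sum>i\<in>A. f i n)"
  using assms
proof (induction A rule: infinite_finite_induct)
  case (insert x F)
  from insert.prems[of x] insert.IH insert.prems
  obtain m m' where m: "int_quasipoly m (f x)" "int_quasipoly m' (\<lambda>n. \<Sum>i\<in>F. f i n)" by blast
  then have pos: "0 < m" "0 < m'" by (auto simp: int_quasipoly_def)
  have "int_quasipoly (m * m') (f x)" "int_quasipoly (m * m') (\<lambda>n. \<Sum>i\<in>F. f i n)"
    using int_quasipoly_mult[OF m(1) pos(2)] int_quasipoly_mult[OF m(2) pos(1)] by (simp_all add: mult.commute)
  from int_quasipoly_add_same[OF this] insert show ?case by auto
qed (use int_quasipoly_const[of 1] in auto)

text \<open>On the residue class of \<open>n\<close> the function is a polynomial in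
  \<open>k\<close> that takes the value \<open>c\<close> for all large \<open>k\<close>, so the
  polynomial minus \<open>c\<close> has infinitely many roots.\<close>

lemma int_quasipoly_eventually_const:
  assumes "int_quasipoly m f" "\<And>n. n \<ge> n0 \<Longrightarrow> f n = c"
  shows "f n = c"
proof -
  have m: "0 < m" using assms by (auto simp: int_quasipoly_def)
  obtain p where p: "f (n + int m * k) = poly p (of_int k)" for k
    using assms unfolding int_quasipoly_def by meson
  have "n + int m * k \<ge> n0" if "k \<ge> \<bar>n0 - n\<bar>" for k
  proof -
    have "k \<le> int m * k" using m that mult_right_mono[of 1 "int m" k] by simp
    then show ?thesis using that by linarith
  qed
  then have "of_int ` {\<bar>n0 - n\<bar>..} \<subseteq> {x. poly (p - [:c:]) x = 0}"
    using p assms(2) by fastforce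
  moreover have "infinite (of_int ` {\<bar>n0 - n\<bar>..} :: real set)"
    by (subst finite_image_iff) (auto simp: inj_on_def infinite_Ici)
  ultimately have "p - [:c:] = 0" using poly_roots_finite finite_subset by blast
  then show ?thesis using p[of 0] by simp
qed

text \<open>The backward difference of \<open>x ^ Suc n\<close> is \<open>Suc n * x ^ n\<close> plus
  lower powers, by the binomial theorem; antidifferences of the lower powers come from strong
  induction and cancel them.\<close>

lemma power_antidifference:
  "\<exists>q::real poly. \<forall>x. poly q x - poly q (x - 1) = x ^ n"
proof (induction n rule: less_induct)
  case (less n)
  then have "\<forall>i. \<exists>q::real poly. i < n \<longrightarrow> (\<forall>x. poly q x - poly q (x - 1) = x ^ i)" by blast
  from choice[OF this] obtain Q :: "nat \<Rightarrow> real poly"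
    where Q: "\<And>i x. i < n \<Longrightarrow> poly (Q i) x - poly (Q i) (x - 1) = x ^ i" by blast
  define c :: "nat \<Rightarrow> real" where "c i = of_nat (Suc n choose i) * (-1) ^ (Suc n - i)" for i
  define q where "q = smult (1 / real (Suc n)) (monom 1 (Suc n) + (\<Sum>i<n. smult (c i) (Q i)))"
  have "poly q x - poly q (x - 1) = x ^ n" for x
  proof -
    have "(x - 1) ^ Suc n = (\<Sum>i\<le>Suc n. c i * x ^ i)"
      using binomial_ring[of x "-1" "Suc n"] by (simp add: c_def mult.commute mult.left_commute)
    also have "\<dots> = (\<Sum>i<n. c i * x ^ i) + c n * x ^ n + c (Suc n) * x ^ Suc n"
      by (simp add: lessThan_Suc_atMost[symmetric] del: power_Suc)
    also have "c n = - real (Suc n)" by (simp add: c_def)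
    also have "c (Suc n) = 1" by (simp add: c_def)
    finally have "x ^ Suc n - (x - 1) ^ Suc n + (\<Sum>i<n. c i * x ^ i) = real (Suc n) * x ^ n"
      by (simp add: algebra_simps)
    moreover have "(\<Sum>i<n. c i * poly (Q i) x) - (\<Sum>i<n. c i * poly (Q i) (x - 1)) = (\<Sum>i<n. c i * x ^ i)"
      by (subst sum_subtractf[symmetric], rule sum.cong) (auto simp only: right_diff_distrib[symmetric] Q lessThan_iff)
    ultimately have "(x ^ Suc n + (\<Sum>i<n. c i * poly (Q i) x)) - ((x - 1) ^ Suc n + (\<Sum>i<n. c i * poly (Q i) (x - 1)))
        = real (Suc n) * x ^ n" by linarith
    moreover have "poly q y = (1 / real (Suc n)) * (y ^ Suc n + (\<Sum>i<n. c i * poly (Q i) y))" for y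
      by (simp add: q_def poly_sum poly_monom)
    ultimately show ?thesis
      by (simp only: right_diff_distrib[symmetric]) (simp del: of_nat_Suc)
  qed
  then show ?case by blast
qed

lemma poly_antidifference:
  fixes p :: "real poly"
  shows "\<exists>q. \<forall>x. poly q x - poly q (x - 1) = poly p x"
proof -
  obtain Q where Q: "\<And>i x. poly (Q i) x - poly (Q i) (x - 1) = (x::real) ^ i"
    using power_antidifference by metis
  have "poly (\<Sum>i\<le>degree p. smult (coeff p i) (Q i)) x - poly (\<Sum>i\<le>degree p. smult (coeff p i) (Q i)) (x - 1) = poly p x" for x
    by (simp add: poly_sum sum_subtractf[symmetric] right_diff_distrib[symmetric] Q)
       (simp add: poly_altdef)
  then show ?thesis by blast
qed

lemma int_antidifference:
  fixes g :: "int \<Rightarrow> real"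
  shows "\<exists>G. G (-1) = 0 \<and> (\<forall>k. G k - G (k - 1) = g k)"
proof -
  define G where "G k = (if 0 \<le> k then sum g {0..k} else - sum g {k + 1..-1})" for k
  have "G k - G (k - 1) = g k" for k
  proof -
    consider "k \<ge> 1" | "k = 0" | "k < 0" by linarith
    then show ?thesis
    proof cases
      case 1
      then have "{0..k} = insert k {0..k-1}" by auto
      then show ?thesis using 1 by (simp add: G_def)
    next
      case 3
      then have "{k..-1} = insert k {k+1..-1}" by auto
      then show ?thesis using 3 by (simp add: G_def)
    qed (simp add: G_def)
  qed
  moreover have "G (-1) = 0" by (simp add: G_def)
  ultimately show ?thesis by blast
qed

text \<open>Each residue class modulo \<open>w\<close> is summed separately, starting at its member
  in the block from \<open>- w\<close> to -1. A step of length \<open>m * w\<close> adds up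
  \<open>m\<close> values of \<open>f\<close>, which form a polynomial on each class modulo
  \<open>m * w\<close>; a polynomial antidifference then describes \<open>F\<close> up to a
  constant.\<close>

lemma int_quasipoly_antidifference:
  assumes f: "int_quasipoly m f" and w: "0 < w"
  shows "\<exists>m' F. int_quasipoly m' F \<and> (\<forall>n. F n - F (n - int w) = f n) \<and>
           (\<forall>n. - int w \<le> n \<and> n < 0 \<longrightarrow> F n = 0)"
proof -
  have "\<forall>r. \<exists>G. G (-1) = 0 \<and> (\<forall>k. G k - G (k - 1) = f (r + int w * k))"
    by (rule allI, rule int_antidifference)
  then obtain G where G: "\<And>r. G r (-1) = 0" "\<And>r k. G r k - G r (k - 1) = f (r + int w * k)" by metis
  define F where "F n = G (n mod int w) (n div int w)" for n
  have diff: "F n - F (n - int w) = f n" for n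
  proof -
    have a: "(n - int w) div int w = n div int w - 1"
      using w div_add_self2[of "int w" "n - int w"] by simp
    have b: "(n - int w) mod int w = n mod int w" by simp
    show ?thesis unfolding F_def a b using G(2) by simp
  qed
  have zero: "F n = 0" if "- int w \<le> n" "n < 0" for n
  proof -
    have "n div int w = -1" using that w
      by (intro int_div_pos_eq[of _ _ _ "n + int w"]) auto
    then show ?thesis unfolding F_def using G(1) by simp
  qed
  have m: "0 < m" using f by (auto simp: int_quasipoly_def)
  have blk: "F n - F (n - int (w * j)) = (\<Sum>i<j. f (n - int (w * i)))" for n j
  proof (induction j)
    case (Suc j)
    have "F (n - int (w * j)) - F (n - int (w * j) - int w) = f (n - int (w * j))" by (rule diff)
    moreover have "n - int (w * j) - int w = n - int (w * Suc j)" by simp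
    ultimately show ?case using Suc by (simp only: sum.lessThan_Suc)
  qed simp
  have S: "int_quasipoly m (\<lambda>n. \<Sum>i<m. f (n - int (w * i)))"
    using int_quasipoly_shift[OF f, of "- int (w * i)" for i] m by (intro int_quasipoly_sum_same) auto
  have S: "int_quasipoly (m * w) (\<lambda>n. \<Sum>i<m. f (n - int (w * i)))"
    using int_quasipoly_mult[OF S w] .
  have "int_quasipoly (m * w) F"
    unfolding int_quasipoly_def
  proof (intro conjI allI)
    fix r
    obtain p where p: "(\<Sum>i<m. f (r + int (m * w) * k - int (w * i))) = poly p (of_int k)" for k
      using S unfolding int_quasipoly_def by meson
    obtain q where q: "poly q x - poly q (x - 1) = poly p x" for x
      using poly_antidifference by blast
    have step: "F (r + int (m * w) * k) - F (r + int (m * w) * (k - 1)) = poly q (of_int k) - poly q (of_int (k - 1))" for k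
      using blk[of "r + int (m * w) * k" m] p[of k] q[of "of_int k"] by (simp add: algebra_simps)
    \<comment> \<open>Both terms have the same backward difference, so \<open>D\<close> is constant,
      and this constant is added to \<open>q\<close>.\<close>
    define D where "D k = F (r + int (m * w) * k) - poly q (of_int k)" for k
    have D_step: "D k = D (k - 1)" for k using step[of k] by (simp add: D_def)
    have "D k = D 0" for k
    proof (induction k rule: int_induct[where k=0])
      case (step1 i) then show ?case using D_step[of "i + 1"] by simp
    next
      case (step2 i) then show ?case using D_step[of i] by simp
    qed simp
    then have "\<forall>k. F (r + int (m * w) * k) = poly (q + [:D 0:]) (of_int k)"
      unfolding D_def by (simp add: algebra_simps) 
    then show "\<exists>p. \<forall>k. F (r + int (m * w) * k) = poly p (of_int k)" by blast
  qed (use m w in auto)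
  with diff zero show ?thesis by blast
qed

section \<open>Lattice points of weighted simplices\<close>

definition weight_points :: "'a set \<Rightarrow> ('a \<Rightarrow> nat) \<Rightarrow> int \<Rightarrow> ('a \<Rightarrow> nat) set" where
  "weight_points N w n = {k. (\<forall>j. j \<notin> N \<longrightarrow> k j = 0) \<and> int (\<Sum>j\<in>N. w j * k j) \<le> n}"

lemma finite_weight_points:
  assumes "finite N" "\<And>j. j \<in> N \<Longrightarrow> 0 < w j"
  shows "finite (weight_points N w n)"
proof -
  have "weight_points N w n \<subseteq> {k. \<forall>j. (j \<in> N \<longrightarrow> k j \<in> {..nat n}) \<and> (j \<notin> N \<longrightarrow> k j = 0)}"
  proof clarsimp
    fix k j assume k: "k \<in> weight_points N w n"
    have "k j \<le> nat n" if "j \<in> N"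
    proof -
      have "1 * k j \<le> w j * k j" using assms that by (intro mult_right_mono) (auto simp: Suc_le_eq)
      also have "\<dots> \<le> (\<Sum>j\<in>N. w j * k j)" using that assms by (intro member_le_sum) auto
      finally have "int (k j) \<le> n" using k unfolding weight_points_def by (metis (mono_tags, lifting) mem_Collect_eq of_nat_mono order.trans mult_1)
      then show ?thesis by simp
    qed
    then show "(j \<in> N \<longrightarrow> k j \<le> nat n) \<and> (j \<notin> N \<longrightarrow> k j = 0)" using k by (auto simp: weight_points_def)
  qed
  then show ?thesis using finite_set_of_finite_funs[OF assms(1), of "{..nat n}" 0]
    by (meson finite_atMost finite_subset)
qed

text \<open>Points with \<open>k j = 0\<close> form the simplex without \<open>j\<close>; lowering
  \<open>k j\<close> by one in the others lowers the level by \<open>w j\<close>. This is the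
  recursion that antidifferences solve.\<close>

lemma card_weight_points_insert:
  assumes "finite N" "j \<notin> N" "\<And>i. i \<in> insert j N \<Longrightarrow> 0 < w i"
  shows "card (weight_points (insert j N) w n) =
         card (weight_points (insert j N) w (n - int (w j))) + card (weight_points N w n)"
proof -
  let ?A = "weight_points (insert j N) w" and ?s = "\<lambda>k::'a \<Rightarrow> nat. k(j := Suc (k j))"
  have eq: "(\<Sum>i\<in>N. int (w i) * int (if i = j then x i else k i)) = (\<Sum>i\<in>N. int (w i) * int (k i))" for k x
    using assms(2) by (intro sum.cong) auto
  have split: "?A n = ?s ` ?A (n - int (w j)) \<union> weight_points N w n"
  proof (intro equalityI subsetI)
    fix k assume k: "k \<in> ?A n"
    show "k \<in> ?s ` ?A (n - int (w j)) \<union> weight_points N w n"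
    proof (cases "k j")
      case 0
      then have "k \<in> weight_points N w n" using k assms unfolding weight_points_def by auto metis
      then show ?thesis by blast
    next
      case (Suc y)
      then have "k = ?s (k(j := y))" by auto
      moreover have "k(j := y) \<in> ?A (n - int (w j))"
        using k Suc assms by (auto simp: weight_points_def eq algebra_simps split: if_splits)
      ultimately show ?thesis by blast
    qed
  next
    fix k assume "k \<in> ?s ` ?A (n - int (w j)) \<union> weight_points N w n"
    then show "k \<in> ?A n"
      using assms(1,2) by (auto simp: weight_points_def eq algebra_simps split: if_splits)
  qed
  have inj: "inj_on ?s (?A (n - int (w j)))"
  proof (rule inj_onI)
    fix k k' assume e: "?s k = ?s k'"
    show "k = k'"
    proof
      fix i show "k i = k' i" using fun_cong[OF e, of i] by (auto split: if_splits)
    qed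
  qed
  have "?s ` ?A (n - int (w j)) \<inter> weight_points N w n = {}"
    using assms(2) by (auto simp: weight_points_def)
  moreover have "finite (?s ` ?A (n - int (w j)))" "finite (weight_points N w n)"
    using assms by (auto intro!: finite_imageI finite_weight_points)
  ultimately show ?thesis unfolding split
    using inj by (simp add: card_Un_disjoint card_image)
qed

lemma weight_points_neg: "n < 0 \<Longrightarrow> weight_points N w n = {}"
  unfolding weight_points_def using of_nat_0_le_iff order.trans by fastforce

text \<open>
  The last conjunct is Ehrhart reciprocity for a simplex: for positive \<open>n\<close>, \<open>E (n - 1 - sum w N)\<close>
  counts the interior points of the \<open>n\<close>-th dilate.
\<close>

lemma weight_points_quasipoly:
  fixes w :: "'a \<Rightarrow> nat"
  assumes "finite N" "\<And>j. j \<in> N \<Longrightarrow> 0 < w j"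
  shows "\<exists>m E. int_quasipoly m E \<and>
           (\<forall>n. - int (sum w N) \<le> n \<longrightarrow> E n = real (card (weight_points N w n))) \<and>
           (\<forall>n. E (- n) = (-1) ^ card N * E (n - 1 - int (sum w N)))"
  using assms
proof (induction N)
  case empty
  have "weight_points {} w n = {\<lambda>_. 0}" if "n \<ge> 0" for n
    using that by (auto simp: weight_points_def)
  then show ?case
    by (intro exI[of _ 1] exI[of _ "\<lambda>_. 1"]) (auto intro: int_quasipoly_const)
next
  case (insert j N)
  let ?S = "int (sum w N)" and ?w = "int (w j)"
  obtain m E where E: "int_quasipoly m E"
      "\<And>n. - ?S \<le> n \<Longrightarrow> E n = real (card (weight_points N w n))"
      "\<And>n. E (- n) = (-1) ^ card N * E (n - 1 - ?S)"
    using insert.IH insert.prems by auto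
  have wj: "0 < w j" using insert.prems by simp
  obtain m' F where F: "int_quasipoly m' F" "\<And>n. F n - F (n - ?w) = E n"
      "\<And>n. - ?w \<le> n \<Longrightarrow> n < 0 \<Longrightarrow> F n = 0"
    using int_quasipoly_antidifference[OF E(1) wj] by blast
  have S: "int (sum w (insert j N)) = ?S + ?w" using insert.hyps by simp
  have E0: "E n = 0" if "- ?S \<le> n" "n < 0" for n
    using E(2)[OF that(1)] that(2) by (simp add: weight_points_neg)
  \<comment> \<open>Running the recursion downwards from the block where \<open>F\<close> is
    normalized to zero keeps it zero as long as \<open>E\<close> vanishes, that is, for another
    \<open>sum w N\<close> negative levels.\<close>
  have F0': "F n = 0" if "- ?S - ?w \<le> n" "n < 0" "nat (- n) = k" for n k
    using that
  proof (induction k arbitrary: n rule: less_induct)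
    case (less k)
    show ?case
    proof (cases "- ?w \<le> n")
      case False
      have "F (n + ?w) = 0" using less.IH[of "nat (- (n + ?w))" "n + ?w"] less.prems False wj by auto
      moreover have "E (n + ?w) = 0" using E0[of "n + ?w"] less.prems False by auto
      ultimately show ?thesis using F(2)[of "n + ?w"] by simp
    qed (use F(3) less.prems in auto)
  qed
  then have F0: "F n = 0" if "- ?S - ?w \<le> n" "n < 0" for n using that by blast
  have cnt: "F n = real (card (weight_points (insert j N) w n))" if "- (?S + ?w) \<le> n" for n
    using that
  proof (induction "nat (n + ?S + ?w)" arbitrary: n rule: less_induct)
    case less
    show ?case
    proof (cases "n < 0")
      case True
      then show ?thesis using F0[of n] less.prems True by (simp add: weight_points_neg)
    next
      case False
      have "F (n - ?w) = real (card (weight_points (insert j N) w (n - ?w)))"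
        using wj less.prems False sum_nonneg[of N "\<lambda>x. int (w x)"] by (intro less.hyps) auto
      moreover have "E n = real (card (weight_points N w n))" using E(2)[of n] False sum_nonneg[of N "\<lambda>x. int (w x)"] by simp
      ultimately show ?thesis
        using F(2)[of n] card_weight_points_insert[of N j w n] insert by simp
    qed
  qed
  \<comment> \<open>The failure of reciprocity. By the reciprocity of \<open>E\<close> it has period
    \<open>w j\<close>, so one block of arguments decides.\<close>
  define D where "D n = F (- n) - (-1) ^ Suc (card N) * F (n - 1 - (?S + ?w))" for n
  have D_per: "D (n + ?w) = D n" for n
  proof -
    have a: "F (- n) - F (- n - ?w) = E (- n)" by (rule F(2))
    have b: "F (n - 1 - ?S) - F (n - 1 - ?S - ?w) = E (n - 1 - ?S)" by (rule F(2))
    have arg: "- (n + ?w) = - n - ?w" "n + ?w - 1 - (?S + ?w) = n - 1 - ?S"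
        "n - 1 - (?S + ?w) = n - 1 - ?S - ?w" by linarith+
    have "D (n + ?w) - D n = - (F (- n) - F (- n - ?w)) + (-1) ^ card N * (F (n - 1 - ?S) - F (n - 1 - ?S - ?w))"
      unfolding D_def arg by (simp add: algebra_simps)
    then show ?thesis using a b E(3)[of n] by simp
  qed
  have D_per': "D (n + ?w * k) = D n" for n k
  proof (induction k arbitrary: n rule: int_induct[where k=0])
    case (step1 i)
    then show ?case using D_per[of "n + ?w * i"] by (simp add: algebra_simps)
  next
    case (step2 i)
    then show ?case using D_per[of "n + ?w * (i - 1)"] by (simp add: algebra_simps)
  qed simp
  have "D n = 0" for n
  proof -
    \<comment> \<open>The representative \<open>r + 1\<close> lies between 1 and \<open>w j\<close>,
      where both arguments of \<open>F\<close> fall into the negative range on which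
      \<open>F\<close> vanishes.\<close>
    define r where "r = (n - 1) mod ?w"
    have r: "0 \<le> r" "r < ?w" using wj by (auto simp: r_def)
    have n: "n = (r + 1) + ?w * ((n - 1) div ?w)" unfolding r_def by simp
    have "D n = D (r + 1)" by (subst n) (rule D_per')
    also have "\<dots> = 0" unfolding D_def
      using r F0[of "- (r + 1)"] F0[of "r + 1 - 1 - (?S + ?w)"] sum_nonneg[of N "\<lambda>x. int (w x)"] by simp
    finally show ?thesis .
  qed
  then have rec: "F (- n) = (-1) ^ card (insert j N) * F (n - 1 - (?S + ?w))" for n
    using insert.hyps by (auto simp: D_def eq_neg_iff_add_eq_0)
  show ?case unfolding S using F(1) cnt rec by blast
qed

section \<open>Cones and bases of a vector configuration\<close>

text \<open>An indexed family instead of a set of vectors: the \<open>a i\<close> may coincide and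
  still belong to different coordinates \<open>x $ i\<close>.\<close>

locale vector_configuration =
  fixes g :: "'j::finite \<Rightarrow> 'v::euclidean_space"
begin

definition comb :: "('j \<Rightarrow> real) \<Rightarrow> 'v" where
  "comb z = (\<Sum>j\<in>UNIV. z j *\<^sub>R g j)"

definition cone_of :: "'j set \<Rightarrow> 'v set" where
  "cone_of Y = {comb z | z. (\<forall>j. 0 \<le> z j) \<and> (\<forall>j. j \<notin> Y \<longrightarrow> z j = 0)}"

text \<open>Unique solvability is the form of the basis property that coordinates and pivots use;
  for an index set it also forces distinct elements of \<open>B\<close> to carry distinct
  vectors.\<close>

definition ibasis :: "'j set \<Rightarrow> bool" where
  "ibasis B \<longleftrightarrow> (\<forall>l. \<exists>!z. (\<forall>j. j \<notin> B \<longrightarrow> z j = 0) \<and> comb z = l)"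

definition coord :: "'j set \<Rightarrow> 'v \<Rightarrow> 'j \<Rightarrow> real" where
  "coord B l = (THE z. (\<forall>j. j \<notin> B \<longrightarrow> z j = 0) \<and> comb z = l)"

lemma comb_lin: "comb (\<lambda>j. s * z j + t * y j) = s *\<^sub>R comb z + t *\<^sub>R comb y"
  by (simp add: comb_def scaleR_left_distrib sum.distrib scaleR_sum_right)

lemma comb_add: "comb (\<lambda>j. z j + y j) = comb z + comb y"
  using comb_lin[of 1 z 1 y] by simp

lemma comb_diff: "comb (\<lambda>j. z j - y j) = comb z - comb y"
  using comb_lin[of 1 z "-1" y] by simp

lemma comb_scale: "comb (\<lambda>j. s * z j) = s *\<^sub>R comb z"
  using comb_lin[of s z 0 z] by simp

lemma comb_zero: "comb (\<lambda>j. 0) = 0"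
  by (simp add: comb_def)

lemma comb_unit: "comb (\<lambda>j. if j = k then c else 0) = c *\<^sub>R g k"
  by (simp add: comb_def if_distrib[of "\<lambda>x. x *\<^sub>R _"] cong: if_cong)

lemma comb_supp:
  assumes "\<And>j. j \<notin> Y \<Longrightarrow> z j = 0"
  shows "comb z = (\<Sum>j\<in>Y. z j *\<^sub>R g j)"
  unfolding comb_def using assms by (intro sum.mono_neutral_right) auto

lemma coord_ex:
  assumes "ibasis B"
  shows "(\<forall>j. j \<notin> B \<longrightarrow> coord B l j = 0) \<and> comb (coord B l) = l"
proof -
  have "\<exists>!z. (\<forall>j. j \<notin> B \<longrightarrow> z j = 0) \<and> comb z = l" using assms by (simp add: ibasis_def)
  then show ?thesis unfolding coord_def by (rule theI')
qed

lemma coord_outside: "ibasis B \<Longrightarrow> j \<notin> B \<Longrightarrow> coord B l j = 0"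
  and comb_coord: "ibasis B \<Longrightarrow> comb (coord B l) = l"
  using coord_ex by auto

lemma coord_unique:
  assumes "ibasis B" "\<And>j. j \<notin> B \<Longrightarrow> z j = 0" "comb z = l"
  shows "coord B l = z"
proof -
  have "\<exists>!z. (\<forall>j. j \<notin> B \<longrightarrow> z j = 0) \<and> comb z = l" using assms by (simp add: ibasis_def)
  then show ?thesis unfolding coord_def by (rule the1_equality) (use assms in auto)
qed

lemma coord_lin:
  assumes "ibasis B"
  shows "coord B (s *\<^sub>R x + t *\<^sub>R y) j = s * coord B x j + t * coord B y j"
proof -
  have "coord B (s *\<^sub>R x + t *\<^sub>R y) = (\<lambda>j. s * coord B x j + t * coord B y j)"
    using assms by (intro coord_unique) (auto simp: coord_outside comb_lin comb_coord)
  then show ?thesis by simp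
qed

lemma linear_coord: "ibasis B \<Longrightarrow> linear (\<lambda>l. coord B l j)"
  using coord_lin[of B 1 _ 1 _ j] coord_lin[of B _ _ 0 0 j] by (intro linearI) auto

lemmas coord_add = linear_add[OF linear_coord]
lemmas coord_diff = linear_diff[OF linear_coord]
lemmas coord_scale = linear_scale[OF linear_coord, unfolded real_scaleR_def]
lemmas coord_zero = linear_0[OF linear_coord]

lemma coord_comb:
  assumes "ibasis B"
  shows "coord B (comb z) k = (\<Sum>j\<in>UNIV. z j * coord B (g j) k)"
  unfolding comb_def by (simp add: linear_sum[OF linear_coord[OF assms]] coord_scale[OF assms])

lemma continuous_on_coord: "ibasis B \<Longrightarrow> continuous_on S (\<lambda>l. coord B l j)"
  using linear_coord linear_conv_bounded_linear linear_continuous_on by blast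

lemma coord_gen:
  assumes "ibasis B" "k \<in> B"
  shows "coord B (g k) j = (if j = k then 1 else 0)"
proof -
  have "coord B (g k) = (\<lambda>j. if j = k then 1 else 0)"
    using assms(2) comb_unit[of k 1] by (intro coord_unique[OF assms(1)]) auto
  then show ?thesis by simp
qed

lemma cone_of_ibasis:
  assumes "ibasis B"
  shows "cone_of B = {l. \<forall>j. 0 \<le> coord B l j}"
proof (intro set_eqI iffI)
  fix l assume "l \<in> cone_of B"
  then obtain z where z: "l = comb z" "\<forall>j. 0 \<le> z j" "\<forall>j. j \<notin> B \<longrightarrow> z j = 0"
    unfolding cone_of_def by auto
  then have "coord B l = z" using coord_unique[OF assms, of z l] by auto
  then show "l \<in> {l. \<forall>j. 0 \<le> coord B l j}" using z by simp
next
  fix l assume "l \<in> {l. \<forall>j. 0 \<le> coord B l j}"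
  then show "l \<in> cone_of B" unfolding cone_of_def using coord_ex[OF assms, of l]
    by (smt (verit, best) mem_Collect_eq)
qed

lemma cone_of_lin:
  assumes "x \<in> cone_of Y" "y \<in> cone_of Y" "0 \<le> s" "0 \<le> t"
  shows "s *\<^sub>R x + t *\<^sub>R y \<in> cone_of Y"
proof -
  obtain z z' where "x = comb z" "y = comb z'" "\<forall>j. 0 \<le> z j" "\<forall>j. 0 \<le> z' j"
      "\<forall>j. j \<notin> Y \<longrightarrow> z j = 0" "\<forall>j. j \<notin> Y \<longrightarrow> z' j = 0"
    using assms unfolding cone_of_def by auto
  then show ?thesis unfolding cone_of_def using assms comb_lin[of s z t z']
    by (intro CollectI exI[of _ "\<lambda>j. s * z j + t * z' j"]) auto
qed

lemma cone_of_eq_hull: "cone_of Y = convex_cone hull (g ` Y)"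
proof (rule equalityI)
  have conv: "convex_cone (cone_of Y)"
    unfolding convex_cone_iff using cone_of_lin[of _ Y _ 1 1] cone_of_lin[of _ Y _ _ 0]
    by (auto simp: cone_of_def intro!: exI[of _ "\<lambda>_. 0"] simp: comb_zero)
  have "g ` Y \<subseteq> cone_of Y"
  proof clarify
    fix k assume "k \<in> Y"
    then show "g k \<in> cone_of Y" unfolding cone_of_def using comb_unit[of k 1]
      by (intro CollectI exI[of _ "\<lambda>j. if j = k then 1 else 0"]) auto
  qed
  then show "convex_cone hull (g ` Y) \<subseteq> cone_of Y" using conv by (simp add: hull_minimal)
next
  show "cone_of Y \<subseteq> convex_cone hull (g ` Y)"
  proof
    fix l assume "l \<in> cone_of Y"
    then obtain z where z: "l = comb z" "\<And>j. 0 \<le> z j" "\<And>j. j \<notin> Y \<Longrightarrow> z j = 0"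
      unfolding cone_of_def by auto
    have "(\<Sum>j\<in>Y. z j *\<^sub>R g j) \<in> convex_cone hull (g ` Y)"
      using z(2) finite_subset[OF subset_UNIV, of Y]
      by (induction Y rule: infinite_finite_induct)
         (auto simp: convex_cone_hull_contains_0 hull_inc intro!: convex_cone_hull_add convex_cone_hull_mul
               dest: subsetD[OF hull_mono[OF subset_insertI]])
    then show "l \<in> convex_cone hull (g ` Y)" using z comb_supp[of Y z] by simp
  qed
qed

lemma cone_of_ibasis_face:
  assumes "ibasis B" "l \<in> cone_of B" "\<And>j. j \<notin> Y \<Longrightarrow> coord B l j = 0"
  shows "l \<in> cone_of Y"
  unfolding cone_of_def using assms comb_coord[OF assms(1), of l]
  by (intro CollectI exI[of _ "coord B l"]) (auto simp: cone_of_ibasis)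

lemma ibasis_iff:
  "ibasis B \<longleftrightarrow> inj_on g B \<and> independent (g ` B) \<and> span (g ` B) = UNIV"
proof
  assume B: "ibasis B"
  have inj: "inj_on g B"
  proof (rule inj_onI)
    fix i j assume "i \<in> B" "j \<in> B" "g i = g j"
    then show "i = j" using coord_gen[OF B, of i i] coord_gen[OF B, of j i] by (auto split: if_splits)
  qed
  have "independent (g ` B)"
  proof -
    have "u v = 0" if u: "(\<Sum>v\<in>g ` B. u v *\<^sub>R v) = 0" "v \<in> g ` B" for u v
    proof -
      define z where "z j = (if j \<in> B then u (g j) else 0)" for j
      have "comb z = (\<Sum>j\<in>B. u (g j) *\<^sub>R g j)"
        by (subst comb_supp[of B]) (auto simp: z_def intro!: sum.cong)
      also have "\<dots> = 0" using u(1) by (simp add: sum.reindex[OF inj])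
      finally have "coord B 0 = z" by (intro coord_unique[OF B]) (auto simp: z_def)
      then have "z j = 0" for j using coord_zero[OF B] by metis
      then show ?thesis using u(2) by (metis imageE z_def)
    qed
    then show ?thesis by (subst dependent_finite) auto
  qed
  moreover have "l \<in> span (g ` B)" for l
  proof -
    have "l = (\<Sum>j\<in>B. coord B l j *\<^sub>R g j)"
      using comb_coord[OF B, of l] comb_supp[of B "coord B l"] coord_outside[OF B] by simp
    also have "\<dots> \<in> span (g ` B)" by (intro span_sum span_scale span_base) auto
    finally show ?thesis .
  qed
  ultimately show "inj_on g B \<and> independent (g ` B) \<and> span (g ` B) = UNIV" using inj by auto
next
  assume *: "inj_on g B \<and> independent (g ` B) \<and> span (g ` B) = UNIV"
  show "ibasis B"
    unfolding ibasis_def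
  proof (intro allI ex_ex1I)
    fix l
    have "l \<in> span (g ` B)" using * by simp
    then obtain u where u: "l = (\<Sum>v\<in>g ` B. u v *\<^sub>R v)" by (subst (asm) span_finite) auto
    define z where "z j = (if j \<in> B then u (g j) else 0)" for j
    have "comb z = (\<Sum>j\<in>B. u (g j) *\<^sub>R g j)"
      by (subst comb_supp[of B]) (auto simp: z_def intro!: sum.cong)
    also have "\<dots> = l" using * u by (simp add: sum.reindex)
    finally show "\<exists>z. (\<forall>j. j \<notin> B \<longrightarrow> z j = 0) \<and> comb z = l"
      by (intro exI[of _ z]) (auto simp: z_def)
  next
    fix l z y
    assume z: "(\<forall>j. j \<notin> B \<longrightarrow> z j = 0) \<and> comb z = l" and y: "(\<forall>j. j \<notin> B \<longrightarrow> y j = 0) \<and> comb y = l"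
    define u where "u v = (z (inv_into B g v) - y (inv_into B g v))" for v
    have "(\<Sum>v\<in>g ` B. u v *\<^sub>R v) = (\<Sum>j\<in>B. (z j - y j) *\<^sub>R g j)"
      using * by (auto simp: sum.reindex u_def intro!: sum.cong)
    also have "\<dots> = comb (\<lambda>j. z j - y j)" using z y by (subst comb_supp[of B]) auto
    also have "\<dots> = 0" using z y by (simp add: comb_diff)
    finally have "\<forall>v\<in>g ` B. u v = 0" using * by (subst (asm) dependent_finite) auto
    then have "z j = y j" if "j \<in> B" for j using that * by (auto simp: u_def)
    then show "z = y" using z y by (intro ext) metis
  qed
qed

lemma card_ibasis: "ibasis B \<Longrightarrow> card B = DIM('v)"
  unfolding ibasis_iff using dim_eq_card_independent[of "g ` B"] dim_span[of "g ` B"]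
  by (metis card_image dim_UNIV)

lemma ibasis_of_basis:
  assumes "S \<subseteq> g ` Y" "independent S" "span S = UNIV"
  shows "\<exists>B\<subseteq>Y. ibasis B \<and> g ` B = S"
  using assms unfolding ibasis_iff subset_image_inj by metis

lemma ibasis_subset:
  assumes "span (g ` Y) = UNIV"
  shows "\<exists>B\<subseteq>Y. ibasis B"
proof -
  obtain S where S: "S \<subseteq> g ` Y" "independent S" "g ` Y \<subseteq> span S"
    using maximal_independent_subset by blast
  then have "span S = UNIV" using assms span_minimal[OF S(3) subspace_span] by auto
  then show ?thesis using ibasis_of_basis[OF S(1,2)] by blast
qed

text \<open>The pivot of the simplex method: the expansion of \<open>g k\<close> in \<open>B\<close>
  can be solved for \<open>g b\<close>, because its coefficient at \<open>b\<close> is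
  nonzero.\<close>

lemma ibasis_exchange:
  assumes B: "ibasis B" "k \<notin> B" "b \<in> B" "coord B (g k) b \<noteq> 0"
  shows "ibasis (insert k (B - {b}))"
proof -
  let ?\<beta> = "coord B (g k)"
  show ?thesis unfolding ibasis_def
  proof (intro allI ex_ex1I)
    fix l
    let ?t = "coord B l b / ?\<beta> b"
    let ?z = "\<lambda>j. coord B l j - ?t * ?\<beta> j + (if j = k then ?t else 0)"
    have "comb ?z = l"
      by (simp only: comb_add comb_diff comb_scale comb_unit comb_coord[OF B(1)]) simp
    moreover have "?z j = 0" if "j \<notin> insert k (B - {b})" for j
      using that B by (cases "j = b") (auto simp: coord_outside)
    ultimately show "\<exists>z. (\<forall>j. j \<notin> insert k (B - {b}) \<longrightarrow> z j = 0) \<and> comb z = l"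
      by (intro exI[of _ ?z]) auto
  next
    fix l z y
    assume z: "(\<forall>j. j \<notin> insert k (B - {b}) \<longrightarrow> z j = 0) \<and> comb z = l"
       and y: "(\<forall>j. j \<notin> insert k (B - {b}) \<longrightarrow> y j = 0) \<and> comb y = l"
    let ?u = "\<lambda>j. z j - y j"
    have u0: "comb ?u = 0" using z y by (simp add: comb_diff)
    \<comment> \<open>Replacing \<open>g k\<close> by its expansion in \<open>B\<close> turns the
      relation \<open>?u\<close> into one supported on \<open>B\<close>, hence trivial.\<close>
    let ?v = "\<lambda>j. ?u j - (if j = k then ?u k else 0) + ?u k * ?\<beta> j"
    have "comb ?v = 0" using u0 
      by (simp add: comb_add comb_diff[of ?u] comb_scale comb_unit comb_coord[OF B(1)])
    then have v: "coord B 0 = ?v"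
      by (intro coord_unique[OF B(1)]) (use z y B in \<open>auto simp: coord_outside\<close>)
    then have v0: "?v j = 0" for j using coord_zero[OF B(1), of j] by metis
    have "z b = 0 \<and> y b = 0" using z y B by auto
    then have "?u k = 0" using v0[of b] B by (cases "b = k") auto
    then have "?u j = 0" for j using v0[of j] by (cases "j = k") auto
    then show "z = y" by (simp add: fun_eq_iff)
  qed
qed

text \<open>The ratio test of the simplex method: the smallest ratio is the longest step along
  \<open>- \<beta>\<close> that keeps all coordinates nonnegative, and the index attaining it drops
  to zero.\<close>

lemma ratio_test:
  fixes z \<beta> :: "'j \<Rightarrow> real"
  assumes "\<And>j. 0 \<le> z j" "0 < \<beta> k"
  shows "\<exists>t b. 0 < \<beta> b \<and> 0 \<le> t \<and> t = z b / \<beta> b \<and> (\<forall>j. 0 \<le> z j - t * \<beta> j)"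
proof -
  define T where "T = (\<lambda>j. z j / \<beta> j) ` {j. 0 < \<beta> j}"
  have T: "finite T" "T \<noteq> {}" using assms by (auto simp: T_def)
  have "Min T \<in> T" using Min_in[OF T] .
  then obtain b where b: "0 < \<beta> b" "Min T = z b / \<beta> b" by (auto simp: T_def)
  have "0 \<le> z j - Min T * \<beta> j" for j
  proof (cases "0 < \<beta> j")
    case True
    then have "Min T \<le> z j / \<beta> j" using T by (auto simp: T_def)
    then show ?thesis using True by (simp add: field_simps)
  next
    case False
    have "0 \<le> Min T" using b assms(1)[of b] by simp
    then show ?thesis using False assms(1)[of j] mult_nonneg_nonpos[of "Min T" "\<beta> j"] by simp
  qed
  then show ?thesis using b assms(1)[of b] by (intro exI[of _ "Min T"] exI[of _ b]) auto
qed

text \<open>A linear relation on \<open>Y\<close> with a positive coefficient can be subtracted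
  until some coordinate vanishes, which shrinks \<open>Y\<close>. Without relations \<open>Y\<close>
  is independent and extends to a basis among the generators, and enlarging the index set only
  enlarges the cone.\<close>

lemma caratheodory_cone:
  assumes "span (range g) = UNIV" "l \<in> cone_of Y"
  shows "\<exists>B. ibasis B \<and> l \<in> cone_of B"
  using assms(2)
proof (induction "card Y" arbitrary: Y rule: less_induct)
  case less
  obtain z where z: "l = comb z" "\<And>j. 0 \<le> z j" "\<And>j. j \<notin> Y \<Longrightarrow> z j = 0"
    using less.prems unfolding cone_of_def by auto
  show ?case
  proof (cases "\<exists>\<beta>. comb \<beta> = 0 \<and> (\<forall>j. j \<notin> Y \<longrightarrow> \<beta> j = 0) \<and> (\<exists>k. \<beta> k \<noteq> 0)")
    case True
    then obtain \<beta> k where "comb \<beta> = 0" "\<forall>j. j \<notin> Y \<longrightarrow> \<beta> j = 0" "\<beta> k \<noteq> 0" by auto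
    then have "\<exists>\<beta>. comb \<beta> = 0 \<and> (\<forall>j. j \<notin> Y \<longrightarrow> \<beta> j = 0) \<and> 0 < \<beta> k"
      using comb_scale[of "-1" \<beta>] by (cases "0 < \<beta> k") (blast, force intro!: exI[of _ "\<lambda>j. - 1 * \<beta> j"])
    then obtain \<beta> where \<beta>: "comb \<beta> = 0" "\<forall>j. j \<notin> Y \<longrightarrow> \<beta> j = 0" "0 < \<beta> k" by auto
    obtain t b where t: "0 < \<beta> b" "0 \<le> t" "t = z b / \<beta> b" "\<forall>j. 0 \<le> z j - t * \<beta> j"
      using ratio_test[of z \<beta> k] z(2) \<beta>(3) by blast
    have b: "b \<in> Y" using t \<beta> by force
    have "l \<in> cone_of (Y - {b})"
      unfolding cone_of_def
    proof (intro CollectI exI conjI allI impI)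
      show "l = comb (\<lambda>j. z j - t * \<beta> j)" using z \<beta> by (simp add: comb_diff comb_scale)
      show "z j - t * \<beta> j = 0" if "j \<notin> Y - {b}" for j
        using that t z \<beta> by (cases "j = b") auto
    qed (use t in auto)
    moreover have "card (Y - {b}) < card Y" using b by (intro card_Diff1_less) auto
    ultimately show ?thesis using less.hyps by blast
  next
    case False
    have inj: "inj_on g Y"
    proof (rule inj_onI, rule ccontr)
      fix i j assume ij: "i \<in> Y" "j \<in> Y" "g i = g j" "i \<noteq> j"
      let ?\<beta> = "\<lambda>k. (if k = i then 1 else 0) - (if k = j then 1 else 0) :: real"
      have "comb ?\<beta> = 0" using ij(3) by (simp add: comb_diff comb_unit)
      moreover have "\<forall>k. k \<notin> Y \<longrightarrow> ?\<beta> k = 0" using ij by auto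
      moreover have "?\<beta> i \<noteq> 0" using ij by simp
      ultimately show False using False by blast
    qed
    have "independent (g ` Y)"
    proof -
      have "u v = 0" if u: "(\<Sum>v\<in>g ` Y. u v *\<^sub>R v) = 0" "v \<in> g ` Y" for u v
      proof -
        define \<beta> where "\<beta> j = (if j \<in> Y then u (g j) else 0)" for j
        have "comb \<beta> = (\<Sum>j\<in>Y. u (g j) *\<^sub>R g j)"
          by (subst comb_supp[of Y]) (auto simp: \<beta>_def intro!: sum.cong)
        also have "\<dots> = 0" using u(1) by (simp add: sum.reindex[OF inj])
        finally have "comb \<beta> = 0" .
        moreover have "\<forall>j. j \<notin> Y \<longrightarrow> \<beta> j = 0" by (simp add: \<beta>_def)
        ultimately have "\<beta> j = 0" for j using False by blast
        then show ?thesis using u(2) by (metis imageE \<beta>_def)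
      qed
      then show ?thesis by (subst dependent_finite) auto
    qed
    then obtain S where S: "g ` Y \<subseteq> S" "S \<subseteq> range g" "independent S" "range g \<subseteq> span S"
      using maximal_independent_subset_extend[of "g ` Y" "range g"] by auto
    then have "span S = UNIV" using assms(1) span_minimal[OF S(4) subspace_span] by auto
    then obtain B where B: "ibasis B" "g ` B = S" using ibasis_of_basis[OF S(2,3)] by blast
    have "l \<in> cone_of B"
      using less.prems S(1) B(2) hull_mono[of "g ` Y" "g ` B" convex_cone] unfolding cone_of_eq_hull by auto
    then show ?thesis using B by blast
  qed
qed

end

section \<open>Chambers\<close>

context vector_configuration begin

lemma closed_cone_of: "ibasis B \<Longrightarrow> closed (cone_of B)"
  unfolding cone_of_ibasis using continuous_on_coord
  by (auto intro!: closed_Collect_all closed_Collect_le)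

lemma interior_cone_of:
  assumes B: "ibasis B"
  shows "interior (cone_of B) = {l. \<forall>j\<in>B. 0 < coord B l j}"
proof (rule equalityI)
  have "open (\<Inter>j\<in>B. {l. 0 < coord B l j})"
    using continuous_on_coord[OF B] by (intro open_INT) (auto intro!: open_Collect_less)
  moreover have "(\<Inter>j\<in>B. {l. 0 < coord B l j}) = {l. \<forall>j\<in>B. 0 < coord B l j}" by auto
  moreover have "{l. \<forall>j\<in>B. 0 < coord B l j} \<subseteq> cone_of B"
    unfolding cone_of_ibasis[OF B] using coord_outside[OF B] by (auto simp: less_imp_le) (metis less_imp_le order_refl)
  ultimately show "{l. \<forall>j\<in>B. 0 < coord B l j} \<subseteq> interior (cone_of B)"
    by (simp add: interior_maximal)
  show "interior (cone_of B) \<subseteq> {l. \<forall>j\<in>B. 0 < coord B l j}"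
  proof clarify
    fix l j assume l: "l \<in> interior (cone_of B)" and j: "j \<in> B"
    \<comment> \<open>An interior point can be moved slightly against \<open>g j\<close>, which
      lowers only the coordinate at \<open>j\<close>; so this coordinate was positive.\<close>
    have "((\<lambda>t. l - t *\<^sub>R g j) \<longlongrightarrow> l - 0 *\<^sub>R g j) (at_right 0)"
      by (intro tendsto_intros)
    then have "\<forall>\<^sub>F t in at_right 0. l - t *\<^sub>R g j \<in> interior (cone_of B)"
      using l by (intro topological_tendstoD) auto
    moreover have "\<forall>\<^sub>F t in at_right (0::real). 0 < t" by (simp add: eventually_at_right_less)
    ultimately have "\<forall>\<^sub>F t in at_right 0. l - t *\<^sub>R g j \<in> interior (cone_of B) \<and> 0 < t"
      by (rule eventually_conj)
    then obtain t where t: "l - t *\<^sub>R g j \<in> interior (cone_of B)" "0 < t"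
      using eventually_happens' by (metis (no_types, lifting) trivial_limit_at_right_real)
    then have "l - t *\<^sub>R g j \<in> cone_of B" using interior_subset by blast
    then have "0 \<le> coord B (l - t *\<^sub>R g j) j" by (simp add: cone_of_ibasis[OF B])
    also have "\<dots> = coord B l j - t" using j by (simp add: coord_diff[OF B] coord_scale[OF B] coord_gen[OF B])
    finally show "0 < coord B l j" using t(2) by simp
  qed
qed

section \<open>Linear programming on the fibres of \<open>comb\<close>\<close>

definition cost :: "('j \<Rightarrow> real) \<Rightarrow> 'j set \<Rightarrow> 'v \<Rightarrow> real" where
  "cost c B l = (\<Sum>j\<in>UNIV. c j * coord B l j)"

lemma linear_cost: "ibasis B \<Longrightarrow> linear (cost c B)"
  unfolding cost_def
  by (intro linearI)
     (auto simp: coord_add coord_scale algebra_simps sum.distrib sum_distrib_left)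

lemma cost_gen:
  assumes "ibasis B" "k \<in> B"
  shows "cost c B (g k) = c k"
  unfolding cost_def using coord_gen[OF assms] by (simp add: if_distrib[of "\<lambda>x. _ * x"] cong: if_cong)

text \<open>The reduced cost of the simplex method: the slope of the total cost when
  \<open>k\<close> enters and the coordinates in \<open>B\<close> compensate.\<close>

definition reduced_cost :: "('j \<Rightarrow> real) \<Rightarrow> 'j set \<Rightarrow> 'j \<Rightarrow> real" where
  "reduced_cost c B k = c k - cost c B (g k)"

lemma reduced_cost_basis: "ibasis B \<Longrightarrow> k \<in> B \<Longrightarrow> reduced_cost c B k = 0"
  by (simp add: reduced_cost_def cost_gen)

text \<open>An optimality certificate: if all reduced costs are nonnegative, no nonnegative solution
  is cheaper than the basic one. It follows by expanding every generator in
  \<open>B\<close>.\<close>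

lemma cost_comb:
  assumes "ibasis B"
  shows "(\<Sum>j\<in>UNIV. c j * z j) = cost c B (comb z) + (\<Sum>j\<in>UNIV. reduced_cost c B j * z j)"
proof -
  have "cost c B (comb z) = (\<Sum>j\<in>UNIV. z j * cost c B (g j))"
    using linear_cost[OF assms] unfolding comb_def by (simp add: linear_sum linear_scale)
  then show ?thesis by (simp add: reduced_cost_def algebra_simps sum.distrib sum_subtractf)
qed

definition walls :: "'v set" where
  "walls = (\<Union>B\<in>{B. ibasis B}. frontier (cone_of B))"

text \<open>The open chambers. As components they are connected by definition; their convexity comes
  out of \<open>cell_eq\<close>.\<close>

definition cells :: "'v set set" where
  "cells = components (UNIV - walls)"

end

text \<open>Positive spanning makes every linear program with constraint \<open>comb z = l\<close>
  feasible, and it provides representations whose coordinates are all positive.\<close>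

locale positive_configuration = vector_configuration g for g :: "'j::finite \<Rightarrow> 'v::euclidean_space" +
  assumes cone_of_UNIV: "cone_of UNIV = UNIV"
begin

lemma span_gens: "span (range g) = UNIV"
proof -
  have "l \<in> span (range g)" for l
  proof -
    obtain z where "l = comb z" using cone_of_UNIV unfolding cone_of_def by blast
    then show ?thesis unfolding comb_def by (auto intro: span_sum span_scale span_base)
  qed
  then show ?thesis by auto
qed

lemma not_wall_interior:
  assumes "x \<notin> walls" "ibasis B" "x \<in> cone_of B"
  shows "x \<in> interior (cone_of B)"
  using assms closed_cone_of[OF assms(2)] unfolding walls_def by (auto simp: frontier_def)

text \<open>Off the walls every feasible basis is nondegenerate, so a feasible basis of minimal cost
  admits no improving pivot and is therefore optimal.\<close>

lemma optimal_basis: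
  assumes x: "x \<notin> walls" and c: "\<And>j. 0 \<le> c j"
  shows "\<exists>B. ibasis B \<and> x \<in> cone_of B \<and> (\<forall>k. 0 \<le> reduced_cost c B k)"
proof -
  define F where "F = {B. ibasis B \<and> x \<in> cone_of B}"
  have "F \<noteq> {}" using caratheodory_cone[OF span_gens, of x UNIV] cone_of_UNIV by (auto simp: F_def)
  moreover have "finite F" by simp
  ultimately obtain B where B: "B \<in> F" "\<And>B'. B' \<in> F \<Longrightarrow> cost c B x \<le> cost c B' x"
    using ex_min_if_finite[of "(\<lambda>B. cost c B x) ` F"] by (auto simp: not_less)
  then have iB: "ibasis B" and xB: "x \<in> cone_of B" by (auto simp: F_def)
  have pos: "0 < coord B x j" if "j \<in> B" for j
    using not_wall_interior[OF x iB xB] that interior_cone_of[OF iB] by auto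
  have nonneg: "0 \<le> coord B x j" for j using xB by (simp add: cone_of_ibasis[OF iB])
  have "0 \<le> reduced_cost c B k" for k
  proof (rule ccontr)
    assume neg: "\<not> 0 \<le> reduced_cost c B k"
    then have k: "k \<notin> B" using reduced_cost_basis[OF iB] by auto
    show False
    proof (cases "\<exists>j. 0 < coord B (g k) j")
      case False
      \<comment> \<open>If \<open>g k\<close> has no positive coordinate, nonnegative prices give
        its expansion a cost of at most 0, so the reduced cost is at least \<open>c k\<close>,
        contrary to its being negative.\<close>
      then have "cost c B (g k) \<le> 0"
        unfolding cost_def using c by (intro sum_nonpos) (auto simp: mult_nonneg_nonpos not_less)
      then show False using neg c[of k] by (simp add: reduced_cost_def)
    next
      case True
      then obtain t b where t: "0 < coord B (g k) b" "0 \<le> t" "t = coord B x b / coord B (g k) b"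
          "\<forall>j. 0 \<le> coord B x j - t * coord B (g k) j"
        using ratio_test[of "coord B x" "coord B (g k)"] nonneg by blast
      have b: "b \<in> B" using t(1) coord_outside[OF iB] by force
      \<comment> \<open>Nondegeneracy enters here: the step is positive, so the pivot strictly
        lowers the cost.\<close>
      have t0: "0 < t" using t b pos by simp
      have tb: "coord B x b = t * coord B (g k) b" using t(1,3) by simp
      let ?B = "insert k (B - {b})"
      have iB': "ibasis ?B" using ibasis_exchange[OF iB k b] t by simp
      let ?z = "\<lambda>j. coord B x j - t * coord B (g k) j + (if j = k then t else 0)"
      have zx: "comb ?z = x"
        by (simp only: comb_add comb_diff comb_scale comb_unit comb_coord[OF iB]) simp
      have zB: "?z j = 0" if "j \<notin> ?B" for j
        using that k b tb by (cases "j = b") (auto simp: coord_outside[OF iB])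
      have z: "coord ?B x = ?z" by (rule coord_unique[OF iB' zB zx])
      have "x \<in> cone_of ?B" using t(2,4) by (simp add: cone_of_ibasis[OF iB'] z add_nonneg_nonneg)
      then have "cost c B x \<le> cost c ?B x" using B(2) iB' by (simp add: F_def)
      also have "\<dots> = cost c B x - t * cost c B (g k) + t * c k"
        unfolding cost_def z
        by (simp add: algebra_simps sum.distrib sum_subtractf sum_distrib_left if_distrib[of "\<lambda>x. _ * x"] cong: if_cong)
      also have "\<dots> = cost c B x + t * reduced_cost c B k" by (simp add: reduced_cost_def algebra_simps)
      finally have "0 \<le> t * reduced_cost c B k" by simp
      then show False using t0 neg by (simp add: zero_le_mult_iff)
    qed
  qed
  then show ?thesis using iB xB by blast
qed

lemma cell_not_wall: "U \<in> cells \<Longrightarrow> x \<in> U \<Longrightarrow> x \<notin> walls"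
  unfolding cells_def using in_components_subset by blast

lemma cell_nonempty: "U \<in> cells \<Longrightarrow> U \<noteq> {}"
  unfolding cells_def using in_components_nonempty by blast

lemma cell_in_cone:
  assumes U: "U \<in> cells" "x \<in> U" and B: "ibasis B" "x \<in> cone_of B"
  shows "U \<subseteq> interior (cone_of B)"
proof (rule ccontr)
  assume "\<not> U \<subseteq> interior (cone_of B)"
  moreover have "U \<inter> frontier (cone_of B) = {}"
    using U cell_not_wall B unfolding walls_def by blast
  moreover have "connected U" using U by (simp add: cells_def in_components_connected)
  ultimately have "\<not> U - cone_of B \<noteq> {}"
    using connected_Int_frontier[of U "cone_of B"] U B by auto
  then have "U \<subseteq> cone_of B" by auto
  then have "U \<subseteq> interior (cone_of B)"
    using \<open>U \<inter> frontier (cone_of B) = {}\<close> closed_cone_of[OF B(1)] by (auto simp: frontier_def)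
  then show False using \<open>\<not> U \<subseteq> interior (cone_of B)\<close> by simp
qed

definition cell_bases :: "'v set \<Rightarrow> 'j set set" where
  "cell_bases U = {B. ibasis B \<and> U \<subseteq> cone_of B}"

lemma cell_bases_iff:
  assumes "U \<in> cells" "x \<in> U"
  shows "B \<in> cell_bases U \<longleftrightarrow> ibasis B \<and> x \<in> cone_of B"
  using assms cell_in_cone[OF assms, of B] interior_subset[of "cone_of B"] unfolding cell_bases_def by blast

text \<open>The intersection of open cones is convex, so it only has to avoid the walls. If it
  contained a point \<open>y\<close> on a facet of a basis cone, charge 1 for every generator
  outside this facet: \<open>y\<close> can be had for free, while an optimal basis for a point of
  the cell, feasible for \<open>y\<close> too, must use a generator that is charged.\<close>

lemma cell_eq:
  assumes U: "U \<in> cells"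
  shows "U = {l. \<forall>B\<in>cell_bases U. l \<in> interior (cone_of B)}" (is "U = ?V")
proof (rule equalityI)
  obtain x where x: "x \<in> U" using cell_nonempty[OF U] by blast
  show "U \<subseteq> ?V"
    using cell_in_cone[OF U] cell_bases_iff[OF U] by blast
  have V: "?V \<inter> walls = {}"
  proof (rule ccontr)
    assume "?V \<inter> walls \<noteq> {}"
    then obtain y B0 where y: "y \<in> ?V" "ibasis B0" "y \<in> frontier (cone_of B0)" unfolding walls_def by auto
    then have yB: "y \<in> cone_of B0" "y \<notin> interior (cone_of B0)"
      using closed_cone_of[OF y(2)] by (auto simp: frontier_def)
    then obtain i where i: "i \<in> B0" "coord B0 y i \<le> 0" unfolding interior_cone_of[OF y(2)] by (auto simp: not_less)
    then have i0: "coord B0 y i = 0" using yB(1) by (simp add: cone_of_ibasis[OF y(2)] antisym)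
    define c :: "'j \<Rightarrow> real" where "c j = (if j \<in> B0 - {i} then 0 else 1)" for j
    have c0: "0 \<le> c j" for j by (simp add: c_def)
    obtain B where B: "ibasis B" "x \<in> cone_of B" "\<And>k. 0 \<le> reduced_cost c B k"
      using optimal_basis[of x c, OF cell_not_wall[OF U x] c0] by auto
    have yint: "y \<in> interior (cone_of B)" using y(1) B cell_bases_iff[OF U x] by blast
    have "(\<Sum>j\<in>UNIV. c j * coord B0 y j) = 0"
      by (intro sum.neutral) (auto simp: c_def i0 coord_outside[OF y(2)])
    moreover have "0 \<le> (\<Sum>j\<in>UNIV. reduced_cost c B j * coord B0 y j)"
      using B(3) yB(1) by (intro sum_nonneg) (auto simp: cone_of_ibasis[OF y(2)])
    ultimately have "cost c B y \<le> 0"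
      using cost_comb[OF B(1), of c "coord B0 y"] comb_coord[OF y(2)] by simp
    moreover have "0 < cost c B y"
    proof -
      have "card B = card B0" using card_ibasis B(1) y(2) by simp
      \<comment> \<open>All bases have the same cardinality, so \<open>B\<close> does not fit into
        the facet.\<close>
      then have "\<not> B \<subseteq> B0 - {i}" using i(1) card_mono[of "B0 - {i}" B] card_Diff1_less[of B0 i] by auto
      then obtain j where j: "j \<in> B" "j \<notin> B0 - {i}" by auto
      have pos: "\<forall>j\<in>B. 0 < coord B y j" using yint interior_cone_of[OF B(1)] by auto
      have "0 < c j * coord B y j" using j pos by (simp add: c_def)
      also have "\<dots> \<le> cost c B y" unfolding cost_def
      proof (rule member_le_sum)
        show "0 \<le> c k * coord B y k" for k
          using pos coord_outside[OF B(1), of k y] by (cases "k \<in> B") (auto simp: c_def less_imp_le)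
      qed auto
      finally show ?thesis .
    qed
    ultimately show False by simp
  qed
  have "convex ?V"
  proof -
    have "?V = (\<Inter>B\<in>cell_bases U. interior (cone_of B))" by auto
    then show ?thesis
      by (auto intro!: convex_INT convex_interior simp: cone_of_eq_hull convex_convex_cone_hull)
  qed
  then have "connected ?V" by (rule convex_connected)
  then show "?V \<subseteq> U"
    using components_maximal[of U "UNIV - walls" ?V] U V x \<open>U \<subseteq> ?V\<close> unfolding cells_def by auto
qed

lemma cell_iff:
  assumes "U \<in> cells"
  shows "l \<in> U \<longleftrightarrow> (\<forall>B\<in>cell_bases U. \<forall>j\<in>B. 0 < coord B l j)"
  using cell_eq[OF assms] interior_cone_of by (auto simp: cell_bases_def)

text \<open>The hypothesis on \<open>l\<close> describes the closure of the cell, but that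
  description is derived only afterwards, with the help of this lemma.\<close>

lemma cell_shift_aux:
  assumes U: "U \<in> cells" and l: "\<And>B. B \<in> cell_bases U \<Longrightarrow> l \<in> cone_of B" and x: "x \<in> U" and t: "0 < t"
  shows "l + t *\<^sub>R x \<in> U"
proof (subst cell_iff[OF U], intro ballI)
  fix B j assume B: "B \<in> cell_bases U" and j: "j \<in> B"
  then have iB: "ibasis B" by (simp add: cell_bases_def)
  have "0 < coord B x j" using x B j cell_iff[OF U] by blast
  moreover have "0 \<le> coord B l j" using l[OF B] by (simp add: cone_of_ibasis[OF iB])
  ultimately show "0 < coord B (l + t *\<^sub>R x) j"
    using t by (simp add: coord_add[OF iB] coord_scale[OF iB] add_nonneg_pos)
qed

lemma closure_cell:
  assumes U: "U \<in> cells"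
  shows "closure U = {l. \<forall>B\<in>cell_bases U. l \<in> cone_of B}" (is "_ = ?V")
proof (rule equalityI)
  have "closed (\<Inter>B\<in>cell_bases U. cone_of B)"
    using closed_cone_of by (intro closed_INT) (auto simp: cell_bases_def)
  moreover have "(\<Inter>B\<in>cell_bases U. cone_of B) = ?V" by auto
  moreover have "U \<subseteq> ?V" by (auto simp: cell_bases_def)
  ultimately show "closure U \<subseteq> ?V" by (simp add: closure_minimal)
  show "?V \<subseteq> closure U"
  proof
    fix l assume l: "l \<in> ?V"
    obtain x where x: "x \<in> U" using cell_nonempty[OF U] by blast
    have in_U: "l + t *\<^sub>R x \<in> U" if "0 < t" for t
      using cell_shift_aux[OF U _ x that] l by blast
    have "((\<lambda>t. l + t *\<^sub>R x) \<longlongrightarrow> l + 0 *\<^sub>R x) (at_right 0)" by (intro tendsto_intros)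
    moreover have "\<forall>\<^sub>F t in at_right 0. l + t *\<^sub>R x \<in> closure U"
      using eventually_at_right_less[of "0::real"]
      by eventually_elim (use in_U closure_subset in blast)
    ultimately show "l \<in> closure U"
      using Lim_in_closed_set[of "closure U" "\<lambda>t. l + t *\<^sub>R x" "at_right 0"] by simp
  qed
qed

lemma cell_shift:
  assumes "U \<in> cells" "l \<in> closure U" "x \<in> U" "0 < t"
  shows "l + t *\<^sub>R x \<in> U"
  using assms by (intro cell_shift_aux) (auto simp: closure_cell)

lemma open_cell:
  assumes U: "U \<in> cells"
  shows "open U"
proof -
  have "U = (\<Inter>B\<in>cell_bases U. interior (cone_of B))" using cell_eq[OF U] by auto
  moreover have "open (\<Inter>B\<in>cell_bases U. interior (cone_of B))" by (intro open_INT) auto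
  ultimately show ?thesis by simp
qed

lemma interior_closure_cell:
  assumes U: "U \<in> cells"
  shows "interior (closure U) = U"
proof (rule equalityI)
  show "U \<subseteq> interior (closure U)" by (simp add: closure_subset interior_maximal open_cell[OF U])
  show "interior (closure U) \<subseteq> U"
  proof
    fix l assume "l \<in> interior (closure U)"
    moreover have "interior (closure U) \<subseteq> interior (cone_of B)" if "B \<in> cell_bases U" for B
      using that closure_cell[OF U] by (intro interior_mono) auto
    ultimately show "l \<in> U" using cell_eq[OF U] by blast
  qed
qed

text \<open>The optimal value of the linear program that charges for the generators outside \<open>Y\<close> is
  additive on each chamber and vanishes exactly on \<open>cone_of Y\<close>.\<close>

lemma cell_face:
  assumes U: "U \<in> cells" and uw: "u \<in> closure U" "w \<in> closure U"
    and st: "0 < s" "0 < t" and Y: "s *\<^sub>R u + t *\<^sub>R w \<in> cone_of Y"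
  shows "u \<in> cone_of Y"
proof -
  obtain x where x: "x \<in> U" using cell_nonempty[OF U] by blast
  define c :: "'j \<Rightarrow> real" where "c j = (if j \<in> Y then 0 else 1)" for j
  have c0: "0 \<le> c j" for j by (simp add: c_def)
  obtain B where B: "ibasis B" "x \<in> cone_of B" "\<And>k. 0 \<le> reduced_cost c B k"
    using optimal_basis[of x c, OF cell_not_wall[OF U x] c0] by auto
  have BU: "B \<in> cell_bases U" using B cell_bases_iff[OF U x] by blast
  have pos: "0 \<le> coord B v j" if "v \<in> closure U" for v j
    using that BU B(1) closure_cell[OF U] by (auto simp: cone_of_ibasis)
  have cost_nonneg: "0 \<le> cost c B v" if "v \<in> closure U" for v
    unfolding cost_def using pos[OF that] by (intro sum_nonneg) (auto simp: c_def)
  obtain z where z: "s *\<^sub>R u + t *\<^sub>R w = comb z" "\<forall>j. 0 \<le> z j" "\<forall>j. j \<notin> Y \<longrightarrow> z j = 0"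
    using Y unfolding cone_of_def by auto
  have "(\<Sum>j\<in>UNIV. c j * z j) = 0" using z by (intro sum.neutral) (auto simp: c_def)
  moreover have "0 \<le> (\<Sum>j\<in>UNIV. reduced_cost c B j * z j)"
    using z B by (intro sum_nonneg) auto
  ultimately have "cost c B (s *\<^sub>R u + t *\<^sub>R w) \<le> 0" using cost_comb[OF B(1), of c z] z by simp
  then have "s * cost c B u + t * cost c B w \<le> 0"
    using linear_cost[OF B(1), of c] by (simp add: linear_add linear_scale)
  moreover have "0 \<le> t * cost c B w" using st cost_nonneg[OF uw(2)] by simp
  ultimately have "s * cost c B u \<le> 0" by linarith
  then have "cost c B u = 0" using st cost_nonneg[OF uw(1)] by (simp add: mult_le_0_iff)
  then have "\<forall>j\<in>UNIV. c j * coord B u j = 0"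
    unfolding cost_def using pos[OF uw(1)] by (subst (asm) sum_nonneg_eq_0_iff) (auto simp: c_def)
  then have "coord B u j = 0" if "j \<notin> Y" for j using that by (auto simp: c_def split: if_splits)
  moreover have "u \<in> cone_of B" using uw BU closure_cell[OF U] by auto
  ultimately show ?thesis using cone_of_ibasis_face[OF B(1)] by blast
qed

end

section \<open>The Lawrence--Varchenko decomposition\<close>

context vector_configuration begin

definition polar_sign :: "('j \<Rightarrow> real) \<Rightarrow> 'j set \<Rightarrow> 'j set \<Rightarrow> int" where
  "polar_sign c J B = (-1) ^ card {j \<in> J - B. reduced_cost c B j < 0}"

text \<open>With \<open>S\<close> the set of negative coordinates of \<open>z\<close>, this says
  that \<open>z\<close> lies in the cone at the vertex of \<open>B\<close> after the edges of
  negative reduced cost have been flipped, so that the cost grows along every edge. Zeros do not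
  belong to \<open>S\<close>, hence the facets of flipped coordinates are excluded and the cone is
  half-open.\<close>

definition polar_match :: "('j \<Rightarrow> real) \<Rightarrow> 'j set \<Rightarrow> 'j set \<Rightarrow> 'j set \<Rightarrow> bool" where
  "polar_match c J B S \<longleftrightarrow> (\<forall>j\<in>J - B. j \<in> S \<longleftrightarrow> reduced_cost c B j < 0)"

text \<open>The difference of the two sides of the decomposition for the generators in
  \<open>J\<close>. Neither \<open>S\<close> nor \<open>J\<close> is tied to a point, so that signs
  can be changed and generators deleted one at a time.\<close>

definition lv_defect :: "('j \<Rightarrow> real) \<Rightarrow> 'v \<Rightarrow> 'j set \<Rightarrow> 'j set \<Rightarrow> int" where
  "lv_defect c l J S = of_bool (S = {}) -
     (\<Sum>B | ibasis B \<and> B \<subseteq> J \<and> l \<in> cone_of B. polar_sign c J B * of_bool (polar_match c J B S))"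

text \<open>No edge at any vertex is level, so each edge has a definite polarization; nonnegative
  prices make all vertices cost at least 0.\<close>

definition generic_cost :: "('j \<Rightarrow> real) \<Rightarrow> bool" where
  "generic_cost c \<longleftrightarrow> (\<forall>j. 0 \<le> c j) \<and> (\<forall>B j. ibasis B \<longrightarrow> j \<notin> B \<longrightarrow> reduced_cost c B j \<noteq> 0)"

text \<open>A basis containing \<open>u\<close> ignores the sign at \<open>u\<close>. For any other
  basis at most one of the two sets matches, and the factor -1 for a flipped \<open>u\<close> is
  offset by the minus sign of the difference.\<close>

lemma polar_term_delete:
  assumes c: "generic_cost c" and B: "ibasis B" and u: "u \<in> J" "u \<notin> S"
  shows "polar_sign c J B * of_bool (polar_match c J B S) - polar_sign c J B * of_bool (polar_match c J B (insert u S))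
    = (if u \<in> B then 0 else polar_sign c (J - {u}) B * of_bool (polar_match c (J - {u}) B S))"
proof (cases "u \<in> B")
  case True
  then have "polar_match c J B (insert u S) = polar_match c J B S" by (auto simp: polar_match_def)
  then show ?thesis using True by simp
next
  case False
  have m1: "polar_match c J B S \<longleftrightarrow> polar_match c (J - {u}) B S \<and> \<not> reduced_cost c B u < 0"
    using False u unfolding polar_match_def by auto
  have m2: "polar_match c J B (insert u S) \<longleftrightarrow> polar_match c (J - {u}) B S \<and> reduced_cost c B u < 0"
    using False u unfolding polar_match_def by auto
  show ?thesis
  proof (cases "reduced_cost c B u < 0")
    case True
    have "{j \<in> J - B. reduced_cost c B j < 0} = insert u {j \<in> J - {u} - B. reduced_cost c B j < 0}"
      using False u True by auto
    then have "polar_sign c J B = - polar_sign c (J - {u}) B" by (simp add: polar_sign_def)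
    then show ?thesis using m1 m2 True False by simp
  next
    case nneg: False
    then have "{j \<in> J - B. reduced_cost c B j < 0} = {j \<in> J - {u} - B. reduced_cost c B j < 0}" by auto
    then have "polar_sign c J B = polar_sign c (J - {u}) B" by (simp add: polar_sign_def)
    then show ?thesis using m1 m2 False nneg by simp
  qed
qed

text \<open>Letting the coordinate at \<open>u\<close> cross zero changes the defect by that of the
  configuration without \<open>u\<close>; this drives the induction on the number of
  generators.\<close>

lemma lv_defect_delete:
  assumes c: "generic_cost c" and u: "u \<in> J" "u \<notin> S"
  shows "lv_defect c l J S - lv_defect c l J (insert u S) = lv_defect c l (J - {u}) S"
proof -
  let ?F = "{B. ibasis B \<and> B \<subseteq> J \<and> l \<in> cone_of B}"
  let ?G = "{B. ibasis B \<and> B \<subseteq> J - {u} \<and> l \<in> cone_of B}"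
  let ?t = "\<lambda>J S B. polar_sign c J B * of_bool (polar_match c J B S) :: int"
  have "(\<Sum>B\<in>?F. ?t J S B) - (\<Sum>B\<in>?F. ?t J (insert u S) B)
      = (\<Sum>B\<in>?F. if u \<in> B then 0 else ?t (J - {u}) S B)"
    unfolding sum_subtractf[symmetric] using polar_term_delete[OF c _ u] by (intro sum.cong) auto
  also have "\<dots> = (\<Sum>B\<in>?G. ?t (J - {u}) S B)"
    by (rule sum.mono_neutral_cong_right) auto
  finally show ?thesis by (simp add: lv_defect_def)
qed

text \<open>The elements of \<open>X\<close> are added one by one; each addition costs the defect of
  a further deletion, which vanishes by \<open>IH\<close>. The induction has to vary the deleted set
  \<open>V\<close>.\<close>

lemma lv_defect_extend:
  assumes c: "generic_cost c" and T: "T \<subseteq> J" "S \<inter> T = {}"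
    and IH: "\<And>V. V \<subseteq> T \<Longrightarrow> V \<noteq> {} \<Longrightarrow> lv_defect c l (J - V) S = 0"
    and "X \<subseteq> T" "V \<subseteq> T - X"
  shows "lv_defect c l (J - V) (S \<union> X) = lv_defect c l (J - V) S"
proof -
  have "finite X" by simp
  then show ?thesis using assms(5,6)
  proof (induction X arbitrary: V)
    case (insert u X)
    have "lv_defect c l (J - V) (S \<union> X) - lv_defect c l (J - V) (insert u (S \<union> X)) =
        lv_defect c l (J - V - {u}) (S \<union> X)"
      using insert T by (intro lv_defect_delete[OF c]) auto
    also have "J - V - {u} = J - insert u V" by auto
    also have "lv_defect c l (J - insert u V) (S \<union> X) = lv_defect c l (J - insert u V) S"
      using insert by (intro insert.IH) auto
    also have "\<dots> = 0" using insert by (intro IH) auto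
    finally show ?case using insert.IH[of V] insert.prems by auto
  qed simp
qed

lemma locally_const_real:
  fixes F :: "real \<Rightarrow> 'a"
  assumes "\<And>t0. \<forall>\<^sub>F t in at t0. F t = F t0"
  shows "F s = F t"
  by (rule connected_local_const[of UNIV]) (use assms in \<open>auto simp: eq_commute[of "F _" "F _"]\<close>)

text \<open>Moving \<open>z\<close> along a line in the fibre of \<open>comb\<close>, the defect can only change when coordinates
  \<open>T\<close> vanish, and there the jump is a combination of defects of deletions of \<open>T\<close>. Far out along a
  direction of negative cost both sides of the identity vanish.\<close>

lemma lv_defect_generic:
  assumes c: "generic_cost c"
    and generic: "\<And>Y. l \<in> span (g ` Y) \<Longrightarrow> span (g ` Y) = UNIV"
    and "comb z = l" "\<And>j. j \<notin> J \<Longrightarrow> z j = 0"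
  shows "lv_defect c l J {j. z j < 0} = 0"
  using assms(3,4)
proof (induction "card J" arbitrary: J z rule: less_induct)
  case less
  \<comment> \<open>Genericity of \<open>l\<close> guarantees that every subconfiguration able to
    represent \<open>l\<close> still contains a basis; this property survives the deletions.\<close>
  have "l \<in> span (g ` J)"
    using less.prems comb_supp[of J z] by (auto intro: span_sum span_scale span_base)
  then obtain B0 where B0: "B0 \<subseteq> J" "ibasis B0" using generic ibasis_subset by meson
  show ?case
  proof (cases "B0 = J")
    case True
    have "B = J" if "ibasis B" "B \<subseteq> J" for B
      using that B0 True card_ibasis by (intro card_subset_eq) auto
    then have F: "{B. ibasis B \<and> B \<subseteq> J \<and> l \<in> cone_of B} = (if l \<in> cone_of J then {J} else {})"
      using B0 True by auto
    have "coord J l = z" using coord_unique[of J z l] less.prems B0 True by auto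
    then have "l \<in> cone_of J \<longleftrightarrow> {j. z j < 0} = {}"
      using B0 True by (auto simp: cone_of_ibasis not_less)
    moreover have "polar_sign c J J = 1" unfolding polar_sign_def Diff_cancel by simp
    ultimately show ?thesis unfolding lv_defect_def F by (auto simp: polar_match_def)
  next
    case False
    then obtain k where k: "k \<in> J" "k \<notin> B0" using B0 by auto
    define r where "r = reduced_cost c B0 k"
    have r0: "r \<noteq> 0" using c B0 k by (simp add: generic_cost_def r_def)
    \<comment> \<open>The elementary relation that expresses \<open>g k\<close> through
      \<open>B0\<close>, signed so that the cost falls along it with slope
      \<open>\<bar>r\<bar>\<close>.\<close>
    define w where "w j = - sgn r * ((if j = k then 1 else 0) - coord B0 (g k) j)" for j
    have w_comb: "comb w = 0"
      unfolding w_def using comb_scale[of "- sgn r" "\<lambda>j. (if j = k then 1 else 0) - coord B0 (g k) j"]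
      by (simp add: comb_diff comb_unit comb_coord[OF B0(2)])
    have w_supp: "w j = 0" if "j \<notin> J" for j
      using that B0 k coord_outside[OF B0(2), of j] by (auto simp: w_def)
    have w_cost: "(\<Sum>j\<in>UNIV. c j * w j) = - \<bar>r\<bar>"
    proof -
      have "(\<Sum>j\<in>UNIV. c j * w j) = (\<Sum>j\<in>UNIV. - sgn r * (c j * (if j = k then 1 else 0) - c j * coord B0 (g k) j))"
        by (intro sum.cong) (auto simp: w_def algebra_simps)
      also have "\<dots> = - sgn r * (c k - cost c B0 (g k))"
        by (simp only: sum_distrib_left[symmetric] sum_subtractf cost_def)
           (simp add: if_distrib[of "\<lambda>x. _ * x"] cong: if_cong)
      also have "\<dots> = - \<bar>r\<bar>" by (simp add: r_def[unfolded reduced_cost_def, symmetric] abs_sgn mult.commute)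
      finally show ?thesis .
    qed
    let ?zt = "\<lambda>t j. z j + t * w j"
    have zt_comb: "comb (?zt t) = l" for t
      using less.prems w_comb by (simp add: comb_add comb_scale)
    have zt_supp: "?zt t j = 0" if "j \<notin> J" for t j using that less.prems w_supp by simp
    define F where "F t = lv_defect c l J {j. ?zt t j < 0}" for t
    have loc: "\<forall>\<^sub>F t in at t0. F t = F t0" for t0
    proof -
      \<comment> \<open>Only these coordinates can change sign near \<open>t0\<close>. The point
        \<open>?zt t0\<close> vanishes on \<open>T\<close>, so it also solves the problem for every
        deletion of a part of \<open>T\<close>, and the induction hypothesis applies to it.\<close>
      define T where "T = {j \<in> J. ?zt t0 j = 0}"
      define S where "S = {j. ?zt t0 j < 0}"
      have "\<forall>\<^sub>F t in at t0. j \<in> T \<or> (?zt t j < 0 \<longleftrightarrow> j \<in> S)" for j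
      proof -
        have lim: "((\<lambda>t. ?zt t j) \<longlongrightarrow> ?zt t0 j) (at t0)" by (intro tendsto_intros)
        consider "?zt t0 j < 0" | "?zt t0 j > 0" | "j \<in> T" | "j \<notin> J"
          unfolding T_def by fastforce
        then show ?thesis
        proof cases
          case 1
          then show ?thesis using order_tendstoD(2)[OF lim] by (auto simp: S_def elim: eventually_mono)
        next
          case 2
          from order_tendstoD(1)[OF lim 2] show ?thesis
            by eventually_elim (use 2 in \<open>auto simp: S_def\<close>)
        next
          case 4
          then show ?thesis using zt_supp by (auto simp: S_def)
        qed auto
      qed
      then have "\<forall>\<^sub>F t in at t0. \<forall>j. j \<in> T \<or> (?zt t j < 0 \<longleftrightarrow> j \<in> S)" by (rule eventually_all_finite)
      then show ?thesis
      proof eventually_elim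
        case (elim t)
        have ST: "S \<inter> T = {}" by (auto simp: S_def T_def)
        have "{j. ?zt t j < 0} = S \<union> ({j. ?zt t j < 0} \<inter> T)" using elim ST by blast
        moreover have "lv_defect c l (J - {}) (S \<union> ({j. ?zt t j < 0} \<inter> T)) = lv_defect c l (J - {}) S"
        proof (rule lv_defect_extend[OF c _ ST, of J])
          fix V assume V: "V \<subseteq> T" "V \<noteq> {}"
          then have "V \<subseteq> J" by (auto simp: T_def)
          then have "card (J - V) < card J" using V by (intro psubset_card_mono) auto
          then show "lv_defect c l (J - V) S = 0"
            unfolding S_def using V zt_comb zt_supp by (intro less.hyps) (auto simp: T_def)
        qed (auto simp: T_def)
        ultimately show ?case by (simp add: F_def S_def)
      qed
    qed
    \<comment> \<open>Chosen to bring the total cost down to -1. Nonnegative solutions and solutions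
      in a polarized cone have nonnegative cost, so every term of the defect is 0 at this
      parameter.\<close>
    define t where "t = ((\<Sum>j\<in>UNIV. c j * z j) + 1) / \<bar>r\<bar>"
    have neg: "(\<Sum>j\<in>UNIV. c j * ?zt t j) < 0"
    proof -
      have "(\<Sum>j\<in>UNIV. c j * ?zt t j) = (\<Sum>j\<in>UNIV. c j * z j) + t * (\<Sum>j\<in>UNIV. c j * w j)"
        by (simp add: algebra_simps sum.distrib sum_distrib_left)
      also have "\<dots> = -1" using r0 by (simp add: w_cost t_def)
      finally show ?thesis by simp
    qed
    have "F t = 0"
    proof -
      have "{j. ?zt t j < 0} \<noteq> {}"
      proof
        assume "{j. ?zt t j < 0} = {}"
        then have "0 \<le> (\<Sum>j\<in>UNIV. c j * ?zt t j)"
          using c by (intro sum_nonneg) (auto simp: generic_cost_def not_less)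
        then show False using neg by simp
      qed
      moreover have "\<not> polar_match c J B {j. ?zt t j < 0}" if B: "ibasis B" "l \<in> cone_of B" for B
      proof
        assume m: "polar_match c J B {j. ?zt t j < 0}"
        have "0 \<le> reduced_cost c B j * ?zt t j" for j
        proof (cases "j \<in> J - B")
          case True
          then have "?zt t j < 0 \<longleftrightarrow> reduced_cost c B j < 0" using m by (simp add: polar_match_def)
          then show ?thesis by (auto simp: zero_le_mult_iff not_less)
        next
          case False
          then show ?thesis using zt_supp[of j t] reduced_cost_basis[OF B(1), of j] by auto
        qed
        then have "0 \<le> (\<Sum>j\<in>UNIV. reduced_cost c B j * ?zt t j)" by (intro sum_nonneg) auto
        moreover have "0 \<le> cost c B l"
          unfolding cost_def using B c by (intro sum_nonneg) (auto simp: generic_cost_def cone_of_ibasis)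
        ultimately show False using neg cost_comb[OF B(1), of c "?zt t"] zt_comb[of t] by simp
      qed
      ultimately show ?thesis unfolding F_def lv_defect_def by (auto intro!: sum.neutral)
    qed
    moreover have "F 0 = F t" using locally_const_real[of F] loc by blast
    ultimately show ?thesis by (simp add: F_def)
  qed
qed

end

context positive_configuration begin

text \<open>Represent \<open>p\<close> minus the sum of all generators and add 1 to each coordinate.
  This supplies perturbation directions whose coordinates all have the same sign.\<close>

lemma positive_combination: "\<exists>u. comb u = p \<and> (\<forall>j. 1 \<le> u j)"
proof -
  have "p - comb (\<lambda>_. 1) \<in> cone_of UNIV" by (simp add: cone_of_UNIV)
  then obtain z where z: "p - comb (\<lambda>_. 1) = comb z" "\<And>j. 0 \<le> z j" unfolding cone_of_def by auto
  have "comb (\<lambda>j. z j + 1) = p" using z(1) by (simp add: comb_add algebra_simps flip: z(1))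
  then show ?thesis using z(2) by (intro exI[of _ "\<lambda>j. z j + 1"]) auto
qed

text \<open>Finitely many proper subspaces form a null set, while a cell is open and
  nonempty.\<close>

lemma generic_point:
  assumes U: "U \<in> cells"
  shows "\<exists>p\<in>U. \<forall>Y. p \<in> span (g ` Y) \<longrightarrow> span (g ` Y) = UNIV"
proof -
  let ?N = "(\<lambda>Y. span (g ` Y)) ` {Y. span (g ` Y) \<noteq> UNIV}"
  have "negligible (\<Union>?N)"
  proof (rule negligible_Union)
    fix t assume "t \<in> ?N"
    then obtain Y where Y: "t = span (g ` Y)" "span (g ` Y) \<noteq> UNIV" by auto
    then have "dim t < DIM('v)"
      using dim_eq_full[of "g ` Y"] dim_subset_UNIV[of t] by (simp add: dim_span)
    then show "negligible t" by (rule negligible_lowdim)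
  qed auto
  then have "\<not> U \<subseteq> \<Union>?N"
    using open_not_negligible[OF open_cell[OF U] cell_nonempty[OF U]] negligible_subset by blast
  then show ?thesis by blast
qed

text \<open>A proper subspace spanned by generators does not contain \<open>p\<close>, so the line
  through \<open>l\<close> in direction \<open>p\<close> meets it at most once.\<close>

lemma generic_on_ray:
  assumes p: "\<And>Y. p \<in> span (g ` Y) \<Longrightarrow> span (g ` Y) = UNIV"
  shows "\<forall>\<^sub>F t in at_right (0::real). \<forall>Y. l + t *\<^sub>R p \<in> span (g ` Y) \<longrightarrow> span (g ` Y) = UNIV"
proof (rule eventually_all_finite)
  fix Y
  show "\<forall>\<^sub>F t in at_right (0::real). l + t *\<^sub>R p \<in> span (g ` Y) \<longrightarrow> span (g ` Y) = UNIV"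
  proof (cases "\<exists>t1. l + t1 *\<^sub>R p \<in> span (g ` Y) \<and> span (g ` Y) \<noteq> UNIV")
    case True
    then obtain t1 where t1: "l + t1 *\<^sub>R p \<in> span (g ` Y)" "span (g ` Y) \<noteq> UNIV" by auto
    have *: "t = t1" if "l + t *\<^sub>R p \<in> span (g ` Y)" for t
    proof (rule ccontr)
      assume "t \<noteq> t1"
      have "(l + t *\<^sub>R p) - (l + t1 *\<^sub>R p) \<in> span (g ` Y)" using that t1(1) by (rule span_diff)
      then have "(t - t1) *\<^sub>R p \<in> span (g ` Y)" by (simp add: scaleR_left_diff_distrib)
      then have "(1 / (t - t1)) *\<^sub>R (t - t1) *\<^sub>R p \<in> span (g ` Y)" by (rule span_scale)
      then have "p \<in> span (g ` Y)" using \<open>t \<noteq> t1\<close> by simp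
      then show False using p t1(2) by blast
    qed
    have "\<forall>\<^sub>F t in at_right 0. t \<noteq> t1" by (rule eventually_neq_at_within)
    then show ?thesis by eventually_elim (use * in blast)
  qed auto
qed

text \<open>On a closed chamber the identity is obtained by perturbing \<open>z\<close> so that \<open>comb z\<close> moves to a
  generic point of the chamber.\<close>

lemma polar_decomposition_perturbed:
  assumes c: "generic_cost c" and U: "U \<in> cells" and z: "comb z \<in> closure U"
    and u: "comb u \<in> U" "\<And>Y. comb u \<in> span (g ` Y) \<Longrightarrow> span (g ` Y) = UNIV"
    and S: "\<forall>\<^sub>F t in at_right 0. {j. z j + t * u j < 0} = S"
  shows "of_bool (S = {}) = (\<Sum>B\<in>cell_bases U. polar_sign c UNIV B * of_bool (polar_match c UNIV B S))"
proof -
  have "\<forall>\<^sub>F t in at_right (0::real). 0 < t" by (rule eventually_at_right_less)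
  then have "\<forall>\<^sub>F t in at_right 0. 0 < t \<and> {j. z j + t * u j < 0} = S \<and>
      (\<forall>Y. comb z + t *\<^sub>R comb u \<in> span (g ` Y) \<longrightarrow> span (g ` Y) = UNIV)"
    using S generic_on_ray[of "comb u" "comb z", OF u(2), simplified] by eventually_elim simp
  then obtain t where t: "0 < t" "{j. z j + t * u j < 0} = S"
      "\<And>Y. comb z + t *\<^sub>R comb u \<in> span (g ` Y) \<Longrightarrow> span (g ` Y) = UNIV"
    using eventually_happens'[OF trivial_limit_at_right_real] by blast
  let ?l = "comb z + t *\<^sub>R comb u"
  have "lv_defect c ?l UNIV {j. z j + t * u j < 0} = 0"
    by (rule lv_defect_generic[OF c t(3)]) (auto simp: comb_add comb_scale)
  moreover have "{B. ibasis B \<and> B \<subseteq> UNIV \<and> ?l \<in> cone_of B} = cell_bases U"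
    using cell_bases_iff[OF U cell_shift[OF U z u(1) t(1)]] by auto
  ultimately show ?thesis by (simp add: lv_defect_def t(2))
qed

lemma eventually_sign_perturb:
  fixes z u :: "'j \<Rightarrow> real"
  assumes "\<And>j. u j \<noteq> 0"
  shows "\<forall>\<^sub>F t in at_right 0. {j. z j + t * u j < 0} = {j. z j < 0 \<or> z j = 0 \<and> u j < 0}"
proof -
  have "\<forall>\<^sub>F t in at_right 0. z j + t * u j < 0 \<longleftrightarrow> z j < 0 \<or> z j = 0 \<and> u j < 0" for j
  proof -
    have lim: "((\<lambda>t. z j + t * u j) \<longlongrightarrow> z j + 0 * u j) (at_right 0)" by (intro tendsto_intros)
    consider "z j < 0" | "0 < z j" | "z j = 0" by linarith
    then show ?thesis
    proof cases
      case 1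
      then have "\<forall>\<^sub>F t in at_right 0. z j + t * u j < 0" using order_tendstoD(2)[OF lim] by simp
      then show ?thesis by eventually_elim (use 1 in auto)
    next
      case 2
      then have "\<forall>\<^sub>F t in at_right 0. 0 < z j + t * u j" using order_tendstoD(1)[OF lim] by simp
      then show ?thesis by eventually_elim (use 2 in auto)
    next
      case 3
      have "\<forall>\<^sub>F t in at_right (0::real). 0 < t" by (rule eventually_at_right_less)
      then show ?thesis by eventually_elim (use 3 in \<open>auto simp: mult_less_0_iff\<close>)
    qed
  qed
  then have "\<forall>\<^sub>F t in at_right 0. \<forall>j. z j + t * u j < 0 \<longleftrightarrow> z j < 0 \<or> z j = 0 \<and> u j < 0"
    by (rule eventually_all_finite)
  then show ?thesis by eventually_elim blast
qed

text \<open>The Lawrence--Varchenko decomposition of the polyhedron \<open>{z. comb z = l, z \<ge> 0}\<close> into its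
  polarized vertex cones, and of its interior.\<close>

lemma polar_decomposition:
  assumes c: "generic_cost c" and U: "U \<in> cells" and z: "comb z \<in> closure U"
  shows "of_bool (\<forall>j. 0 \<le> z j) =
      (\<Sum>B\<in>cell_bases U. polar_sign c UNIV B * of_bool (polar_match c UNIV B {j. z j < 0}))" (is ?A)
    and "of_bool (\<forall>j. 0 < z j) =
      (\<Sum>B\<in>cell_bases U. polar_sign c UNIV B * of_bool (polar_match c UNIV B {j. z j \<le> 0}))" (is ?B)
proof -
  obtain p where p: "p \<in> U" "\<And>Y. p \<in> span (g ` Y) \<Longrightarrow> span (g ` Y) = UNIV"
    using generic_point[OF U] by blast
  obtain u where u: "comb u = p" "\<And>j. 1 \<le> u j" using positive_combination by blast
  have u0: "0 < u j" for j using u(2)[of j] by linarith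
  have "{j. z j < 0 \<or> z j = 0 \<and> u j < 0} = {j. z j < 0}" using u0 by (auto dest: less_asym)
  then have "\<forall>\<^sub>F t in at_right 0. {j. z j + t * u j < 0} = {j. z j < 0}"
    using eventually_sign_perturb[of u z] u0 by (metis less_irrefl)
  from polar_decomposition_perturbed[OF c U z _ _ this] p u(1) show ?A by (simp add: not_less)
  \<comment> \<open>The direction \<open>p\<close> into the cell also has a representation with all
    coordinates negative. It makes vanishing coordinates of \<open>z\<close> count as negative,
    which gives the version with strict inequalities.\<close>
  obtain w where w: "comb w = - p" "\<And>j. 1 \<le> w j" using positive_combination by blast
  define v where "v j = - w j" for j
  have v: "comb v = p" using w(1) comb_scale[of "-1" w] by (simp add: v_def[abs_def])
  have v0: "v j < 0" for j using w(2)[of j] by (simp add: v_def)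
  have "{j. z j < 0 \<or> z j = 0 \<and> v j < 0} = {j. z j \<le> 0}" using v0 by auto
  then have "\<forall>\<^sub>F t in at_right 0. {j. z j + t * v j < 0} = {j. z j \<le> 0}"
    using eventually_sign_perturb[of v z] v0 by (metis less_irrefl)
  from polar_decomposition_perturbed[OF c U z _ _ this] p v show ?B by (simp add: not_le)
qed

end

section \<open>Lattices\<close>

lemma dirichlet_approx_finite:
  fixes \<theta> :: "'j::finite \<Rightarrow> real"
  assumes "0 < N"
  shows "\<exists>(q::nat) p. 0 < q \<and> (\<forall>j. \<bar>real q * \<theta> j - of_int (p j)\<bar> < 1 / real N)"
proof -
  obtain f :: "'j \<Rightarrow> nat" where f: "bij_betw f UNIV {0..<CARD('j)}"
    using ex_bij_betw_finite_nat[of "UNIV :: 'j set"] by auto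
  obtain q p where q: "0 < q"
      "\<And>i. i < CARD('j) \<Longrightarrow> \<bar>of_int q * \<theta> (inv_into UNIV f i) - of_int (p i)\<bar> < 1 / real N"
    using Dirichlet_approx_simult[OF assms, of "CARD('j)" "\<lambda>i. \<theta> (inv_into UNIV f i)"] by blast
  have "f j < CARD('j)" "inv_into UNIV f (f j) = j" for j
    using f by (auto simp: bij_betw_def)
  then have "\<bar>of_int q * \<theta> j - of_int (p (f j))\<bar> < 1 / real N" for j
    using q(2)[of "f j"] by simp
  then show ?thesis using q(1)
    by (intro exI[of _ "nat q"] exI[of _ "\<lambda>j. p (f j)"]) auto
qed

lemma common_multiplier:
  fixes f :: "'a \<Rightarrow> real"
  assumes "finite A" "\<And>x. x \<in> A \<Longrightarrow> \<exists>q::nat. 0 < q \<and> real q * f x \<in> \<int>"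
  shows "\<exists>M::nat. 0 < M \<and> (\<forall>x\<in>A. real M * f x \<in> \<int>)"
  using assms
proof (induction A)
  case (insert x A)
  from insert.prems[of x] insert.IH insert.prems
  obtain M q :: nat where M: "0 < M" "\<forall>x\<in>A. real M * f x \<in> \<int>" "0 < q" "real q * f x \<in> \<int>" by blast
  have "real (M * q) * f y \<in> \<int>" if "y \<in> insert x A" for y
  proof (cases "y = x")
    case True
    have "real M * (real q * f x) \<in> \<int>" by (rule Ints_mult[OF Ints_of_nat M(4)])
    then show ?thesis using True by (simp add: mult.assoc)
  next
    case False
    then have "real M * f y \<in> \<int>" using M that by auto
    then have "real q * (real M * f y) \<in> \<int>" by (rule Ints_mult[OF Ints_of_nat])
    then show ?thesis by (simp add: mult.assoc mult.left_commute)
  qed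
  then show ?case using M by (intro exI[of _ "M * q"]) auto
qed auto

lemma finite_bounded_lattice:
  assumes "0 < (k::nat)"
  shows "finite {x::real^'n. (\<forall>i. real k * x $ i \<in> \<int>) \<and> (\<forall>i. \<bar>x $ i\<bar> \<le> C)}" (is "finite ?A")
proof -
  let ?D = "\<Pi>\<^sub>E i\<in>(UNIV::'n set). {-\<lceil>real k * C\<rceil>..\<lceil>real k * C\<rceil>}"
  have "?A \<subseteq> (\<lambda>f. \<chi> i. of_int (f i) / real k) ` ?D"
  proof
    fix x assume x: "x \<in> ?A"
    define f where "f i = \<lfloor>real k * x $ i\<rfloor>" for i
    have fi: "of_int (f i) = real k * x $ i" for i using x by (simp add: f_def)
    have "f \<in> ?D"
    proof (rule PiE_I)
      fix i
      have "\<bar>real k * x $ i\<bar> \<le> real k * C" using x by (simp add: abs_mult mult_left_mono)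
      then have "\<bar>of_int (f i)\<bar> \<le> real k * C" by (simp only: fi)
      then show "f i \<in> {-\<lceil>real k * C\<rceil>..\<lceil>real k * C\<rceil>}" by simp linarith
    qed auto
    moreover have "x = (\<chi> i. of_int (f i) / real k)" using assms by (simp add: vec_eq_iff fi)
    ultimately show "x \<in> (\<lambda>f. \<chi> i. of_int (f i) / real k) ` ?D" by blast
  qed
  then show ?thesis by (rule finite_subset) (auto intro!: finite_imageI finite_PiE)
qed

lemma finite_bounded_int_vecs: "finite {x \<in> int_vecs. \<forall>i. \<bar>x $ i\<bar> \<le> C}"
  using finite_bounded_lattice[of 1 C] by (simp add: int_vecs_def)

lemma add_subgroup_int_vecs: "add_subgroup int_vecs"
  by (auto simp: add_subgroup_def int_vecs_def)

lemma add_subgroup_0: "add_subgroup N \<Longrightarrow> 0 \<in> N"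
  and add_subgroup_diff: "add_subgroup N \<Longrightarrow> x \<in> N \<Longrightarrow> y \<in> N \<Longrightarrow> x - y \<in> N"
  by (auto simp: add_subgroup_def)

lemma add_subgroup_neg: "add_subgroup N \<Longrightarrow> x \<in> N \<Longrightarrow> - x \<in> N"
  using add_subgroup_diff[of N 0 x] add_subgroup_0 by auto

lemma add_subgroup_add: "add_subgroup N \<Longrightarrow> x \<in> N \<Longrightarrow> y \<in> N \<Longrightarrow> x + y \<in> N"
  using add_subgroup_diff[of N x "- y"] add_subgroup_neg[of N y] by auto

lemma add_subgroup_scale:
  fixes N :: "'a::real_vector set"
  assumes "add_subgroup N" "x \<in> N"
  shows "real n *\<^sub>R x \<in> N"
  using assms by (induction n) (auto simp: add_subgroup_0 add_subgroup_add scaleR_left_distrib)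

lemma coset_eq_iff:
  assumes "add_subgroup N"
  shows "(+) x ` N = (+) y ` N \<longleftrightarrow> x - y \<in> N"
proof
  assume "(+) x ` N = (+) y ` N"
  then have "x + 0 \<in> (+) y ` N" using add_subgroup_0[OF assms] by (metis imageI)
  then show "x - y \<in> N" by auto
next
  assume *: "x - y \<in> N"
  have "(+) x ` N \<subseteq> (+) y ` N" if "x - y \<in> N" for x y
  proof clarify
    fix n assume "n \<in> N"
    then have "y + ((x - y) + n) \<in> (+) y ` N" using add_subgroup_add[OF assms that] by blast
    then show "x + n \<in> (+) y ` N" by simp
  qed
  moreover have "y - x \<in> N" using add_subgroup_neg[OF assms *] by simp
  ultimately show "(+) x ` N = (+) y ` N" using * by blast
qed

text \<open>Two of the multiples of \<open>x\<close> from 0 up to the index fall into the same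
  coset. The bound by the index allows a denominator that is uniform in \<open>x\<close>.\<close>

lemma finite_index_multiple:
  fixes M :: "'a::real_vector set"
  assumes "finite_index_subgroup N M" "add_subgroup M" "x \<in> M"
  shows "\<exists>n::nat. 0 < n \<and> n \<le> card (cosets M N) \<and> real n *\<^sub>R x \<in> N"
proof -
  let ?f = "\<lambda>i::nat. (+) (real i *\<^sub>R x) ` N"
  have N: "add_subgroup N" "finite (cosets M N)" using assms(1) by (auto simp: finite_index_subgroup_def)
  have "?f ` {0..card (cosets M N)} \<subseteq> cosets M N"
    using add_subgroup_scale[OF assms(2,3)] by (auto simp: cosets_def)
  then have "card (?f ` {0..card (cosets M N)}) < card {0..card (cosets M N)}"
    using card_mono[OF N(2)] by (metis card_atLeastAtMost diff_zero le_imp_less_Suc)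
  then have "\<not> inj_on ?f {0..card (cosets M N)}" by (metis card_image less_irrefl)
  then obtain i j where "i \<le> card (cosets M N)" "j \<le> card (cosets M N)" "i \<noteq> j" "?f i = ?f j"
    by (auto simp: inj_on_def)
  then obtain i j where ij: "i \<le> card (cosets M N)" "j < i" "?f i = ?f j"
    by (metis nat_neq_iff)
  then have "real i *\<^sub>R x - real j *\<^sub>R x \<in> N" using coset_eq_iff[OF N(1)] by blast
  then have "real (i - j) *\<^sub>R x \<in> N" using ij(2) by (simp add: scaleR_left_diff_distrib of_nat_diff)
  then show ?thesis using ij by (intro exI[of _ "i - j"]) auto
qed

text \<open>The factorial of the index is divisible by every multiplier that can occur.\<close>

lemma overlattice_denominator:
  assumes "overlattice L'"
  shows "\<exists>k::nat. 0 < k \<and> (\<forall>l\<in>L'. real k *\<^sub>R l \<in> int_vecs)"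
proof -
  let ?c = "card (cosets L' int_vecs)"
  have "real (fact ?c) *\<^sub>R l \<in> int_vecs" if l: "l \<in> L'" for l
  proof -
    obtain n where n: "0 < n" "n \<le> ?c" "real n *\<^sub>R l \<in> int_vecs"
      using finite_index_multiple[of int_vecs L' l] assms l by (auto simp: overlattice_def)
    then obtain m where "fact ?c = m * n" using dvd_fact[of n ?c] by (metis dvdE mult.commute Suc_leI One_nat_def)
    then have "real (fact ?c) *\<^sub>R l = real m *\<^sub>R real n *\<^sub>R l" by (simp only: of_nat_mult scaleR_scaleR)
    then show ?thesis using add_subgroup_scale[OF add_subgroup_int_vecs n(3), of m] by argo
  qed
  then show ?thesis by (intro exI[of _ "fact ?c"]) auto
qed

definition scaled_int_vecs :: "nat \<Rightarrow> (real^'n) set" where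
  "scaled_int_vecs n = (\<lambda>y. real n *\<^sub>R y) ` int_vecs"

lemma scaled_int_vecs_subset: "scaled_int_vecs n \<subseteq> int_vecs"
  using add_subgroup_scale[OF add_subgroup_int_vecs] by (auto simp: scaled_int_vecs_def)

lemma add_subgroup_scaled: "add_subgroup (scaled_int_vecs n)"
  unfolding add_subgroup_def
proof (intro conjI ballI)
  show "0 \<in> scaled_int_vecs n"
    using add_subgroup_0[OF add_subgroup_int_vecs] by (force simp: scaled_int_vecs_def image_iff)
next
  fix x y :: "real^'n" assume "x \<in> scaled_int_vecs n" "y \<in> scaled_int_vecs n"
  then obtain x' y' where "x = real n *\<^sub>R x'" "y = real n *\<^sub>R y'" "x' \<in> int_vecs" "y' \<in> int_vecs"
    by (auto simp: scaled_int_vecs_def)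
  then have "x - y = real n *\<^sub>R (x' - y')" "x' - y' \<in> int_vecs"
    using add_subgroup_diff[OF add_subgroup_int_vecs] by (auto simp: scaleR_diff_right)
  then show "x - y \<in> scaled_int_vecs n" by (auto simp: scaled_int_vecs_def)
qed

text \<open>Reducing each coordinate modulo \<open>n\<close> gives bounded coset representatives,
  and the elements of \<open>L'\<close> have a common denominator, so only finitely many
  remain.\<close>

lemma finite_index_scaled:
  fixes L' :: "(real^'s) set"
  assumes L: "overlattice L'" and n: "0 < n"
  shows "finite_index_subgroup (scaled_int_vecs n) L'"
proof -
  obtain k :: nat where k: "0 < k" "\<And>l. l \<in> L' \<Longrightarrow> real k *\<^sub>R l \<in> int_vecs"
    using overlattice_denominator[OF L] by blast
  have sub: "int_vecs \<subseteq> L'" using L by (auto simp: overlattice_def finite_index_subgroup_def)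
  let ?A = "{x::real^'s. (\<forall>i. real k * x $ i \<in> \<int>) \<and> (\<forall>i. \<bar>x $ i\<bar> \<le> real n)}"
  have "cosets L' (scaled_int_vecs n) \<subseteq> (\<lambda>x. (+) x ` scaled_int_vecs n) ` ?A"
    unfolding cosets_def
  proof clarify
    fix m assume m: "m \<in> L'"
    define y :: "real^'s" where "y = (\<chi> i. of_int \<lfloor>m $ i / real n\<rfloor>)"
    let ?x = "m - real n *\<^sub>R y"
    have y: "y \<in> int_vecs" by (simp add: y_def int_vecs_def)
    have "m - ?x \<in> scaled_int_vecs n" using y by (auto simp: scaled_int_vecs_def)
    then have "(+) m ` scaled_int_vecs n = (+) ?x ` scaled_int_vecs n"
      using coset_eq_iff[OF add_subgroup_scaled] by blast
    moreover have "?x \<in> ?A"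
    proof (intro CollectI conjI allI)
      fix i
      have "real k * m $ i \<in> \<int>" using k(2)[OF m] by (simp add: int_vecs_def)
      then show "real k * ?x $ i \<in> \<int>" by (auto simp: y_def algebra_simps intro!: Ints_diff Ints_mult)
      define f where "f = real_of_int \<lfloor>m $ i / real n\<rfloor>"
      have "f \<le> m $ i / real n" "m $ i / real n < f + 1" unfolding f_def by linarith+
      then have "f * real n \<le> m $ i" "m $ i < (f + 1) * real n"
        using n by (simp_all only: pos_le_divide_eq pos_divide_less_eq of_nat_0_less_iff)
      moreover have "?x $ i = m $ i - f * real n" by (simp add: y_def f_def)
      ultimately show "\<bar>?x $ i\<bar> \<le> real n" by (simp add: algebra_simps)
    qed
    ultimately show "(+) m ` scaled_int_vecs n \<in> (\<lambda>x. (+) x ` scaled_int_vecs n) ` ?A" by blast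
  qed
  then have "finite (cosets L' (scaled_int_vecs n))"
    by (rule finite_subset) (intro finite_imageI finite_bounded_lattice k(1))
  then show ?thesis using add_subgroup_scaled scaled_int_vecs_subset sub
    by (auto simp: finite_index_subgroup_def)
qed

lemma cls_eq_iff: "cls x = cls y \<longleftrightarrow> x - y \<in> int_vecs"
  unfolding cls_def by (rule coset_eq_iff[OF add_subgroup_int_vecs])

lemma cls_add_int: "y \<in> int_vecs \<Longrightarrow> cls (x + y) = cls x"
  by (simp add: cls_eq_iff)

lemma cls_neg:
  fixes x :: "real^'n"
  shows "cls (- x) = uminus ` cls x"
proof -
  have "uminus ` (int_vecs :: (real^'n) set) = int_vecs"
    using add_subgroup_neg[OF add_subgroup_int_vecs] by (force simp: image_iff)
  then have "(+) (- x) ` int_vecs = (+) (- x) ` uminus ` int_vecs" by (simp only:)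
  also have "\<dots> = uminus ` (+) x ` int_vecs" unfolding image_image by (intro image_cong) auto
  finally show ?thesis unfolding cls_def .
qed

lemma real_polynomial_function_poly:
  assumes "real_polynomial_function f"
  shows "real_polynomial_function (\<lambda>x. poly p (f x))"
  by (induction p) (auto intro!: real_polynomial_function.intros(2-4) assms)

lemma lin_comb_component: "lin_comb a x $ v = (\<Sum>i\<in>UNIV. x $ i * a i $ v)"
  by (simp add: lin_comb_def)

lemma lin_comb_add: "lin_comb a (x + y) = lin_comb a x + lin_comb a y"
  by (simp add: vec_eq_iff lin_comb_component algebra_simps sum.distrib)

lemma lin_comb_diff: "lin_comb a (x - y) = lin_comb a x - lin_comb a y"
  by (simp add: vec_eq_iff lin_comb_component algebra_simps sum_subtractf)

lemma lin_comb_neg: "lin_comb a (- x) = - lin_comb a x"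
  by (simp add: vec_eq_iff lin_comb_component sum_negf)

lemma lin_comb_scale: "lin_comb a (c *\<^sub>R x) = c *\<^sub>R lin_comb a x"
  by (simp add: vec_eq_iff lin_comb_component algebra_simps sum_distrib_left)

section \<open>The configuration of the vectors a_i and -E_v\<close>

locale lattice_cone =
  fixes a :: "'d::finite \<Rightarrow> real ^ 's::finite" and L' :: "(real ^ 's) set"
  assumes overlattice: "overlattice L'"
    and a_in: "\<And>i. a i \<in> L'"
    and a_pos: "\<And>i v. 0 < a i $ v"
begin

definition gen :: "'d + 's \<Rightarrow> real ^ 's" where
  "gen j = (case j of Inl i \<Rightarrow> a i | Inr v \<Rightarrow> - axis v 1)"

lemma gen_simps [simp]: "gen (Inl i) = a i" "gen (Inr v) = - axis v 1"
  by (simp_all add: gen_def)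

sublocale vector_configuration gen .

lemma sum_UNIV_sum:
  fixes f :: "'d + 's \<Rightarrow> 'b::comm_monoid_add"
  shows "(\<Sum>j\<in>UNIV. f j) = (\<Sum>i\<in>UNIV. f (Inl i)) + (\<Sum>v\<in>UNIV. f (Inr v))"
  unfolding UNIV_sum by (subst sum.union_disjoint) (auto simp: sum.reindex)

definition xpart :: "('d + 's \<Rightarrow> real) \<Rightarrow> real ^ 'd" where
  "xpart z = (\<chi> i. z (Inl i))"

definition slack :: "real ^ 'd \<Rightarrow> real ^ 's \<Rightarrow> 'd + 's \<Rightarrow> real" where
  "slack x l j = (case j of Inl i \<Rightarrow> x $ i | Inr v \<Rightarrow> (lin_comb a x - l) $ v)"

lemma slack_simps [simp]: "slack x l (Inl i) = x $ i" "slack x l (Inr v) = lin_comb a x $ v - l $ v"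
  by (simp_all add: slack_def)

lemma comb_component: "comb z $ v = lin_comb a (xpart z) $ v - z (Inr v)"
  unfolding comb_def sum_UNIV_sum
  by (simp add: lin_comb_component xpart_def sum_negf axis_def if_distrib[of "\<lambda>x. _ * x"] cong: if_cong)

lemma comb_slack [simp]: "comb (slack x l) = l"
  by (simp add: vec_eq_iff comb_component xpart_def lin_comb_component)

text \<open>Together with \<open>comb_slack\<close> this parametrizes the fibre of
  \<open>comb\<close> over \<open>l\<close> by the points \<open>x\<close>.\<close>

lemma slack_xpart: "slack (xpart z) (comb z) = z"
proof
  show "slack (xpart z) (comb z) j = z j" for j
    by (cases j) (auto simp: comb_component, simp add: xpart_def)
qed

lemma slack_add: "slack (x + y) (l + l') j = slack x l j + slack y l' j"
  by (cases j) (auto simp: lin_comb_add)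

lemma slack_diff: "slack (x - y) (l - l') j = slack x l j - slack y l' j"
  by (cases j) (auto simp: lin_comb_diff)

lemma slack_neg: "slack (- x) (- l) j = - slack x l j"
  by (cases j) (auto simp: lin_comb_neg)

sublocale positive_configuration gen
proof
  have "l \<in> cone_of UNIV" for l
  proof -
    fix i0 :: 'd
    \<comment> \<open>A large multiple of a single \<open>a i0\<close> dominates \<open>l\<close>,
      since its coordinates are positive; the slack generators absorb the excess.\<close>
    define t where "t = Max (insert 0 (range (\<lambda>v. l $ v / a i0 $ v)))"
    have t: "0 \<le> t" "l $ v / a i0 $ v \<le> t" for v unfolding t_def by (intro Max_ge; simp)+
    let ?x = "axis i0 t :: real^'d"
    have "lin_comb a ?x $ v = t * a i0 $ v" for v
      by (simp add: lin_comb_component axis_def if_distrib[of "\<lambda>x. x * _"] cong: if_cong)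
    moreover have "l $ v \<le> t * a i0 $ v" for v using t(2)[of v] a_pos[of i0 v] by (simp add: field_simps)
    ultimately have "0 \<le> slack ?x l j" for j using t(1) by (cases j) (auto simp: axis_def)
    then show ?thesis unfolding cone_of_def by (intro CollectI exI[of _ "slack ?x l"]) auto
  qed
  then show "cone_of UNIV = UNIV" by auto
qed

lemma add_subgroup_L': "add_subgroup L'" and int_vecs_L': "int_vecs \<subseteq> L'"
  using overlattice by (auto simp: overlattice_def finite_index_subgroup_def)

lemma axis_int: "axis v 1 \<in> int_vecs"
  by (auto simp: int_vecs_def axis_def)

lemma gen_in: "gen j \<in> L'"
  using a_in add_subgroup_neg[OF add_subgroup_L'] int_vecs_L' axis_int by (cases j) auto

text \<open>A simultaneous Diophantine approximation of the coordinates solves the linear system up to an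
  error below the common denominator, hence exactly.\<close>

lemma coord_rational:
  assumes B: "ibasis B" and l: "l \<in> L'"
  shows "\<exists>q::nat. 0 < q \<and> (\<forall>j. real q * coord B l j \<in> \<int>)"
proof -
  obtain k :: nat where k: "0 < k" "\<And>l. l \<in> L' \<Longrightarrow> real k *\<^sub>R l \<in> int_vecs"
    using overlattice_denominator[OF overlattice] by blast
  have kint: "real k * l $ v \<in> \<int>" if "l \<in> L'" for l v using k(2)[OF that] by (simp add: int_vecs_def)
  \<comment> \<open>\<open>C\<close> bounds how far the generators, scaled by the denominator
    \<open>k\<close>, magnify the error of the approximation; once \<open>N\<close> exceeds
    \<open>C\<close>, the scaled error is an integer of absolute value below 1.\<close>
  define C where "C = real k * (\<Sum>j\<in>UNIV. \<Sum>v\<in>UNIV. \<bar>gen j $ v\<bar>)"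
  define N where "N = Suc (nat \<lceil>C\<rceil>)"
  have C0: "0 \<le> C" by (simp add: C_def sum_nonneg)
  have N: "C < real N" "0 < N" unfolding N_def using C0 by linarith+
  obtain q p where q: "0 < q" "\<And>j. \<bar>real q * coord B l j - of_int (p j)\<bar> < 1 / real N"
    using dirichlet_approx_finite[OF N(2), of "coord B l"] by blast
  define d where "d j = (if j \<in> B then real_of_int (p j) else 0) - real q * coord B l j" for j
  have d_bound: "\<bar>d j\<bar> \<le> 1 / real N" for j
    using q(2)[of j] coord_outside[OF B, of j l] by (auto simp: d_def abs_minus_commute)
  have comb_d: "comb d = comb (\<lambda>j. if j \<in> B then real_of_int (p j) else 0) - real q *\<^sub>R l"
    unfolding d_def by (simp add: comb_diff comb_scale comb_coord[OF B])
  have "comb d $ v = 0" for v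
  proof -
    have "real k * comb d $ v = (\<Sum>j\<in>UNIV. (if j \<in> B then real_of_int (p j) else 0) * (real k * gen j $ v))
        - real q * (real k * l $ v)"
      unfolding comb_d by (simp add: comb_def algebra_simps sum_distrib_left)
    moreover have "\<dots> \<in> \<int>"
      using kint[OF l] kint[OF gen_in] by (intro Ints_diff Ints_sum Ints_mult[of "if _ then _ else _"] Ints_mult[of "real q"]) auto
    ultimately have "real k * comb d $ v \<in> \<int>" by simp
    moreover have "\<bar>real k * comb d $ v\<bar> < 1"
    proof -
      have "\<bar>real k * comb d $ v\<bar> = real k * \<bar>\<Sum>j\<in>UNIV. d j * gen j $ v\<bar>" by (simp add: comb_def abs_mult)
      also have "\<dots> \<le> real k * (\<Sum>j\<in>UNIV. (1 / real N) * \<bar>gen j $ v\<bar>)"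
        by (intro mult_left_mono order.trans[OF sum_abs] sum_mono) (simp_all only: abs_mult mult_right_mono[OF d_bound] abs_ge_zero of_nat_0_le_iff)
      also have "\<dots> \<le> real k * (\<Sum>j\<in>UNIV. (1 / real N) * (\<Sum>v\<in>UNIV. \<bar>gen j $ v\<bar>))"
        by (intro mult_left_mono sum_mono member_le_sum) auto
      also have "\<dots> = C / real N" by (simp add: C_def sum_distrib_left sum_divide_distrib)
      also have "\<dots> < 1" using N by simp
      finally show ?thesis .
    qed
    ultimately have "real k * comb d $ v = 0" by (metis Ints_nonzero_abs_less1)
    then show ?thesis using k(1) by simp
  qed
  then have "comb d = 0" by (simp add: vec_eq_iff)
  then have "coord B 0 = d" using coord_outside[OF B] by (intro coord_unique[OF B]) (auto simp: d_def)
  then have "d j = 0" for j using coord_zero[OF B] by metis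
  then have "real q * coord B l j = (if j \<in> B then real_of_int (p j) else 0)" for j
    unfolding d_def by (metis eq_iff_diff_eq_0)
  then have "\<forall>j. real q * coord B l j \<in> \<int>" by auto
  then show ?thesis using q(1) by blast
qed

lemma coord_denominator:
  "\<exists>M::nat. 0 < M \<and> (\<forall>B j k. ibasis B \<longrightarrow> real M * coord B (gen j) k \<in> \<int>)"
proof -
  have "\<exists>M::nat. 0 < M \<and> (\<forall>x\<in>{B. ibasis B} \<times> UNIV. real M * (case x of (B, j, k) \<Rightarrow> coord B (gen j) k) \<in> \<int>)"
    by (rule common_multiplier) (use coord_rational gen_in in \<open>auto, blast\<close>)
  then show ?thesis by auto
qed

text \<open>A functional of \<open>x\<close> alone: slacks are free of charge, so the cost of
  \<open>slack x l\<close> does not involve \<open>l\<close>.\<close>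

definition xi_cost :: "('d \<Rightarrow> nat) \<Rightarrow> 'd + 's \<Rightarrow> real" where
  "xi_cost \<xi> j = (case j of Inl i \<Rightarrow> real (\<xi> i) | Inr v \<Rightarrow> 0)"

text \<open>Take distinct powers of \<open>t\<close> as coefficients. Each nonbasic reduced cost
  becomes a polynomial in \<open>t\<close> that is not identically zero, and some natural number
  avoids the finitely many roots.\<close>

lemma ex_generic_cost: "\<exists>\<xi>. (\<forall>i. 0 < \<xi> i) \<and> generic_cost (xi_cost \<xi>)"
proof -
  obtain e :: "'d \<Rightarrow> nat" where e: "inj e" using finite_imp_inj_to_nat_seg[of "UNIV :: 'd set"] by auto
  define \<eta> where "\<eta> B j k = (if k = j then 1 else 0) - coord B (gen j) k" for B j k
  define P where "P B j = (\<Sum>i\<in>UNIV. monom (\<eta> B j (Inl i)) (e i))" for B j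
  have red: "reduced_cost (xi_cost (\<lambda>i. t ^ e i)) B j = poly (P B j) (real t)" for t B j
  proof -
    have "reduced_cost (xi_cost (\<lambda>i. t ^ e i)) B j = (\<Sum>k\<in>UNIV. xi_cost (\<lambda>i. t ^ e i) k * \<eta> B j k)"
      by (simp add: reduced_cost_def cost_def \<eta>_def right_diff_distrib sum_subtractf if_distrib[of "\<lambda>x. _ * x"] cong: if_cong)
    also have "\<dots> = poly (P B j) (real t)"
      unfolding sum_UNIV_sum P_def by (simp add: xi_cost_def poly_sum poly_monom mult.commute)
    finally show ?thesis .
  qed
  have nz: "P B j \<noteq> 0" if B: "ibasis B" "j \<notin> B" for B j
  proof
    assume P0: "P B j = 0"
    have "coeff (P B j) (e i) = \<eta> B j (Inl i)" for i
      using e unfolding P_def by (simp add: coeff_sum inj_eq if_distrib cong: if_cong)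
    \<comment> \<open>A relation that involves none of the \<open>a i\<close> is trivial, because
      the vectors \<open>- axis v 1\<close> are independent; yet the coefficient of \<open>j\<close>
      in this one is 1.\<close>
    then have "xpart (\<eta> B j) = 0" using P0 by (simp add: vec_eq_iff xpart_def)
    moreover have "comb (\<eta> B j) = 0"
    proof -
      have "\<eta> B j = (\<lambda>k. (if k = j then 1 else 0) - coord B (gen j) k)" by (simp add: \<eta>_def fun_eq_iff)
      then show ?thesis using comb_unit[of j 1] by (simp add: comb_diff comb_coord[OF B(1)])
    qed
    ultimately have "\<eta> B j = slack 0 0" using slack_xpart[of "\<eta> B j"] by simp
    then have "\<eta> B j j = 0" by (cases j) (auto simp: lin_comb_component)
    then show False using coord_outside[OF B] by (simp add: \<eta>_def)
  qed
  define Z where "Z = (\<Union>B\<in>{B. ibasis B}. \<Union>j\<in>-B. {t. poly (P B j) t = 0})"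
  have "finite Z" unfolding Z_def using nz by (intro finite_UN_I) (auto intro: poly_roots_finite)
  moreover have "infinite (real ` {1::nat..})" by (subst finite_image_iff) (auto simp: infinite_Ici)
  ultimately obtain t :: nat where t: "1 \<le> t" "real t \<notin> Z"
    by (metis (no_types, lifting) atLeast_iff finite_subset image_subset_iff)
  have "generic_cost (xi_cost (\<lambda>i. t ^ e i))"
    unfolding generic_cost_def using t(2) red by (auto simp: Z_def xi_cost_def split: sum.split)
  then show ?thesis using t(1) by (intro exI[of _ "\<lambda>i. t ^ e i"]) auto
qed

end

section \<open>Lattice points of polarized simplices\<close>

lemma Ints_of_int_floor: "x \<in> \<int> \<Longrightarrow> of_int \<lfloor>x\<rfloor> = x"
  by (auto elim: Ints_cases)

definition half_line :: "bool \<Rightarrow> real \<Rightarrow> bool" where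
  "half_line c u \<longleftrightarrow> (if c then 0 \<le> u else 0 < u)"

lemma half_line_mono: "half_line c u \<Longrightarrow> u \<le> v \<Longrightarrow> half_line c v"
  by (auto simp: half_line_def split: if_splits)

lemma half_line_bounds: "half_line c u \<Longrightarrow> \<not> half_line c (u - M) \<Longrightarrow> 0 \<le> u \<and> u \<le> M"
  by (auto simp: half_line_def split: if_splits)

text \<open>Subtracting the period as often as possible leaves the fundamental interval of length
  \<open>M\<close>, which contains its lower end if \<open>c\<close> holds and its upper end
  otherwise.\<close>

lemma half_line_period:
  assumes "0 < M" "half_line c u"
  shows "\<exists>k::nat. half_line c (u - M * real k) \<and> \<not> half_line c (u - M * real k - M)"
proof -
  have "\<exists>k::nat. \<not> half_line c (u - M * real k)"
  proof -
    obtain k :: nat where "u / M < real k" using reals_Archimedean2 by blast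
    then have "u - M * real k < 0" using assms(1) by (simp add: field_simps)
    then show ?thesis by (intro exI[of _ k]) (auto simp: half_line_def)
  qed
  then obtain k where k: "\<not> half_line c (u - M * real k)" "\<And>i. i < k \<Longrightarrow> half_line c (u - M * real i)"
    using exists_least_iff[of "\<lambda>k. \<not> half_line c (u - M * real k)"] by auto
  then have "k \<noteq> 0" using assms(2) by (cases k) auto
  then obtain k' where k': "k = Suc k'" by (cases k) auto
  then show ?thesis using k by (intro exI[of _ k']) (auto simp: algebra_simps)
qed

lemma half_line_period_unique:
  assumes "0 < M" and u: "half_line c u" "\<not> half_line c (u - M)" and v: "half_line c v" "\<not> half_line c (v - M)"
    and eq: "u + M * real k = v + M * real k'"
  shows "k = k'"
proof -
  have "\<not> k < k'" if u: "half_line c u" "\<not> half_line c (u - M)" and v: "half_line c v" "\<not> half_line c (v - M)"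
    and eq: "u + M * real k = v + M * real k'" for u v k k'
  proof
    assume "k < k'"
    then have "M * real (Suc k) \<le> M * real k'" using assms(1) by (intro mult_left_mono) auto
    then have "v \<le> u - M" using eq by (simp add: algebra_simps)
    then show False using half_line_mono[OF v(1)] u(2) by blast
  qed
  from this[OF u v eq] this[OF v u eq[symmetric]] show ?thesis by simp
qed

text \<open>\<open>M\<close> is a common denominator for the expansions of all generators in all
  bases, so that moving by \<open>M\<close> along an edge of any polarized cone is a lattice
  translation.\<close>

locale polarized_cone = lattice_cone a L' for a :: "'d::finite \<Rightarrow> real ^ 's::finite" and L' +
  fixes \<xi> :: "'d \<Rightarrow> nat" and M :: nat
  assumes xi_pos: "\<And>i. 0 < \<xi> i" and xi_generic: "generic_cost (xi_cost \<xi>)"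
    and M_pos: "0 < M" and M_int: "\<And>B j k. ibasis B \<Longrightarrow> real M * coord B (gen j) k \<in> \<int>"
begin

abbreviation red :: "('d + 's) set \<Rightarrow> 'd + 's \<Rightarrow> real" where
  "red B j \<equiv> reduced_cost (xi_cost \<xi>) B j"

definition weight :: "real ^ 'd \<Rightarrow> real" where
  "weight x = (\<Sum>i\<in>UNIV. real (\<xi> i) * x $ i)"

lemma weight_add: "weight (x + y) = weight x + weight y"
  by (simp add: weight_def algebra_simps sum.distrib)

lemma weight_diff: "weight (x - y) = weight x - weight y"
  by (simp add: weight_def algebra_simps sum_subtractf)

lemma weight_int: "x \<in> int_vecs \<Longrightarrow> weight x \<in> \<int>"
  unfolding weight_def by (auto simp: int_vecs_def intro!: Ints_sum Ints_mult)

lemma weight_xpart: "weight (xpart z) = (\<Sum>j\<in>UNIV. xi_cost \<xi> j * z j)"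
  unfolding sum_UNIV_sum by (simp add: weight_def xpart_def xi_cost_def)

lemma red_nz: "ibasis B \<Longrightarrow> j \<notin> B \<Longrightarrow> red B j \<noteq> 0"
  using xi_generic by (simp add: generic_cost_def)

lemma M_red_int:
  assumes B: "ibasis B"
  shows "real M * red B j \<in> \<int>"
proof -
  have "real M * red B j = real M * xi_cost \<xi> j - (\<Sum>k\<in>UNIV. xi_cost \<xi> k * (real M * coord B (gen j) k))"
    by (simp add: reduced_cost_def cost_def algebra_simps sum_distrib_left)
  also have "\<dots> \<in> \<int>"
    by (intro Ints_diff Ints_sum Ints_mult[OF _ M_int[OF B]] Ints_mult)
       (auto simp: xi_cost_def split: sum.splits)
  finally show ?thesis .
qed

text \<open>The increase of \<open>weight\<close> when the coordinate \<open>j\<close> of a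
  polarized cone moves outwards by \<open>M\<close>; these are the weights of the simplices to be
  counted.\<close>

definition wt :: "('d + 's) set \<Rightarrow> 'd + 's \<Rightarrow> nat" where
  "wt B j = nat \<lfloor>real M * \<bar>red B j\<bar>\<rfloor>"

lemma wt_eq:
  assumes "ibasis B"
  shows "real (wt B j) = real M * \<bar>red B j\<bar>"
proof -
  have "real M * \<bar>red B j\<bar> \<in> \<int>"
    using M_red_int[OF assms, of j] Ints_minus[OF M_red_int[OF assms, of j]] by (auto simp: abs_if)
  then show ?thesis unfolding wt_def using Ints_of_int_floor by (simp add: of_nat_nat)
qed

lemma wt_pos:
  assumes "ibasis B" "j \<notin> B"
  shows "0 < wt B j"
proof -
  have "0 < real (wt B j)" using wt_eq[OF assms(1), of j] red_nz[OF assms] M_pos by simp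
  then show ?thesis by simp
qed

text \<open>The solution \<open>z\<close> of \<open>comb z = l\<close> with prescribed coordinates outside the basis.\<close>

definition lift :: "('d + 's) set \<Rightarrow> real ^ 's \<Rightarrow> ('d + 's \<Rightarrow> real) \<Rightarrow> 'd + 's \<Rightarrow> real" where
  "lift B l y j = (if j \<in> B then 0 else y j) + coord B (l - comb (\<lambda>j. if j \<in> B then 0 else y j)) j"

lemma lift_outside: "ibasis B \<Longrightarrow> j \<notin> B \<Longrightarrow> lift B l y j = y j"
  by (simp add: lift_def coord_outside)

lemma comb_lift: "ibasis B \<Longrightarrow> comb (lift B l y) = l"
  unfolding lift_def by (simp add: comb_add comb_coord)

lemma lift_unique:
  assumes B: "ibasis B" and z: "comb z = l" "\<And>j. j \<notin> B \<Longrightarrow> z j = y j"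
  shows "lift B l y = z"
proof -
  have "coord B 0 = (\<lambda>j. lift B l y j - z j)"
    by (intro coord_unique[OF B]) (auto simp: lift_outside[OF B] z comb_diff comb_lift[OF B])
  then have "lift B l y j - z j = 0" for j using coord_zero[OF B, of j] by metis
  then show ?thesis by (simp add: fun_eq_iff)
qed

lemma slack_xpart_lift: "ibasis B \<Longrightarrow> slack (xpart (lift B l y)) l = lift B l y"
  using slack_xpart[of "lift B l y"] by (simp add: comb_lift)

lemma weight_lift:
  assumes B: "ibasis B"
  shows "weight (xpart (lift B l y)) = cost (xi_cost \<xi>) B l + (\<Sum>j\<in>-B. red B j * y j)"
proof -
  have "(\<Sum>j\<in>UNIV. red B j * lift B l y j) = (\<Sum>j\<in>-B. red B j * lift B l y j)"
    using reduced_cost_basis[OF B] by (intro sum.mono_neutral_right) auto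
  also have "\<dots> = (\<Sum>j\<in>-B. red B j * y j)" by (intro sum.cong) (auto simp: lift_outside[OF B])
  finally show ?thesis
    unfolding weight_xpart using cost_comb[OF B, of "xi_cost \<xi>" "lift B l y"] comb_lift[OF B] by simp
qed

lemma coord_scaled_int:
  assumes B: "ibasis B" and y: "\<And>j. y j \<in> \<int>"
  shows "coord B (real M *\<^sub>R comb y) k \<in> \<int>"
proof -
  have "coord B (comb y) k = (\<Sum>j\<in>UNIV. y j * coord B (gen j) k)"
    by (rule coord_comb[OF B])
  then have "coord B (real M *\<^sub>R comb y) k = (\<Sum>j\<in>UNIV. y j * (real M * coord B (gen j) k))"
    by (simp add: coord_scale[OF B] sum_distrib_left mult.left_commute)
  also have "\<dots> \<in> \<int>" by (intro Ints_sum Ints_mult[OF y M_int[OF B]])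
  finally show ?thesis .
qed

lemma lift_int:
  assumes B: "ibasis B" and y: "\<And>j. y j \<in> \<int>" and n: "n \<in> int_vecs"
  shows "lift B (real M *\<^sub>R n) (\<lambda>j. real M * y j) k \<in> \<int>"
proof -
  \<comment> \<open>The integral vector \<open>slack 0 n\<close> represents \<open>n\<close>, so the
    argument of \<open>coord\<close> becomes \<open>M\<close> times a combination of generators with
    integral coefficients.\<close>
  define u where "u j = slack 0 n j - (if j \<in> B then 0 else y j)" for j
  have eq: "real M *\<^sub>R n - comb (\<lambda>j. if j \<in> B then 0 else real M * y j) = real M *\<^sub>R comb u"
  proof -
    have "comb u = n - comb (\<lambda>j. if j \<in> B then 0 else y j)" unfolding u_def by (simp add: comb_diff)
    moreover have "comb (\<lambda>j. if j \<in> B then 0 else real M * y j) = real M *\<^sub>R comb (\<lambda>j. if j \<in> B then 0 else y j)"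
      unfolding comb_scale[symmetric] by (simp add: if_distrib cong: if_cong)
    ultimately show ?thesis by (simp add: scaleR_diff_right)
  qed
  have "u j \<in> \<int>" for j
    using n y by (cases j) (auto simp: u_def int_vecs_def lin_comb_component)
  then have "coord B (real M *\<^sub>R comb u) k \<in> \<int>" by (rule coord_scaled_int[OF B])
  then show ?thesis unfolding lift_def eq using y by auto
qed

text \<open>The slack coordinates are integral as well, and they differ from \<open>lin_comb\<close>
  by an integral vector; so these translations preserve the class in \<open>H\<close>.\<close>

lemma lift_xpart_int:
  assumes B: "ibasis B" and y: "\<And>j. y j \<in> \<int>" and n: "n \<in> int_vecs"
  shows "xpart (lift B (real M *\<^sub>R n) (\<lambda>j. real M * y j)) \<in> int_vecs"
    and "lin_comb a (xpart (lift B (real M *\<^sub>R n) (\<lambda>j. real M * y j))) \<in> int_vecs"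
proof -
  let ?z = "lift B (real M *\<^sub>R n) (\<lambda>j. real M * y j)"
  show "xpart ?z \<in> int_vecs" using lift_int[OF assms] by (simp add: xpart_def int_vecs_def)
  have "lin_comb a (xpart ?z) $ v = ?z (Inr v) + (real M *\<^sub>R n) $ v" for v
    using comb_component[of ?z v] comb_lift[OF B] by (metis add.commute diff_add_cancel)
  moreover have "real M *\<^sub>R n \<in> int_vecs" using add_subgroup_scale[OF add_subgroup_int_vecs n] .
  ultimately show "lin_comb a (xpart ?z) \<in> int_vecs"
    using lift_int[OF assms] by (simp add: int_vecs_def)
qed

definition lattice_class :: "(real ^ 's) set \<Rightarrow> (real ^ 'd) set" where
  "lattice_class h = {x \<in> int_vecs. cls (lin_comb a x) = h}"

lemma lattice_class_shift:
  assumes "x \<in> lattice_class h" "y \<in> int_vecs" "lin_comb a y \<in> int_vecs"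
  shows "x + y \<in> lattice_class h"
  using assms add_subgroup_add[OF add_subgroup_int_vecs]
  by (auto simp: lattice_class_def lin_comb_add cls_add_int)

lemma lattice_class_unshift:
  assumes "x \<in> lattice_class h" "y \<in> int_vecs" "lin_comb a y \<in> int_vecs"
  shows "x - y \<in> lattice_class h"
proof -
  have "x + (- y) \<in> lattice_class h"
    using assms(2,3) by (intro lattice_class_shift assms(1)) (auto simp: lin_comb_neg add_subgroup_neg[OF add_subgroup_int_vecs])
  then show ?thesis by simp
qed

lemma lattice_class_neg: "x \<in> lattice_class h \<Longrightarrow> - x \<in> lattice_class (uminus ` h)"
  using add_subgroup_neg[OF add_subgroup_int_vecs] by (auto simp: lattice_class_def lin_comb_neg cls_neg)

text \<open>The polarized cone of a basis \<open>B\<close> is cut out by sign conditions on the slacks outside \<open>B\<close>; the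
  flag \<open>b\<close> exchanges strict and weak inequalities. Multiples of \<open>step\<close> carry the box onto the cone.\<close>

definition polar_coord :: "('d + 's) set \<Rightarrow> real ^ 's \<Rightarrow> real ^ 'd \<Rightarrow> 'd + 's \<Rightarrow> real" where
  "polar_coord B l x j = sgn (red B j) * slack x l j"

definition polar_closed :: "bool \<Rightarrow> ('d + 's) set \<Rightarrow> 'd + 's \<Rightarrow> bool" where
  "polar_closed b B j \<longleftrightarrow> (0 < red B j) \<noteq> b"

definition polar_box :: "bool \<Rightarrow> ('d + 's) set \<Rightarrow> (real ^ 's) set \<Rightarrow> real ^ 's \<Rightarrow> (real ^ 'd) set" where
  "polar_box b B h l = {x \<in> lattice_class h. \<forall>j\<in>-B. half_line (polar_closed b B j) (polar_coord B l x j) \<and>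
      \<not> half_line (polar_closed b B j) (polar_coord B l x j - real M)}"

definition polar_simplex :: "bool \<Rightarrow> ('d + 's) set \<Rightarrow> (real ^ 's) set \<Rightarrow> real ^ 's \<Rightarrow> int \<Rightarrow> (real ^ 'd) set" where
  "polar_simplex b B h l R = {x \<in> lattice_class h.
      (\<forall>j\<in>-B. half_line (polar_closed b B j) (polar_coord B l x j)) \<and> weight x \<le> of_int R}"

definition step :: "('d + 's) set \<Rightarrow> ('d + 's \<Rightarrow> nat) \<Rightarrow> real ^ 'd" where
  "step B k = xpart (lift B 0 (\<lambda>j. real M * (sgn (red B j) * real (k j))))"

lemma polar_coord_step:
  assumes B: "ibasis B" "j \<notin> B"
  shows "polar_coord B l (x + step B k) j = polar_coord B l x j + real M * real (k j)"
    and "polar_coord B l (x - step B k) j = polar_coord B l x j - real M * real (k j)"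
proof -
  have "slack (step B k) 0 j = real M * (sgn (red B j) * real (k j))"
    unfolding step_def slack_xpart_lift[OF B(1)] using B by (simp add: lift_outside)
  then have *: "sgn (red B j) * slack (step B k) 0 j = real M * real (k j)"
    using red_nz[OF B] by (auto simp: sgn_if)
  show "polar_coord B l (x + step B k) j = polar_coord B l x j + real M * real (k j)"
    using slack_add[of x "step B k" l 0 j] * by (simp add: polar_coord_def distrib_left)
  show "polar_coord B l (x - step B k) j = polar_coord B l x j - real M * real (k j)"
    using slack_diff[of x "step B k" l 0 j] * by (simp add: polar_coord_def right_diff_distrib)
qed

lemma step_int:
  assumes B: "ibasis B"
  shows "step B k \<in> int_vecs" "lin_comb a (step B k) \<in> int_vecs"
proof -
  have "sgn (red B j) * real (k j) \<in> \<int>" for j by (auto simp: sgn_if)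
  from lift_xpart_int[OF B this add_subgroup_0[OF add_subgroup_int_vecs]]
  show "step B k \<in> int_vecs" "lin_comb a (step B k) \<in> int_vecs" by (simp_all add: step_def)
qed

lemma weight_step:
  assumes B: "ibasis B"
  shows "weight (step B k) = real (\<Sum>j\<in>-B. wt B j * k j)"
  unfolding step_def weight_lift[OF B] using linear_0[OF linear_cost[OF B]]
  by (auto simp: wt_eq[OF B] abs_sgn intro!: sum.cong)

text \<open>In a box the slacks outside \<open>B\<close> are bounded by \<open>M\<close>, and they
  determine the point.\<close>

lemma polar_box_finite:
  assumes B: "ibasis B"
  shows "finite (polar_box b B h l)"
proof -
  define C where "C i = real M + \<bar>coord B l (Inl i)\<bar> + (\<Sum>j\<in>UNIV. real M * \<bar>coord B (gen j) (Inl i)\<bar>)" for i :: 'd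
  have bound: "\<bar>x $ i\<bar> \<le> C i" if x: "x \<in> polar_box b B h l" for x i
  proof -
    define y where "y j = (if j \<in> B then 0 else slack x l j)" for j
    have y: "\<bar>y j\<bar> \<le> real M" for j
    proof (cases "j \<in> B")
      case False
      then have "0 \<le> polar_coord B l x j" "polar_coord B l x j \<le> real M"
        using x False half_line_bounds[of "polar_closed b B j" "polar_coord B l x j" "real M"]
        by (simp_all add: polar_box_def)
      moreover have "\<bar>polar_coord B l x j\<bar> = \<bar>slack x l j\<bar>"
        using red_nz[OF B False] by (simp add: polar_coord_def abs_mult abs_sgn_eq)
      ultimately show ?thesis using False by (simp add: y_def)
    qed (simp add: y_def)
    have "lift B l (slack x l) = slack x l" by (intro lift_unique[OF B]) auto
    then have "lift B l (slack x l) (Inl i) = x $ i" by simp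
    then have "x $ i = y (Inl i) + coord B (l - comb y) (Inl i)"
      by (simp add: lift_def y_def[abs_def])
    also have "\<dots> = y (Inl i) + coord B l (Inl i) - (\<Sum>j\<in>UNIV. y j * coord B (gen j) (Inl i))"
      by (simp add: coord_diff[OF B] coord_comb[OF B])
    finally have "\<bar>x $ i\<bar> \<le> \<bar>y (Inl i)\<bar> + \<bar>coord B l (Inl i)\<bar> + \<bar>\<Sum>j\<in>UNIV. y j * coord B (gen j) (Inl i)\<bar>" by linarith
    also have "\<bar>\<Sum>j\<in>UNIV. y j * coord B (gen j) (Inl i)\<bar> \<le> (\<Sum>j\<in>UNIV. real M * \<bar>coord B (gen j) (Inl i)\<bar>)"
      by (rule order.trans[OF sum_abs], rule sum_mono) (simp add: abs_mult mult_right_mono[OF y])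
    finally show ?thesis using y[of "Inl i"] by (simp add: C_def)
  qed
  have "C i \<le> Max (range C)" for i by (intro Max_ge) auto
  then have "\<bar>x $ i\<bar> \<le> Max (range C)" if "x \<in> polar_box b B h l" for x i
    using bound[OF that, of i] order.trans by blast
  moreover have "polar_box b B h l \<subseteq> int_vecs" by (auto simp: polar_box_def lattice_class_def)
  ultimately have "polar_box b B h l \<subseteq> {x \<in> int_vecs. \<forall>i. \<bar>x $ i\<bar> \<le> Max (range C)}" by blast
  then show ?thesis by (rule finite_subset) (rule finite_bounded_int_vecs)
qed

text \<open>A half-open cone is tiled by translates of its half-open box. As \<open>weight\<close>
  is additive, the translates of a box point \<open>x\<close> that respect the truncation are
  indexed by a weighted simplex of level \<open>R - weight x\<close>.\<close>

lemma polar_simplex_bij: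
  assumes B: "ibasis B"
  shows "bij_betw (\<lambda>(x, k). x + step B k)
     (SIGMA x:polar_box b B h l. weight_points (- B) (wt B) (R - \<lfloor>weight x\<rfloor>)) (polar_simplex b B h l R)"
  (is "bij_betw ?f ?S ?T")
proof (rule bij_betwI')
  fix p q assume p: "p \<in> ?S" and q: "q \<in> ?S"
  obtain x k x' k' where pq: "p = (x, k)" "q = (x', k')" by (cases p, cases q)
  show "?f p = ?f q \<longleftrightarrow> p = q"
  proof
    assume eq: "?f p = ?f q"
    have "k j = k' j" for j
    proof (cases "j \<in> B")
      case True
      then show ?thesis using p q pq by (auto simp: weight_points_def)
    next
      case False
      have "polar_coord B l (x + step B k) j = polar_coord B l (x' + step B k') j" using eq pq by simp
      then show ?thesis
        unfolding polar_coord_step[OF B False] using p q pq False M_pos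
        by (intro half_line_period_unique[of "real M" "polar_closed b B j"]) (auto simp: polar_box_def)
    qed
    then have "k = k'" by auto
    then show "p = q" using eq pq by simp
  qed auto
next
  fix p assume "p \<in> ?S"
  then obtain x k where p: "p = (x, k)" "x \<in> polar_box b B h l"
      "k \<in> weight_points (- B) (wt B) (R - \<lfloor>weight x\<rfloor>)" by auto
  have fl: "of_int \<lfloor>weight x\<rfloor> = weight x"
    using p weight_int Ints_of_int_floor by (auto simp: polar_box_def lattice_class_def)
  have "int (\<Sum>j\<in>-B. wt B j * k j) \<le> R - \<lfloor>weight x\<rfloor>" using p(3) by (simp add: weight_points_def)
  then have "real (\<Sum>j\<in>-B. wt B j * k j) \<le> of_int R - of_int \<lfloor>weight x\<rfloor>"
    by linarith
  then have "weight (x + step B k) \<le> of_int R" by (simp only: weight_add weight_step[OF B] fl)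
  moreover have "x + step B k \<in> lattice_class h"
    using p(2) step_int[OF B] by (intro lattice_class_shift) (auto simp: polar_box_def)
  moreover have "half_line (polar_closed b B j) (polar_coord B l (x + step B k) j)" if "j \<in> - B" for j
  proof -
    have "half_line (polar_closed b B j) (polar_coord B l x j)" using p(2) that by (auto simp: polar_box_def)
    then show ?thesis using that polar_coord_step(1)[OF B, of j l x k] by (auto elim!: half_line_mono)
  qed
  ultimately show "?f p \<in> ?T" using p by (simp add: polar_simplex_def)
next
  fix x assume x: "x \<in> ?T"
  have "\<exists>k::nat. (j \<in> B \<longrightarrow> k = 0) \<and> (j \<notin> B \<longrightarrow> half_line (polar_closed b B j) (polar_coord B l x j - real M * real k) \<and>
      \<not> half_line (polar_closed b B j) (polar_coord B l x j - real M * real k - real M))" for j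
  proof (cases "j \<in> B")
    case False
    then have "half_line (polar_closed b B j) (polar_coord B l x j)" using x by (auto simp: polar_simplex_def)
    then show ?thesis using half_line_period[of "real M"] M_pos False by auto
  qed auto
  then obtain k where k: "\<And>j. j \<in> B \<Longrightarrow> k j = 0"
      "\<And>j. j \<notin> B \<Longrightarrow> half_line (polar_closed b B j) (polar_coord B l x j - real M * real (k j))"
      "\<And>j. j \<notin> B \<Longrightarrow> \<not> half_line (polar_closed b B j) (polar_coord B l x j - real M * real (k j) - real M)"
    by metis
  let ?x = "x - step B k"
  have box: "?x \<in> polar_box b B h l"
    unfolding polar_box_def using x k step_int[OF B] polar_coord_step(2)[OF B]
    by (auto simp: polar_simplex_def intro!: lattice_class_unshift)
  have fl: "of_int \<lfloor>weight ?x\<rfloor> = weight ?x"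
    using box weight_int Ints_of_int_floor by (auto simp: polar_box_def lattice_class_def)
  have "weight ?x + real (\<Sum>j\<in>-B. wt B j * k j) \<le> of_int R"
    using x by (simp only: weight_diff weight_step[OF B] polar_simplex_def) simp
  then have "real_of_int (\<lfloor>weight ?x\<rfloor> + int (\<Sum>j\<in>-B. wt B j * k j)) \<le> of_int R"
    by (simp only: of_int_add fl of_int_of_nat_eq)
  then have "\<lfloor>weight ?x\<rfloor> + int (\<Sum>j\<in>-B. wt B j * k j) \<le> R" by (simp only: of_int_le_iff)
  then have "k \<in> weight_points (- B) (wt B) (R - \<lfloor>weight ?x\<rfloor>)"
    unfolding weight_points_def using k(1) by auto
  then show "\<exists>p\<in>?S. x = ?f p" using box by (intro bexI[of _ "(?x, k)"]) auto
qed

definition simplex_qp :: "('d + 's) set \<Rightarrow> int \<Rightarrow> real" where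
  "simplex_qp B = (SOME E. \<exists>m. int_quasipoly m E \<and>
     (\<forall>n. - int (sum (wt B) (- B)) \<le> n \<longrightarrow> E n = real (card (weight_points (- B) (wt B) n))) \<and>
     (\<forall>n. E (- n) = (-1) ^ card (- B) * E (n - 1 - int (sum (wt B) (- B)))))"

lemma simplex_qp:
  assumes B: "ibasis B"
  shows "\<exists>m. int_quasipoly m (simplex_qp B)"
    and "- int (sum (wt B) (- B)) \<le> n \<Longrightarrow> simplex_qp B n = real (card (weight_points (- B) (wt B) n))"
    and "simplex_qp B (- n) = (-1) ^ CARD('d) * simplex_qp B (n - 1 - int (sum (wt B) (- B)))"
proof -
  have "\<exists>E m. int_quasipoly m E \<and>
     (\<forall>n. - int (sum (wt B) (- B)) \<le> n \<longrightarrow> E n = real (card (weight_points (- B) (wt B) n))) \<and>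
     (\<forall>n. E (- n) = (-1) ^ card (- B) * E (n - 1 - int (sum (wt B) (- B))))"
    using weight_points_quasipoly[of "- B" "wt B"] wt_pos[OF B] by auto
  from someI_ex[OF this] have *: "\<exists>m. int_quasipoly m (simplex_qp B) \<and>
     (\<forall>n. - int (sum (wt B) (- B)) \<le> n \<longrightarrow> simplex_qp B n = real (card (weight_points (- B) (wt B) n))) \<and>
     (\<forall>n. simplex_qp B (- n) = (-1) ^ card (- B) * simplex_qp B (n - 1 - int (sum (wt B) (- B))))"
    unfolding simplex_qp_def .
  \<comment> \<open>A basis has \<open>CARD('s)\<close> elements among
    \<open>CARD('d) + CARD('s)\<close> indices; this is where the exponent of the reciprocity sign
    comes from.\<close>
  have "card (- B) = CARD('d)"
    using card_ibasis[OF B] card_Plus[of "UNIV :: 'd set" "UNIV :: 's set"]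
    by (simp add: Compl_eq_Diff_UNIV card_Diff_subset)
  then show "\<exists>m. int_quasipoly m (simplex_qp B)"
    "- int (sum (wt B) (- B)) \<le> n \<Longrightarrow> simplex_qp B n = real (card (weight_points (- B) (wt B) n))"
    "simplex_qp B (- n) = (-1) ^ CARD('d) * simplex_qp B (n - 1 - int (sum (wt B) (- B)))"
    using * by auto
qed

text \<open>The quasipolynomial that counts \<open>polar_simplex\<close> for large \<open>R\<close>,
  continued to all \<open>R\<close>; reciprocity is a statement about this continuation.\<close>

definition polar_count :: "bool \<Rightarrow> ('d + 's) set \<Rightarrow> (real ^ 's) set \<Rightarrow> real ^ 's \<Rightarrow> int \<Rightarrow> real" where
  "polar_count b B h l R = (\<Sum>x\<in>polar_box b B h l. simplex_qp B (R - \<lfloor>weight x\<rfloor>))"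

lemma finite_polar_simplex:
  assumes B: "ibasis B"
  shows "finite (polar_simplex b B h l R)"
proof -
  have "finite (SIGMA x:polar_box b B h l. weight_points (- B) (wt B) (R - \<lfloor>weight x\<rfloor>))"
    using polar_box_finite[OF B] wt_pos[OF B] by (intro finite_SigmaI finite_weight_points) auto
  then show ?thesis using bij_betw_finite[OF polar_simplex_bij[OF B]] by blast
qed

lemma card_polar_simplex:
  assumes B: "ibasis B"
  shows "\<exists>R0. \<forall>R\<ge>R0. real (card (polar_simplex b B h l R)) = polar_count b B h l R"
proof -
  let ?R0 = "Max (insert 0 ((\<lambda>x. \<lfloor>weight x\<rfloor>) ` polar_box b B h l))"
  have "real (card (polar_simplex b B h l R)) = polar_count b B h l R" if R: "?R0 \<le> R" for R
  proof -
    have "\<forall>x\<in>polar_box b B h l. finite (weight_points (- B) (wt B) (R - \<lfloor>weight x\<rfloor>))"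
      using wt_pos[OF B] by (auto intro!: finite_weight_points)
    from card_SigmaI[OF polar_box_finite[OF B] this] bij_betw_same_card[OF polar_simplex_bij[OF B, of b h l R]]
    have "card (polar_simplex b B h l R) = (\<Sum>x\<in>polar_box b B h l. card (weight_points (- B) (wt B) (R - \<lfloor>weight x\<rfloor>)))"
      by simp
    moreover have "simplex_qp B (R - \<lfloor>weight x\<rfloor>) = real (card (weight_points (- B) (wt B) (R - \<lfloor>weight x\<rfloor>)))"
      if "x \<in> polar_box b B h l" for x
    proof (rule simplex_qp(2)[OF B])
      have "\<lfloor>weight x\<rfloor> \<le> ?R0" using that polar_box_finite[OF B] by (intro Max_ge) auto
      then have "0 \<le> R - \<lfloor>weight x\<rfloor>" using R by linarith
      moreover have "- int (sum (wt B) (- B)) \<le> 0" by linarith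
      ultimately show "- int (sum (wt B) (- B)) \<le> R - \<lfloor>weight x\<rfloor>" by linarith
    qed
    ultimately show ?thesis by (simp add: polar_count_def)
  qed
  then show ?thesis by blast
qed

lemma polar_count_qp:
  assumes B: "ibasis B"
  shows "\<exists>m. int_quasipoly m (\<lambda>R. polar_count b B h l R)"
proof -
  obtain m where "int_quasipoly m (simplex_qp B)" using simplex_qp(1)[OF B] by blast
  then have *: "int_quasipoly m (\<lambda>R. simplex_qp B (R - c))" for c
    using int_quasipoly_shift[of m "simplex_qp B" "- c"] by simp
  show ?thesis unfolding polar_count_def by (rule int_quasipoly_sum, rule exI, rule *)
qed

end

lemma scaled_int_vecs_dvd:
  assumes "m dvd n"
  shows "scaled_int_vecs n \<subseteq> scaled_int_vecs m"
proof
  fix x :: "real^'n" assume "x \<in> scaled_int_vecs n"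
  then obtain y where y: "y \<in> int_vecs" "x = real n *\<^sub>R y" by (auto simp: scaled_int_vecs_def)
  obtain k where "n = m * k" using assms by blast
  then have "x = real m *\<^sub>R real k *\<^sub>R y" using y by simp
  then show "x \<in> scaled_int_vecs m"
    unfolding scaled_int_vecs_def by (rule image_eqI) (rule add_subgroup_scale[OF add_subgroup_int_vecs y(1)])
qed

text \<open>Translates by arbitrary real vectors \<open>l\<close> are included, so the property
  passes to the lattice points of any subspace.\<close>

definition poly_on_cosets :: "nat \<Rightarrow> (real ^ 's \<Rightarrow> real) \<Rightarrow> bool" where
  "poly_on_cosets n f \<longleftrightarrow> 0 < n \<and>
     (\<forall>l. \<exists>p. real_polynomial_function p \<and> (\<forall>\<nu>\<in>scaled_int_vecs n. f (l + \<nu>) = p (l + \<nu>)))"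

lemma poly_on_cosets_dvd: "poly_on_cosets m f \<Longrightarrow> m dvd n \<Longrightarrow> 0 < n \<Longrightarrow> poly_on_cosets n f"
  unfolding poly_on_cosets_def using scaled_int_vecs_dvd by (meson subsetD)

lemma poly_on_cosets_lincomb:
  assumes "poly_on_cosets n f" "\<And>B. B \<in> F \<Longrightarrow> poly_on_cosets n (u B)" "finite F"
  shows "poly_on_cosets n (\<lambda>l. f l - (\<Sum>B\<in>F. c B * u B l))"
  unfolding poly_on_cosets_def
proof (intro conjI allI)
  fix l
  obtain p where p: "real_polynomial_function p" "\<And>\<nu>. \<nu> \<in> scaled_int_vecs n \<Longrightarrow> f (l + \<nu>) = p (l + \<nu>)"
    using assms(1) unfolding poly_on_cosets_def by blast
  have "\<forall>B. \<exists>p. B \<in> F \<longrightarrow> real_polynomial_function p \<and> (\<forall>\<nu>\<in>scaled_int_vecs n. u B (l + \<nu>) = p (l + \<nu>))"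
    using assms(2) unfolding poly_on_cosets_def by blast
  from choice[OF this] obtain P where P: "\<And>B. B \<in> F \<Longrightarrow> real_polynomial_function (P B)"
      "\<And>B \<nu>. B \<in> F \<Longrightarrow> \<nu> \<in> scaled_int_vecs n \<Longrightarrow> u B (l + \<nu>) = P B (l + \<nu>)" by blast
  have "real_polynomial_function (\<lambda>y. p y - (\<Sum>B\<in>F. c B * P B y))"
    using P(1) assms(3)
    by (intro real_polynomial_function_diff real_polynomial_function_sum real_polynomial_function.intros(2,4) p(1)) auto
  then show "\<exists>p. real_polynomial_function p \<and>
      (\<forall>\<nu>\<in>scaled_int_vecs n. f (l + \<nu>) - (\<Sum>B\<in>F. c B * u B (l + \<nu>)) = p (l + \<nu>))"
    using p(2) P(2) by (intro exI[of _ "\<lambda>y. p y - (\<Sum>B\<in>F. c B * P B y)"]) (auto intro!: sum.cong)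
qed (use assms(1) in \<open>simp add: poly_on_cosets_def\<close>)

section \<open>Reciprocity and quasipolynomiality of the truncated cones\<close>

context polarized_cone begin

text \<open>The reflection sends each polar coordinate \<open>t\<close> to \<open>M - t\<close>,
  hence the interval from 0 to \<open>M\<close> closed below to the one closed above. This exchanges
  the flag and changes the signs of \<open>h\<close> and \<open>l\<close>.\<close>

lemma polar_box_reflect:
  assumes B: "ibasis B" and x: "x \<in> polar_box b B h l"
  shows "step B (\<lambda>_. 1) - x \<in> polar_box (\<not> b) B (uminus ` h) (- l)"
proof -
  have c: "polar_coord B (- l) (step B (\<lambda>_. 1) - x) j = real M - polar_coord B l x j" if "j \<notin> B" for j
    using polar_coord_step(1)[OF B that, of "- l" "- x" "\<lambda>_. 1"]
    by (simp add: polar_coord_def slack_neg add.commute)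
  have "- x + step B (\<lambda>_. 1) \<in> lattice_class (uminus ` h)"
    using x step_int[OF B] by (intro lattice_class_shift lattice_class_neg) (auto simp: polar_box_def)
  then have "step B (\<lambda>_. 1) - x \<in> lattice_class (uminus ` h)" by simp
  moreover have "half_line (polar_closed (\<not> b) B j) (real M - polar_coord B l x j) \<and>
      \<not> half_line (polar_closed (\<not> b) B j) (real M - polar_coord B l x j - real M)" if "j \<notin> B" for j
  proof -
    have "half_line (polar_closed b B j) (polar_coord B l x j)" "\<not> half_line (polar_closed b B j) (polar_coord B l x j - real M)"
      using x that by (auto simp: polar_box_def)
    moreover have "polar_closed (\<not> b) B j \<longleftrightarrow> \<not> polar_closed b B j" by (auto simp: polar_closed_def)
    ultimately show ?thesis by (auto simp: half_line_def split: if_splits)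
  qed
  ultimately show ?thesis using c by (simp add: polar_box_def)
qed

text \<open>Reflection matches the box points, and the diagonal
  \<open>step B (\<lambda>_. 1)\<close> has weight \<open>sum (wt B) (- B)\<close>, the shift in the
  reciprocity of simplices. The remaining shift by 1 there is the reason for
  \<open>- R - 1\<close>.\<close>

lemma polar_count_reciprocity:
  assumes B: "ibasis B"
  shows "polar_count (\<not> b) B (uminus ` h) (- l) (- R - 1) = (-1) ^ CARD('d) * polar_count b B h l R"
proof -
  let ?F = "step B (\<lambda>_. 1)"
  have "polar_box (\<not> b) B (uminus ` h) (- l) = (\<lambda>x. ?F - x) ` polar_box b B h l"
  proof (intro equalityI subsetI)
    fix x assume "x \<in> polar_box (\<not> b) B (uminus ` h) (- l)"
    from polar_box_reflect[OF B this] have "?F - x \<in> polar_box b B h l" by (simp add: image_image)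
    then show "x \<in> (\<lambda>x. ?F - x) ` polar_box b B h l" by (intro image_eqI[of _ _ "?F - x"]) auto
  qed (use polar_box_reflect[OF B] in blast)
  then have "polar_count (\<not> b) B (uminus ` h) (- l) (- R - 1) =
      (\<Sum>x\<in>polar_box b B h l. simplex_qp B (- R - 1 - \<lfloor>weight (?F - x)\<rfloor>))"
    unfolding polar_count_def by (simp add: sum.reindex inj_on_def)
  also have "\<dots> = (\<Sum>x\<in>polar_box b B h l. (-1) ^ CARD('d) * simplex_qp B (R - \<lfloor>weight x\<rfloor>))"
  proof (rule sum.cong[OF refl])
    fix x assume "x \<in> polar_box b B h l"
    then have w: "of_int \<lfloor>weight x\<rfloor> = weight x"
      using weight_int Ints_of_int_floor by (auto simp: polar_box_def lattice_class_def)
    have "weight (?F - x) = of_int (int (sum (wt B) (- B)) - \<lfloor>weight x\<rfloor>)"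
      by (simp only: of_int_diff w) (simp add: weight_diff weight_step[OF B])
    then have "\<lfloor>weight (?F - x)\<rfloor> = int (sum (wt B) (- B)) - \<lfloor>weight x\<rfloor>" by (metis floor_of_int)
    then have "- R - 1 - \<lfloor>weight (?F - x)\<rfloor> = (\<lfloor>weight x\<rfloor> - R) - 1 - int (sum (wt B) (- B))" by linarith
    then have "(-1) ^ CARD('d) * simplex_qp B (- R - 1 - \<lfloor>weight (?F - x)\<rfloor>) = simplex_qp B (- (\<lfloor>weight x\<rfloor> - R))"
      using simplex_qp(3)[OF B, of "\<lfloor>weight x\<rfloor> - R"] by (simp only:)
    moreover have "(-1) ^ CARD('d) * (-1) ^ CARD('d) = (1::real)" by (simp flip: power_add)
    ultimately show "simplex_qp B (- R - 1 - \<lfloor>weight (?F - x)\<rfloor>) = (-1) ^ CARD('d) * simplex_qp B (R - \<lfloor>weight x\<rfloor>)"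
      by (metis minus_diff_eq mult.assoc mult_1)
  qed
  finally show ?thesis by (simp add: polar_count_def sum_distrib_left)
qed

text \<open>Such a translation of \<open>l\<close> moves the vertex by the lattice vector
  \<open>\<tau>\<close> and leaves the slacks outside \<open>B\<close> unchanged.\<close>

lemma polar_box_translate:
  assumes B: "ibasis B" and n: "n \<in> int_vecs"
  defines "\<tau> \<equiv> xpart (lift B (real M *\<^sub>R n) (\<lambda>_. 0))"
  shows "polar_box b B h (l + real M *\<^sub>R n) = (\<lambda>x. x + \<tau>) ` polar_box b B h l"
proof -
  have \<tau>: "\<tau> \<in> int_vecs" "lin_comb a \<tau> \<in> int_vecs"
    using lift_xpart_int[OF B _ n, of "\<lambda>_. 0"] by (auto simp: \<tau>_def)
  have s: "slack \<tau> (real M *\<^sub>R n) j = 0" if "j \<notin> B" for j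
    using that lift_outside[OF B] by (simp add: \<tau>_def slack_xpart_lift[OF B])
  have p: "polar_coord B (l + real M *\<^sub>R n) (x + \<tau>) j = polar_coord B l x j" if "j \<notin> B" for x j
    using s[OF that] by (simp add: polar_coord_def slack_add)
  have i: "x + \<tau> \<in> polar_box b B h (l + real M *\<^sub>R n) \<longleftrightarrow> x \<in> polar_box b B h l" for x
    using lattice_class_shift[OF _ \<tau>, of x h] lattice_class_unshift[OF _ \<tau>, of "x + \<tau>" h]
    by (auto simp: polar_box_def p)
  show ?thesis
  proof (intro equalityI subsetI)
    fix x assume "x \<in> polar_box b B h (l + real M *\<^sub>R n)"
    then show "x \<in> (\<lambda>x. x + \<tau>) ` polar_box b B h l"
      using i[of "x - \<tau>"] by (intro image_eqI[of _ _ "x - \<tau>"]) auto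
  qed (use i in blast)
qed

text \<open>When \<open>l\<close> moves by \<open>\<nu>\<close> in \<open>M * m\<close> times
  \<open>int_vecs\<close>, the box moves rigidly and all its weights grow by \<open>C \<nu>\<close>,
  a multiple of the period \<open>m\<close> of \<open>simplex_qp B\<close>. So each summand is a
  polynomial in a linear form.\<close>

lemma polar_count_quasipoly:
  assumes B: "ibasis B"
  shows "\<exists>n. poly_on_cosets n (\<lambda>l. polar_count b B h l R)"
proof -
  obtain m where m: "int_quasipoly m (simplex_qp B)" using simplex_qp(1)[OF B] by blast
  then have m0: "0 < m" by (simp add: int_quasipoly_def)
  define C where "C = cost (xi_cost \<xi>) B"
  have linC: "linear C" unfolding C_def by (rule linear_cost[OF B])
  have "\<exists>p. real_polynomial_function p \<and>
           (\<forall>\<nu>\<in>scaled_int_vecs (M * m). polar_count b B h (l + \<nu>) R = p (l + \<nu>))" for l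
  proof -
    have "\<forall>x. \<exists>p. \<forall>k. simplex_qp B (R - \<lfloor>weight x\<rfloor> + int m * k) = poly p (of_int k)"
      using m unfolding int_quasipoly_def by blast
    from choice[OF this] obtain P
      where P: "\<And>x k. simplex_qp B (R - \<lfloor>weight x\<rfloor> + int m * k) = poly (P x) (of_int k)" by blast
    \<comment> \<open>\<open>- C (y - l) / m\<close> is the number of periods by which the argument
      of \<open>simplex_qp B\<close> is shifted.\<close>
    define p where "p y = (\<Sum>x\<in>polar_box b B h l. poly (P x) (- C (y - l) / real m))" for y
    have "bounded_linear (\<lambda>y. - C y / real m)"
      using linC by (intro bounded_linear_divide[THEN bounded_linear_compose] bounded_linear_minus)
        (simp add: linear_conv_bounded_linear)
    then have "real_polynomial_function (\<lambda>y. - C y / real m + C l / real m)"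
      by (intro real_polynomial_function.intros(1,2,3))
    moreover have "- C (y - l) / real m = - C y / real m + C l / real m" for y
      by (simp add: linear_diff[OF linC] diff_divide_distrib)
    ultimately have "real_polynomial_function p"
      unfolding p_def by (intro real_polynomial_function_sum real_polynomial_function_poly) (auto intro: polar_box_finite[OF B])
    moreover have "polar_count b B h (l + \<nu>) R = p (l + \<nu>)" if \<nu>: "\<nu> \<in> scaled_int_vecs (M * m)" for \<nu>
    proof -
      obtain y where y: "y \<in> int_vecs" "\<nu> = real (M * m) *\<^sub>R y" using \<nu> by (auto simp: scaled_int_vecs_def)
      define n where "n = real m *\<^sub>R y"
      have n: "n \<in> int_vecs" "\<nu> = real M *\<^sub>R n"
        using y add_subgroup_scale[OF add_subgroup_int_vecs] by (auto simp: n_def)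
      define \<tau> where "\<tau> = xpart (lift B (real M *\<^sub>R n) (\<lambda>_. 0))"
      define t where "t = C (real M *\<^sub>R y)"
      have "t \<in> \<int>"
      proof -
        have "coord B (real M *\<^sub>R y) k \<in> \<int>" for k
          using coord_scaled_int[OF B, of "slack 0 y" k] y(1)
          by (auto simp: slack_def int_vecs_def lin_comb_component split: sum.splits)
        then show ?thesis unfolding t_def C_def cost_def
          by (intro Ints_sum Ints_mult) (auto simp: xi_cost_def split: sum.splits)
      qed
      then have t: "of_int \<lfloor>t\<rfloor> = t" by (rule Ints_of_int_floor)
      have Cn: "C \<nu> = real m * t"
        using y by (simp add: t_def linear_scale[OF linC])
      have w\<tau>: "weight \<tau> = real m * t"
        unfolding \<tau>_def weight_lift[OF B] n(2)[symmetric] using Cn by (simp add: C_def)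
      have "polar_count b B h (l + \<nu>) R = (\<Sum>x\<in>polar_box b B h l. simplex_qp B (R - \<lfloor>weight (x + \<tau>)\<rfloor>))"
        unfolding polar_count_def n(2) polar_box_translate[OF B n(1)] \<tau>_def by (simp add: sum.reindex inj_on_def)
      also have "\<dots> = p (l + \<nu>)"
        unfolding p_def
      proof (rule sum.cong[OF refl])
        fix x assume "x \<in> polar_box b B h l"
        then have w: "of_int \<lfloor>weight x\<rfloor> = weight x"
          using weight_int Ints_of_int_floor by (auto simp: polar_box_def lattice_class_def)
        have "weight (x + \<tau>) = of_int (\<lfloor>weight x\<rfloor> + int m * \<lfloor>t\<rfloor>)" by (simp only: of_int_add of_int_mult w t) (simp add: weight_add w\<tau>)
        then have "\<lfloor>weight (x + \<tau>)\<rfloor> = \<lfloor>weight x\<rfloor> + int m * \<lfloor>t\<rfloor>" by (metis floor_of_int)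
        then have "simplex_qp B (R - \<lfloor>weight (x + \<tau>)\<rfloor>) = simplex_qp B (R - \<lfloor>weight x\<rfloor> + int m * (- \<lfloor>t\<rfloor>))"
          by (simp add: algebra_simps)
        also have "\<dots> = poly (P x) (of_int (- \<lfloor>t\<rfloor>))" by (rule P)
        also have "of_int (- \<lfloor>t\<rfloor>) = - C (l + \<nu> - l) / real m" using m0 t by (simp add: Cn)
        finally show "simplex_qp B (R - \<lfloor>weight (x + \<tau>)\<rfloor>) = poly (P x) (- C (l + \<nu> - l) / real m)" .
      qed
      finally show ?thesis .
    qed
    ultimately show ?thesis by blast
  qed
  then show ?thesis using M_pos m0 by (intro exI[of _ "M * m"]) (auto simp: poly_on_cosets_def)
qed

text \<open>The nonbasic coordinates are the \<open>x $ i\<close>, whose reduced costs are positive.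
  No edge is flipped, and the polarized cone is the whole orthant.\<close>

definition slack_basis :: "('d + 's) set" where
  "slack_basis = range Inr"

lemma ibasis_slack: "ibasis slack_basis"
  unfolding ibasis_def
proof (intro allI ex_ex1I)
  fix l :: "real^'s"
  show "\<exists>z. (\<forall>j. j \<notin> slack_basis \<longrightarrow> z j = 0) \<and> comb z = l"
    by (intro exI[of _ "slack 0 l"] conjI allI impI comb_slack)
       (auto simp: slack_basis_def slack_def split: sum.splits)
next
  fix l z y
  assume z: "(\<forall>j. j \<notin> slack_basis \<longrightarrow> z j = 0) \<and> comb z = l"
    and y: "(\<forall>j. j \<notin> slack_basis \<longrightarrow> y j = 0) \<and> comb y = l"
  have "Inl i \<notin> slack_basis" for i by (auto simp: slack_basis_def)
  then have "xpart z = xpart y" using z y by (simp add: xpart_def vec_eq_iff)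
  then show "z = y" using slack_xpart[of z] slack_xpart[of y] z y by simp
qed

lemma red_slack_basis: "red slack_basis (Inl i) = real (\<xi> i)"
proof -
  have "cost (xi_cost \<xi>) slack_basis (gen (Inl i)) = 0"
    unfolding cost_def using coord_outside[OF ibasis_slack]
    by (intro sum.neutral) (auto simp: xi_cost_def slack_basis_def split: sum.splits)
  then show ?thesis by (simp add: reduced_cost_def xi_cost_def)
qed

text \<open>The sets \<open>{j. nonpos b (z j)}\<close> are the sign patterns of the two
  decompositions: \<open>False\<close> belongs to the closed polyhedron, \<open>True\<close> to its
  interior.\<close>

definition nonpos :: "bool \<Rightarrow> real \<Rightarrow> bool" where
  "nonpos b t \<longleftrightarrow> (if b then t \<le> 0 else t < 0)"

lemma polar_simplex_match:
  assumes B: "ibasis B"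
  shows "polar_simplex b B h l R = {x \<in> lattice_class h.
     polar_match (xi_cost \<xi>) UNIV B {j. nonpos b (slack x l j)} \<and> weight x \<le> of_int R}"
proof -
  have "half_line (polar_closed b B j) (polar_coord B l x j) \<longleftrightarrow> (nonpos b (slack x l j) \<longleftrightarrow> red B j < 0)"
    if "j \<notin> B" for x j
    using red_nz[OF B that]
    by (auto simp: half_line_def polar_closed_def polar_coord_def nonpos_def sgn_if not_less not_le)
  then show ?thesis by (auto simp: polar_simplex_def polar_match_def)
qed

lemma polar_simplex_slack:
  "polar_simplex b slack_basis h l R = {x \<in> lattice_class h. (\<forall>i. \<not> nonpos b (x $ i)) \<and> weight x \<le> of_int R}"
proof -
  have "polar_match (xi_cost \<xi>) UNIV slack_basis {j. nonpos b (slack x l j)} \<longleftrightarrow> (\<forall>i. \<not> nonpos b (x $ i))" for x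
  proof -
    have "UNIV - slack_basis = range Inl" by (auto simp: slack_basis_def) (metis obj_sumE rangeI)
    then show ?thesis by (simp add: polar_match_def red_slack_basis)
  qed
  then show ?thesis unfolding polar_simplex_match[OF ibasis_slack] by auto
qed

text \<open>The common form of both counting problems: \<open>False\<close> gives the points behind
  \<open>count_T\<close>, \<open>True\<close> those behind \<open>count_FT\<close>.\<close>

definition truncated_orthant :: "bool \<Rightarrow> (real ^ 's) set \<Rightarrow> real ^ 's \<Rightarrow> (real ^ 'd) set" where
  "truncated_orthant b h l = {x \<in> lattice_class h. (\<forall>i. \<not> nonpos b (x $ i)) \<and> (\<exists>v. nonpos b (slack x l (Inr v)))}"

lemma truncated_orthant_finite: "finite (truncated_orthant b h l)"
proof -
  define C where "C = Max (range (\<lambda>(i, v). \<bar>l $ v\<bar> / a i $ v))"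
  have C: "\<bar>l $ v\<bar> / a i $ v \<le> C" for i v unfolding C_def by (rule Max_ge) auto
  have "\<bar>x $ i\<bar> \<le> C" if x: "x \<in> truncated_orthant b h l" for x i
  proof -
    obtain v where v: "nonpos b (slack x l (Inr v))" using x by (auto simp: truncated_orthant_def)
    have pos: "0 \<le> x $ i" for i using x by (cases b) (auto simp: truncated_orthant_def nonpos_def not_le not_less less_imp_le)
    have "x $ i * a i $ v \<le> lin_comb a x $ v"
      unfolding lin_comb_component by (rule member_le_sum) (auto simp: pos less_imp_le[OF a_pos])
    also have "\<dots> \<le> l $ v" using v by (auto simp: nonpos_def split: if_splits)
    finally have "x $ i \<le> \<bar>l $ v\<bar> / a i $ v" using a_pos[of i v] by (simp add: pos_le_divide_eq)
    then show ?thesis using pos[of i] C[of v i] by simp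
  qed
  then have "truncated_orthant b h l \<subseteq> {x \<in> int_vecs. \<forall>i. \<bar>x $ i\<bar> \<le> C}"
    by (auto simp: truncated_orthant_def lattice_class_def)
  then show ?thesis by (rule finite_subset) (rule finite_bounded_int_vecs)
qed

definition psign :: "('d + 's) set \<Rightarrow> int" where
  "psign B = polar_sign (xi_cost \<xi>) UNIV B"

text \<open>The orthant minus the signed cones of the polyhedron. It is defined for every
  \<open>l\<close>, but with the bases of the fixed chamber, and so it extends the count as a
  quasipolynomial.\<close>

definition cell_count :: "bool \<Rightarrow> (real ^ 's) set \<Rightarrow> (real ^ 's) set \<Rightarrow> real ^ 's \<Rightarrow> int \<Rightarrow> real" where
  "cell_count b U h l R = polar_count b slack_basis h l R -
     (\<Sum>B\<in>cell_bases U. of_int (psign B) * polar_count b B h l R)"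

text \<open>The pointwise decomposition is summed over the points of \<open>weight\<close> at most
  \<open>R\<close>; by assumption \<open>R\<close> the truncation loses no point of
  \<open>truncated_orthant\<close>.\<close>

lemma card_truncated_orthant:
  assumes U: "U \<in> cells" and l: "l \<in> closure U"
    and R: "\<And>x. x \<in> truncated_orthant b h l \<Longrightarrow> weight x \<le> of_int R"
  shows "int (card (truncated_orthant b h l)) = int (card (polar_simplex b slack_basis h l R)) -
     (\<Sum>B\<in>cell_bases U. psign B * int (card (polar_simplex b B h l R)))"
proof -
  let ?T = "truncated_orthant b h l" and ?S = "\<lambda>B. polar_simplex b B h l R"
  define Z where "Z = ?T \<union> ?S slack_basis \<union> (\<Union>B\<in>cell_bases U. ?S B)"
  have bas: "ibasis B" if "B \<in> cell_bases U" for B using that by (simp add: cell_bases_def)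
  have Z: "finite Z"
    unfolding Z_def using truncated_orthant_finite finite_polar_simplex[OF ibasis_slack] finite_polar_simplex[OF bas] by auto
  have card: "int (card A) = (\<Sum>x\<in>Z. of_bool (x \<in> A))" if "A \<subseteq> Z" for A
  proof -
    have "(\<Sum>x\<in>Z. of_bool (x \<in> A)) = (\<Sum>x\<in>A. 1::int)"
      using that Z by (intro sum.mono_neutral_cong_right) auto
    then show ?thesis by simp
  qed
  have pt: "of_bool (x \<in> ?T) = (of_bool (x \<in> ?S slack_basis) - (\<Sum>B\<in>cell_bases U. psign B * of_bool (x \<in> ?S B)) :: int)"
    if "x \<in> Z" for x
  proof -
    have xL: "x \<in> lattice_class h" using that by (auto simp: Z_def truncated_orthant_def polar_simplex_def)
    have lv: "of_bool (\<forall>j. \<not> nonpos b (slack x l j)) =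
        (\<Sum>B\<in>cell_bases U. psign B * of_bool (polar_match (xi_cost \<xi>) UNIV B {j. nonpos b (slack x l j)}))"
      using polar_decomposition[OF xi_generic U, of "slack x l"] l
      by (cases b) (simp_all add: nonpos_def not_less not_le psign_def)
    have all: "(\<forall>j. \<not> nonpos b (slack x l j)) \<longleftrightarrow> (\<forall>i. \<not> nonpos b (x $ i)) \<and> (\<forall>v. \<not> nonpos b (slack x l (Inr v)))"
      by (metis obj_sumE slack_simps(1))
    show ?thesis
    proof (cases "weight x \<le> of_int R")
      case True
      then have "x \<in> ?S B \<longleftrightarrow> polar_match (xi_cost \<xi>) UNIV B {j. nonpos b (slack x l j)}"
        if "B \<in> cell_bases U" for B
        using polar_simplex_match[OF bas[OF that]] xL by auto
      then have "(\<Sum>B\<in>cell_bases U. psign B * of_bool (x \<in> ?S B)) = of_bool (\<forall>j. \<not> nonpos b (slack x l j))"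
        unfolding lv by (intro sum.cong) simp_all
      then show ?thesis unfolding polar_simplex_slack truncated_orthant_def all using True xL by auto
    next
      case False
      then have "x \<notin> ?T" "x \<notin> ?S B" for B using R by (auto simp: polar_simplex_def)
      then show ?thesis by simp
    qed
  qed
  have "int (card ?T) = (\<Sum>x\<in>Z. of_bool (x \<in> ?S slack_basis)) - (\<Sum>x\<in>Z. \<Sum>B\<in>cell_bases U. psign B * of_bool (x \<in> ?S B))"
    using pt by (subst card) (auto simp: Z_def sum_subtractf[symmetric])
  also have "(\<Sum>x\<in>Z. \<Sum>B\<in>cell_bases U. psign B * of_bool (x \<in> ?S B)) = (\<Sum>B\<in>cell_bases U. psign B * (\<Sum>x\<in>Z. of_bool (x \<in> ?S B)))"
    by (subst sum.swap) (simp add: sum_distrib_left)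
  also have "\<dots> = (\<Sum>B\<in>cell_bases U. psign B * int (card (?S B)))"
    by (intro sum.cong refl) (subst card, auto simp: Z_def)
  also have "(\<Sum>x\<in>Z. of_bool (x \<in> ?S slack_basis)) = int (card (?S slack_basis))"
    by (subst card) (auto simp: Z_def)
  finally show ?thesis .
qed

text \<open>The right-hand side is a quasipolynomial in the truncation level \<open>R\<close> that is constant for large
  \<open>R\<close>, so the truncation may be dropped altogether.\<close>

lemma cell_count_eq_card:
  assumes U: "U \<in> cells" and l: "l \<in> closure U"
  shows "cell_count b U h l R = real (card (truncated_orthant b h l))"
proof -
  have bas: "ibasis B" if "B \<in> insert slack_basis (cell_bases U)" for B
    using that ibasis_slack by (auto simp: cell_bases_def)
  have "\<exists>m. int_quasipoly m (\<lambda>R. \<Sum>B\<in>cell_bases U. - of_int (psign B) * polar_count b B h l R)"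
  proof (rule int_quasipoly_sum)
    fix B assume "B \<in> cell_bases U"
    then obtain m where "int_quasipoly m (\<lambda>R. polar_count b B h l R)" using polar_count_qp[OF bas] by blast
    from int_quasipoly_cmult[OF this]
    show "\<exists>m. int_quasipoly m (\<lambda>R. - of_int (psign B) * polar_count b B h l R)" by blast
  qed
  then obtain m1 where m1: "int_quasipoly m1 (\<lambda>R. \<Sum>B\<in>cell_bases U. - of_int (psign B) * polar_count b B h l R)" by blast
  obtain m2 where m2: "int_quasipoly m2 (\<lambda>R. polar_count b slack_basis h l R)"
    using polar_count_qp[OF ibasis_slack] by blast
  have pos: "0 < m1" "0 < m2" using m1 m2 by (auto simp: int_quasipoly_def)
  have "int_quasipoly (m1 * m2) (\<lambda>R. polar_count b slack_basis h l R + (\<Sum>B\<in>cell_bases U. - of_int (psign B) * polar_count b B h l R))"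
    using int_quasipoly_mult[OF m1 pos(2)] int_quasipoly_mult[OF m2 pos(1)]
    by (intro int_quasipoly_add_same) (simp_all add: mult.commute)
  then have qp: "int_quasipoly (m1 * m2) (cell_count b U h l)"
    by (simp add: cell_count_def[abs_def] sum_negf)
  have "\<forall>B. \<exists>R0. B \<in> insert slack_basis (cell_bases U) \<longrightarrow>
      (\<forall>R\<ge>R0. real (card (polar_simplex b B h l R)) = polar_count b B h l R)"
    using card_polar_simplex[OF bas] by blast
  from choice[OF this] obtain R0 where R0: "\<And>B R. B \<in> insert slack_basis (cell_bases U) \<Longrightarrow> R0 B \<le> R \<Longrightarrow>
      real (card (polar_simplex b B h l R)) = polar_count b B h l R" by blast
  \<comment> \<open>Beyond \<open>R1\<close> the truncation contains the whole truncated orthant;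
    beyond \<open>R2\<close> the quasipolynomials of all cones equal their counts.\<close>
  define R1 where "R1 = Max (insert 0 ((\<lambda>x. \<lceil>weight x\<rceil>) ` truncated_orthant b h l))"
  define R2 where "R2 = Max (range R0)"
  have "cell_count b U h l R = real (card (truncated_orthant b h l))" if R: "max R1 R2 \<le> R" for R
  proof -
    have w: "weight x \<le> of_int R" if "x \<in> truncated_orthant b h l" for x
    proof -
      have "\<lceil>weight x\<rceil> \<le> R1" unfolding R1_def using that truncated_orthant_finite by (intro Max_ge) auto
      then show ?thesis using R by linarith
    qed
    have "R0 B \<le> R" for B
    proof -
      have "R0 B \<le> R2" unfolding R2_def by (intro Max_ge) auto
      then show ?thesis using R by simp
    qed
    then have pc: "polar_count b B h l R = real (card (polar_simplex b B h l R))"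
      if "B \<in> insert slack_basis (cell_bases U)" for B using R0[OF that] by simp
    have "real (card (truncated_orthant b h l)) = of_int (int (card (polar_simplex b slack_basis h l R)) -
       (\<Sum>B\<in>cell_bases U. psign B * int (card (polar_simplex b B h l R))))"
      by (subst card_truncated_orthant[OF U l w, symmetric]) simp_all
    also have "\<dots> = cell_count b U h l R" unfolding cell_count_def by (simp add: pc)
    finally show ?thesis by simp
  qed
  from int_quasipoly_eventually_const[OF qp this] show ?thesis .
qed

text \<open>Bases and signs depend only on the chamber and the functional, so the reciprocity of the
  cones applies term by term, also where \<open>cell_count\<close> is not a count.\<close>

lemma cell_count_reciprocity:
  "cell_count (\<not> b) U (uminus ` h) (- l) (- R - 1) = (-1) ^ CARD('d) * cell_count b U h l R"
proof -
  have "(\<Sum>B\<in>cell_bases U. of_int (psign B) * polar_count (\<not> b) B (uminus ` h) (- l) (- R - 1)) =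
      (\<Sum>B\<in>cell_bases U. (-1) ^ CARD('d) * (of_int (psign B) * polar_count b B h l R))"
    by (intro sum.cong) (auto simp: cell_bases_def polar_count_reciprocity)
  then show ?thesis
    unfolding cell_count_def by (simp add: polar_count_reciprocity[OF ibasis_slack] right_diff_distrib sum_distrib_left)
qed

lemma cell_count_quasipoly: "\<exists>n. poly_on_cosets n (\<lambda>l. cell_count b U h l R)"
proof -
  have "\<forall>B. \<exists>n. ibasis B \<longrightarrow> poly_on_cosets n (\<lambda>l. polar_count b B h l R)"
    using polar_count_quasipoly by blast
  from choice[OF this] obtain n where n: "\<And>B. ibasis B \<Longrightarrow> poly_on_cosets (n B) (\<lambda>l. polar_count b B h l R)" by blast
  define K where "K = (\<Prod>B\<in>{B. ibasis B}. n B)"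
  have K: "0 < K" unfolding K_def using n by (intro prod_pos) (auto simp: poly_on_cosets_def)
  have dvd: "n B dvd K" if "ibasis B" for B unfolding K_def using that by (intro dvd_prodI) auto
  have "poly_on_cosets K (\<lambda>l. polar_count b B h l R)" if "ibasis B" for B
    using poly_on_cosets_dvd[OF n[OF that] dvd[OF that] K] .
  then show ?thesis unfolding cell_count_def using ibasis_slack
    by (intro exI[of _ K] poly_on_cosets_lincomb) (auto simp: cell_bases_def)
qed

end

section \<open>Combinatorial type\<close>

lemma closure_finite_UN: "finite A \<Longrightarrow> closure (\<Union>x\<in>A. f x) = (\<Union>x\<in>A. closure (f x))"
  by (induction A rule: finite_induct) auto

context vector_configuration begin

text \<open>Membership of \<open>l\<close> says that the fibre over \<open>l\<close> has a
  nonnegative point whose support is exactly \<open>Y\<close>; this is how sets of tight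
  inequalities are detected.\<close>

definition ocone_of :: "'j set \<Rightarrow> 'v set" where
  "ocone_of Y = {comb z | z. (\<forall>j\<in>Y. 0 < z j) \<and> (\<forall>j. j \<notin> Y \<longrightarrow> z j = 0)}"

lemma ocone_subset_cone: "ocone_of Y \<subseteq> cone_of Y"
  unfolding ocone_of_def cone_of_def by (smt (verit, best) mem_Collect_eq subsetI)

lemma ocone_cone_combination:
  assumes "x \<in> ocone_of Y" "y \<in> cone_of Y" "0 < s" "0 \<le> t"
  shows "s *\<^sub>R x + t *\<^sub>R y \<in> ocone_of Y"
proof -
  obtain z where z: "x = comb z" "\<forall>j\<in>Y. 0 < z j" "\<forall>j. j \<notin> Y \<longrightarrow> z j = 0"
    using assms(1) unfolding ocone_of_def by auto
  obtain z' where z': "y = comb z'" "\<forall>j. 0 \<le> z' j" "\<forall>j. j \<notin> Y \<longrightarrow> z' j = 0"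
    using assms(2) unfolding cone_of_def by auto
  show ?thesis unfolding ocone_of_def using assms(3,4) z z' comb_lin[of s z t z']
    by (intro CollectI exI[of _ "\<lambda>j. s * z j + t * z' j"]) (auto intro: add_pos_nonneg)
qed

end

context positive_configuration begin

text \<open>Prolong the segment from \<open>l1\<close> through \<open>l2\<close> to
  \<open>l3\<close> in \<open>K\<close>, and the one from \<open>l3\<close> through
  \<open>l1\<close> to \<open>l4\<close> in \<open>K\<close>. As \<open>l1\<close> lies between
  \<open>l3\<close> and \<open>l4\<close>, \<open>cell_face\<close> puts \<open>l3\<close> into the
  closed cone; then \<open>l2\<close>, between \<open>l1\<close> and \<open>l3\<close>, has a
  positive share of \<open>l1\<close> and lies in the relatively open cone.\<close>

lemma rel_interior_same_ocone:
  assumes K: "convex K" "K \<subseteq> closure U" "U \<in> cells"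
    and l: "l1 \<in> rel_interior K" "l2 \<in> rel_interior K" and Y: "l1 \<in> ocone_of Y"
  shows "l2 \<in> ocone_of Y"
proof -
  have K': "l1 \<in> K" "l2 \<in> K" "K \<noteq> {}" using l rel_interior_subset by auto
  obtain e where e: "1 < e" "(1 - e) *\<^sub>R l1 + e *\<^sub>R l2 \<in> K"
    using l(2) K'(1) unfolding convex_rel_interior_iff[OF K(1) K'(3)] by blast
  define l3 where "l3 = (1 - e) *\<^sub>R l1 + e *\<^sub>R l2"
  obtain f where f: "1 < f" "(1 - f) *\<^sub>R l3 + f *\<^sub>R l1 \<in> K"
    using l(1) e(2) unfolding convex_rel_interior_iff[OF K(1) K'(3)] l3_def by blast
  define l4 where "l4 = (1 - f) *\<^sub>R l3 + f *\<^sub>R l1"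
  have "((f - 1) / f) *\<^sub>R l3 + (1 / f) *\<^sub>R l4 = l1"
  proof -
    have "((f - 1) / f) *\<^sub>R l3 + (1 / f) *\<^sub>R l4 = ((f - 1) / f + (1 / f) * (1 - f)) *\<^sub>R l3 + ((1 / f) * f) *\<^sub>R l1"
      unfolding l4_def by (simp add: scaleR_add_right scaleR_add_left)
    also have "(f - 1) / f + (1 / f) * (1 - f) = 0" using f by (simp add: field_simps)
    also have "(1 / f) * f = 1" using f by simp
    finally show ?thesis by simp
  qed
  then have "((f - 1) / f) *\<^sub>R l3 + (1 / f) *\<^sub>R l4 \<in> cone_of Y" using Y ocone_subset_cone by auto
  then have l3: "l3 \<in> cone_of Y"
    using e f K(2) by (intro cell_face[OF K(3), of l3 l4]) (auto simp: l3_def l4_def)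
  have "((e - 1) / e) *\<^sub>R l1 + (1 / e) *\<^sub>R l3 = l2"
  proof -
    have "((e - 1) / e) *\<^sub>R l1 + (1 / e) *\<^sub>R l3 = ((e - 1) / e + (1 / e) * (1 - e)) *\<^sub>R l1 + ((1 / e) * e) *\<^sub>R l2"
      unfolding l3_def by (simp add: scaleR_add_right scaleR_add_left)
    also have "(e - 1) / e + (1 / e) * (1 - e) = 0" using e by (simp add: field_simps)
    also have "(1 / e) * e = 1" using e by simp
    finally show ?thesis by simp
  qed
  moreover have "((e - 1) / e) *\<^sub>R l1 + (1 / e) *\<^sub>R l3 \<in> ocone_of Y"
    using e by (intro ocone_cone_combination Y l3) auto
  ultimately show ?thesis by simp
qed

end

section \<open>Faces of the polytopes in terms of tight inequalities\<close>

context lattice_cone begin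

lemma lin_comb_nonneg: "0 \<le> x \<Longrightarrow> 0 \<le> lin_comb a x $ v"
  unfolding lin_comb_component by (intro sum_nonneg) (auto simp: less_eq_vec_def less_imp_le[OF a_pos])

lemma lin_comb_pos:
  assumes "0 \<le> x" "x \<noteq> 0"
  shows "0 < lin_comb a x $ v"
proof -
  obtain i where "x $ i \<noteq> 0" using assms(2) by (auto simp: vec_eq_iff)
  then have i: "0 < x $ i" using assms(1) by (simp add: less_eq_vec_def order.not_eq_order_implies_strict)
  have "0 < x $ i * a i $ v" using i a_pos by simp
  also have "\<dots> \<le> lin_comb a x $ v"
    unfolding lin_comb_component using assms(1)
    by (intro member_le_sum) (auto simp: less_eq_vec_def less_imp_le[OF a_pos])
  finally show ?thesis .
qed

lemma continuous_on_lin_comb: "continuous_on S (\<lambda>x. lin_comb a x $ v)"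
  unfolding lin_comb_component by (intro continuous_intros)

text \<open>As \<open>lin_comb\<close> is nonnegative on the orthant, only coordinates with
  \<open>0 < l $ v\<close> contribute to the open set. Weak inequalities are limits of strict ones
  by shrinking towards the origin.\<close>

lemma polytope_closed_eq: "polytope_closed a l = {x. 0 \<le> x \<and> (\<exists>v. 0 < l $ v \<and> lin_comb a x $ v \<le> l $ v)}"
  (is "_ = ?P")
proof (rule equalityI)
  have "?P = (\<Union>v\<in>{v. 0 < l $ v}. (\<Inter>i. {x. 0 \<le> x $ i}) \<inter> {x. lin_comb a x $ v \<le> l $ v})"
    by (auto simp: less_eq_vec_def)
  moreover have "closed \<dots>"
    by (intro closed_UN closed_Int closed_INT ballI closed_Collect_le continuous_on_lin_comb continuous_intros) auto
  ultimately have "closed ?P" by simp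
  moreover have "polytope_open a l \<subseteq> ?P"
    unfolding polytope_open_def using lin_comb_nonneg
    by (auto simp: less_eq_vec_def[of l] not_le) (meson le_less_trans less_imp_le)
  ultimately show "polytope_closed a l \<subseteq> ?P" unfolding polytope_closed_def by (simp add: closure_minimal)
  show "?P \<subseteq> polytope_closed a l"
  proof
    fix x assume "x \<in> ?P"
    then obtain v where v: "0 \<le> x" "0 < l $ v" "lin_comb a x $ v \<le> l $ v" by auto
    have "\<forall>\<^sub>F t in at_right (0::real). t \<in> {0<..<1}" by (rule eventually_at_right_real) simp
    then have "\<forall>\<^sub>F t in at_right 0. (1 - t) *\<^sub>R x \<in> closure (polytope_open a l)"
    proof eventually_elim
      case (elim t)
      have "lin_comb a ((1 - t) *\<^sub>R x) $ v < l $ v"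
      proof (cases "lin_comb a x $ v = 0")
        case False
        then have "0 < lin_comb a x $ v" using lin_comb_nonneg[OF v(1), of v] by linarith
        then have "(1 - t) * lin_comb a x $ v < lin_comb a x $ v" using elim by simp
        then show ?thesis using v by (simp add: lin_comb_scale)
      qed (use v in \<open>simp add: lin_comb_scale\<close>)
      then have "(1 - t) *\<^sub>R x \<in> polytope_open a l"
        using v(1) elim by (auto simp: polytope_open_def less_eq_vec_def not_le)
      then show ?case using closure_subset by blast
    qed
    moreover have "((\<lambda>t. (1 - t) *\<^sub>R x) \<longlongrightarrow> (1 - 0) *\<^sub>R x) (at_right 0)" by (intro tendsto_intros)
    ultimately show "x \<in> polytope_closed a l" unfolding polytope_closed_def
      using Lim_in_closed_set[of "closure (polytope_open a l)" "\<lambda>t. (1 - t) *\<^sub>R x" "at_right 0"] by simp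
  qed
qed

text \<open>The germ of \<open>polytope_closed a l\<close> at a point is determined by the coordinates vanishing there and,
  unless some inequality is strict, by the set of tight inequalities.\<close>

definition zeros :: "real ^ 'd \<Rightarrow> 'd set" where
  "zeros x = {i. x $ i = 0}"

definition tight :: "real ^ 's \<Rightarrow> real ^ 'd \<Rightarrow> 's set" where
  "tight l x = (if \<exists>v. lin_comb a x $ v < l $ v then {} else {v. lin_comb a x $ v = l $ v})"

definition face_type :: "real ^ 's \<Rightarrow> real ^ 'd \<Rightarrow> 'd set \<times> 's set" where
  "face_type l x = (zeros x, tight l x)"

definition type_germ :: "'d set \<times> 's set \<Rightarrow> (real ^ 'd) set" where
  "type_germ \<sigma> = {u. (\<forall>i\<in>fst \<sigma>. 0 \<le> u $ i) \<and> (snd \<sigma> = {} \<or> (\<exists>v\<in>snd \<sigma>. lin_comb a u $ v \<le> 0))}"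

definition type_le :: "'d set \<times> 's set \<Rightarrow> 'd set \<times> 's set \<Rightarrow> bool" where
  "type_le \<sigma> \<tau> \<longleftrightarrow> fst \<sigma> \<subseteq> fst \<tau> \<and> snd \<sigma> \<subseteq> snd \<tau>"

definition face_types :: "real ^ 's \<Rightarrow> ('d set \<times> 's set) set" where
  "face_types l = face_type l ` polytope_closed a l"

text \<open>Different types can have the same germ, for instance when two tight inequalities have
  proportional linear parts; faces correspond to classes of this relation, not to single
  types.\<close>

definition type_sim :: "'d set \<times> 's set \<Rightarrow> 'd set \<times> 's set \<Rightarrow> bool" where
  "type_sim \<sigma> \<tau> \<longleftrightarrow> (\<exists>e>0. \<forall>u. norm u < e \<longrightarrow> (u \<in> type_germ \<sigma> \<longleftrightarrow> u \<in> type_germ \<tau>))"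

lemma polytope_nonstrict:
  assumes x: "x \<in> polytope_closed a l" and ns: "\<not> (\<exists>v. lin_comb a x $ v < l $ v)"
  shows "tight l x = {v. lin_comb a x $ v = l $ v}" "tight l x \<noteq> {}" "\<And>v. v \<in> tight l x \<Longrightarrow> 0 < l $ v"
proof -
  show t: "tight l x = {v. lin_comb a x $ v = l $ v}" using ns by (simp add: tight_def)
  obtain v where v: "0 \<le> x" "0 < l $ v" "lin_comb a x $ v \<le> l $ v" using x by (auto simp: polytope_closed_eq)
  then have eq: "lin_comb a x $ v = l $ v" using ns by (meson order.antisym not_le)
  then show "tight l x \<noteq> {}" using t by auto
  have "x \<noteq> 0" using eq v(2) by (auto simp: lin_comb_component)
  then show "0 < l $ w" if "w \<in> tight l x" for w
    using lin_comb_pos[OF v(1) \<open>x \<noteq> 0\<close>, of w] that t by simp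
qed

lemma tight_empty_iff: "x \<in> polytope_closed a l \<Longrightarrow> tight l x = {} \<longleftrightarrow> (\<exists>v. lin_comb a x $ v < l $ v)"
  using polytope_nonstrict(2)[of x l] by (auto simp: tight_def)

text \<open>Near \<open>x\<close> only vanishing coordinates and tight inequalities can change their
  status. One strict inequality persists and suffices for membership in the union over
  \<open>v\<close>; hence the value \<open>{}\<close> of \<open>tight\<close> in that case.\<close>

lemma polytope_germ:
  assumes x: "x \<in> polytope_closed a l"
  shows "\<exists>e>0. \<forall>u. norm u < e \<longrightarrow> (x + u \<in> polytope_closed a l \<longleftrightarrow> u \<in> type_germ (face_type l x))"
proof -
  have x0: "0 \<le> x $ i" for i using x by (simp add: polytope_closed_eq less_eq_vec_def)
  have lin: "((\<lambda>u. lin_comb a (x + u) $ v) \<longlongrightarrow> lin_comb a (x + 0) $ v) (nhds 0)" for v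
    unfolding lin_comb_component by (intro tendsto_intros filterlim_ident)
  have crd: "((\<lambda>u. (x + u) $ i) \<longlongrightarrow> (x + 0) $ i) (nhds 0)" for i by (intro tendsto_intros filterlim_ident)
  have "\<forall>\<^sub>F u in nhds 0. x $ i = 0 \<or> 0 < (x + u) $ i" for i
  proof (cases "x $ i = 0")
    case False
    then have "0 < (x + 0) $ i" using x0[of i] by simp
    from order_tendstoD(1)[OF crd this] show ?thesis by eventually_elim simp
  qed simp
  then have "\<forall>\<^sub>F u in nhds 0. \<forall>i. x $ i = 0 \<or> 0 < (x + u) $ i" by (rule eventually_all_finite)
  moreover have "\<forall>\<^sub>F u in nhds 0. (lin_comb a x $ v < l $ v \<longrightarrow> lin_comb a (x + u) $ v < l $ v) \<and>
      (l $ v < lin_comb a x $ v \<longrightarrow> l $ v < lin_comb a (x + u) $ v)" for v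
  proof -
    consider "lin_comb a x $ v < l $ v" | "l $ v < lin_comb a x $ v" | "lin_comb a x $ v = l $ v" by linarith
    then show ?thesis
    proof cases
      case 1
      then show ?thesis using order_tendstoD(2)[OF lin[of v], of "l $ v"] by (auto elim!: eventually_mono)
    next
      case 2
      then show ?thesis using order_tendstoD(1)[OF lin[of v], of "l $ v"] by (auto elim!: eventually_mono)
    qed auto
  qed
  then have "\<forall>\<^sub>F u in nhds 0. \<forall>v. (lin_comb a x $ v < l $ v \<longrightarrow> lin_comb a (x + u) $ v < l $ v) \<and>
      (l $ v < lin_comb a x $ v \<longrightarrow> l $ v < lin_comb a (x + u) $ v)" by (rule eventually_all_finite)
  ultimately have "\<forall>\<^sub>F u in nhds 0. x + u \<in> polytope_closed a l \<longleftrightarrow> u \<in> type_germ (face_type l x)"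
  proof eventually_elim
    case (elim u)
    have nn: "0 \<le> x + u \<longleftrightarrow> (\<forall>i\<in>zeros x. 0 \<le> u $ i)"
    proof -
      have "0 \<le> x $ i + u $ i \<longleftrightarrow> (x $ i = 0 \<longrightarrow> 0 \<le> u $ i)" for i
        using elim(1)[rule_format, of i] by auto
      then show ?thesis by (simp add: less_eq_vec_def zeros_def)
    qed
    show ?case
    proof (cases "\<exists>v. lin_comb a x $ v < l $ v")
      case True
      then obtain v where v: "lin_comb a x $ v < l $ v" by blast
      then have "0 < l $ v" using lin_comb_nonneg[of x v] x0 by (force simp: less_eq_vec_def)
      then have "\<exists>v. 0 < l $ v \<and> lin_comb a (x + u) $ v \<le> l $ v" using elim(2) v less_imp_le by blast
      then show ?thesis using True nn by (auto simp: polytope_closed_eq type_germ_def face_type_def tight_def)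
    next
      case False
      note t = polytope_nonstrict[OF x False]
      have "(0 < l $ v \<and> lin_comb a (x + u) $ v \<le> l $ v) \<longleftrightarrow> v \<in> tight l x \<and> lin_comb a u $ v \<le> 0" for v
      proof (cases "v \<in> tight l x")
        case True
        then show ?thesis using t(1,3) by (auto simp: lin_comb_add)
      next
        case nt: False
        then have "l $ v < lin_comb a x $ v" using False t(1) by (auto simp: not_less order.order_iff_strict)
        then have "l $ v < lin_comb a (x + u) $ v" using elim(2) by blast
        then show ?thesis using nt by auto
      qed
      then show ?thesis using nn t(2) by (auto simp: polytope_closed_eq type_germ_def face_type_def)
    qed
  qed
  then show ?thesis by (simp add: eventually_nhds_metric dist_norm)
qed

lemma same_germ_iff:
  assumes x: "x \<in> polytope_closed a l" and y: "y \<in> polytope_closed a l"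
  shows "same_germ (polytope_closed a l) x y \<longleftrightarrow> type_sim (face_type l x) (face_type l y)"
proof -
  obtain e1 where e1: "0 < e1" "\<And>u. norm u < e1 \<Longrightarrow> x + u \<in> polytope_closed a l \<longleftrightarrow> u \<in> type_germ (face_type l x)"
    using polytope_germ[OF x] by blast
  obtain e2 where e2: "0 < e2" "\<And>u. norm u < e2 \<Longrightarrow> y + u \<in> polytope_closed a l \<longleftrightarrow> u \<in> type_germ (face_type l y)"
    using polytope_germ[OF y] by blast
  show ?thesis
  proof
    assume "same_germ (polytope_closed a l) x y"
    then obtain e where "0 < e" "\<And>u. norm u < e \<Longrightarrow> x + u \<in> polytope_closed a l \<longleftrightarrow> y + u \<in> polytope_closed a l"
      unfolding same_germ_def by blast
    then show "type_sim (face_type l x) (face_type l y)" unfolding type_sim_def using e1 e2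
      by (intro exI[of _ "min e (min e1 e2)"]) auto
  next
    assume "type_sim (face_type l x) (face_type l y)"
    then obtain e where "0 < e" "\<And>u. norm u < e \<Longrightarrow> u \<in> type_germ (face_type l x) \<longleftrightarrow> u \<in> type_germ (face_type l y)"
      unfolding type_sim_def by blast
    then show "same_germ (polytope_closed a l) x y" unfolding same_germ_def using e1 e2
      by (intro exI[of _ "min e (min e1 e2)"]) auto
  qed
qed

definition stratum :: "real ^ 's \<Rightarrow> 'd set \<times> 's set \<Rightarrow> (real ^ 'd) set" where
  "stratum l \<sigma> = {y \<in> polytope_closed a l. face_type l y = \<sigma>}"

lemma closure_stratum_subset: "closure (stratum l \<sigma>) \<subseteq> {y \<in> polytope_closed a l. type_le \<sigma> (face_type l y)}"
proof -
  obtain I V where \<sigma>: "\<sigma> = (I, V)" by (cases \<sigma>)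
  have clP: "closed (polytope_closed a l)" by (simp add: polytope_closed_def)
  show ?thesis
  proof (cases "V = {}")
    case True
    have "closed (polytope_closed a l \<inter> (\<Inter>i\<in>I. {y. y $ i = 0}))"
      by (intro closed_Int clP closed_INT ballI closed_Collect_eq continuous_intros)
    moreover have "stratum l \<sigma> \<subseteq> polytope_closed a l \<inter> (\<Inter>i\<in>I. {y. y $ i = 0})"
      by (auto simp: stratum_def \<sigma> face_type_def zeros_def)
    ultimately have "closure (stratum l \<sigma>) \<subseteq> polytope_closed a l \<inter> (\<Inter>i\<in>I. {y. y $ i = 0})"
      by (rule closure_minimal[rotated])
    then show ?thesis using True by (auto simp: type_le_def \<sigma> face_type_def zeros_def)
  next
    case False
    let ?C = "polytope_closed a l \<inter> (\<Inter>i\<in>I. {y. y $ i = 0}) \<inter> (\<Inter>v. {y. l $ v \<le> lin_comb a y $ v}) \<inter>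
      (\<Inter>v\<in>V. {y. lin_comb a y $ v = l $ v})"
    have "closed ?C"
      by (intro closed_Int clP closed_INT ballI closed_Collect_eq closed_Collect_le continuous_on_lin_comb continuous_intros)
    moreover have "stratum l \<sigma> \<subseteq> ?C"
      using False by (auto simp: stratum_def \<sigma> face_type_def zeros_def tight_def not_less split: if_splits)
    ultimately have "closure (stratum l \<sigma>) \<subseteq> ?C" by (rule closure_minimal[rotated])
    moreover have "?C \<subseteq> {y \<in> polytope_closed a l. type_le \<sigma> (face_type l y)}"
      by (auto simp: type_le_def \<sigma> face_type_def zeros_def tight_def not_less[symmetric])
    ultimately show ?thesis by (rule subset_trans)
  qed
qed

text \<open>Move from \<open>y\<close> slightly towards \<open>x\<close>: coordinates then vanish
  only where they do at both points, and without strict inequalities the same holds for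
  tightness.\<close>

lemma closure_stratum_supset:
  assumes x: "x \<in> stratum l \<sigma>" and y: "y \<in> polytope_closed a l" "type_le \<sigma> (face_type l y)"
  shows "y \<in> closure (stratum l \<sigma>)"
proof -
  obtain I V where \<sigma>: "\<sigma> = (I, V)" by (cases \<sigma>)
  have xP: "x \<in> polytope_closed a l" and zx: "zeros x = I" and tx: "tight l x = V"
    using x by (auto simp: stratum_def \<sigma> face_type_def)
  have zy: "I \<subseteq> zeros y" and ty: "V \<subseteq> tight l y" using y(2) by (auto simp: type_le_def \<sigma> face_type_def)
  have pos: "0 \<le> x" "0 \<le> y" using xP y(1) by (auto simp: polytope_closed_eq)
  have pos': "0 \<le> x $ i" "0 \<le> y $ i" for i using pos by (auto simp: less_eq_vec_def)
  have comb: "0 \<le> (1 - t) *\<^sub>R y + s *\<^sub>R x \<and> zeros ((1 - t) *\<^sub>R y + s *\<^sub>R x) = I" if "0 < s" "t < 1" for s t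
  proof -
    have "(1 - t) * y $ i + s * x $ i = 0 \<longleftrightarrow> i \<in> I" for i
    proof -
      have "(1 - t) * y $ i + s * x $ i = 0 \<longleftrightarrow> (1 - t) * y $ i = 0 \<and> s * x $ i = 0"
        using that pos'[of i] by (intro add_nonneg_eq_0_iff) auto
      then show ?thesis using that zx zy by (auto simp: zeros_def)
    qed
    moreover have "0 \<le> (1 - t) * y $ i + s * x $ i" for i using that pos'[of i] by simp
    ultimately show ?thesis by (simp add: less_eq_vec_def zeros_def)
  qed
  have small: "\<forall>\<^sub>F t in at_right (0::real). t \<in> {0<..<1}" by (rule eventually_at_right_real) simp
  show ?thesis
  proof (cases "V = {}")
    case True
    obtain v where v: "0 < l $ v" "lin_comb a y $ v \<le> l $ v" using y(1) by (auto simp: polytope_closed_eq)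
    have "((\<lambda>t. t * lin_comb a x $ v) \<longlongrightarrow> 0 * lin_comb a x $ v) (at_right 0)" by (intro tendsto_intros)
    then have "\<forall>\<^sub>F t in at_right 0. t * lin_comb a x $ v < l $ v" using v(1) by (intro order_tendstoD(2)) auto
    \<comment> \<open>The polytope is in general not convex, and \<open>x\<close> may satisfy only
      the inequality of another coordinate. Shrinking \<open>y\<close> by \<open>1 - t\<close>
      leaves room \<open>t * l $ v\<close> in the inequality for \<open>v\<close>, and
      \<open>t * t\<close> times \<open>x\<close>, being of second order, fits into it.\<close>
    with small have "\<forall>\<^sub>F t in at_right 0. (1 - t) *\<^sub>R y + (t * t) *\<^sub>R x \<in> closure (stratum l \<sigma>)"
    proof eventually_elim
      case (elim t)
      let ?z = "(1 - t) *\<^sub>R y + (t * t) *\<^sub>R x"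
      have "lin_comb a ?z $ v = (1 - t) * lin_comb a y $ v + t * (t * lin_comb a x $ v)"
        by (simp add: lin_comb_add lin_comb_scale)
      also have "\<dots> < (1 - t) * l $ v + t * l $ v"
        using elim v by (intro add_le_less_mono mult_left_mono mult_strict_left_mono) auto
      finally have *: "lin_comb a ?z $ v < l $ v" by (simp add: algebra_simps)
      have "0 \<le> ?z" "zeros ?z = I" using comb[of "t * t" t] elim by auto
      then have "?z \<in> stratum l \<sigma>"
        using * v(1) True by (auto simp: stratum_def \<sigma> face_type_def tight_def polytope_closed_eq intro: less_imp_le)
      then show ?case using closure_subset by blast
    qed
    moreover have "((\<lambda>t. (1 - t) *\<^sub>R y + (t * t) *\<^sub>R x) \<longlongrightarrow> (1 - 0) *\<^sub>R y + (0 * 0) *\<^sub>R x) (at_right 0)"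
      by (intro tendsto_intros)
    ultimately show ?thesis
      using Lim_in_closed_set[of "closure (stratum l \<sigma>)" "\<lambda>t. (1 - t) *\<^sub>R y + (t * t) *\<^sub>R x" "at_right 0"] by simp
  next
    case False
    have "tight l x \<noteq> {}" "tight l y \<noteq> {}" using False tx ty by auto
    then have nsx: "\<not> (\<exists>v. lin_comb a x $ v < l $ v)" and nsy: "\<not> (\<exists>v. lin_comb a y $ v < l $ v)"
      using tight_empty_iff xP y(1) by blast+
    from small have "\<forall>\<^sub>F t in at_right 0. (1 - t) *\<^sub>R y + t *\<^sub>R x \<in> closure (stratum l \<sigma>)"
    proof eventually_elim
      case (elim t)
      let ?z = "(1 - t) *\<^sub>R y + t *\<^sub>R x"
      have lz: "lin_comb a ?z $ v - l $ v = (1 - t) * (lin_comb a y $ v - l $ v) + t * (lin_comb a x $ v - l $ v)" for v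
        by (simp only: lin_comb_add lin_comb_scale vector_add_component vector_scaleR_component)
           (simp add: algebra_simps)
      have nn: "0 \<le> lin_comb a y $ v - l $ v" "0 \<le> lin_comb a x $ v - l $ v" for v
        using nsx nsy by (auto simp: not_less)
      have nsz: "\<not> (\<exists>v. lin_comb a ?z $ v < l $ v)"
      proof -
        have "0 \<le> lin_comb a ?z $ v - l $ v" for v unfolding lz using elim nn by simp
        then show ?thesis by (auto simp: not_less)
      qed
      have eqV: "lin_comb a ?z $ v = l $ v \<longleftrightarrow> v \<in> V" for v
      proof -
        have "lin_comb a ?z $ v - l $ v = 0 \<longleftrightarrow> (1 - t) * (lin_comb a y $ v - l $ v) = 0 \<and> t * (lin_comb a x $ v - l $ v) = 0"
          unfolding lz using elim nn by (intro add_nonneg_eq_0_iff) auto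
        then have "lin_comb a ?z $ v = l $ v \<longleftrightarrow> lin_comb a y $ v = l $ v \<and> lin_comb a x $ v = l $ v"
          using elim by auto
        then show ?thesis using polytope_nonstrict(1)[OF xP nsx] polytope_nonstrict(1)[OF y(1) nsy] tx ty by auto
      qed
      then have tz: "tight l ?z = V" using nsz unfolding tight_def by auto
      have tz': "lin_comb a ?z $ v \<le> l $ v" if "v \<in> V" for v using eqV[of v] that by simp
      obtain v where v: "v \<in> V" using False by blast
      then have "0 < l $ v" using polytope_nonstrict(3)[OF xP nsx] tx by blast
      moreover have "0 \<le> ?z" "zeros ?z = I" using comb[of t t] elim by auto
      ultimately have "?z \<in> stratum l \<sigma>"
        using tz tz'[OF v] by (auto simp: stratum_def \<sigma> face_type_def polytope_closed_eq)
      then show ?case using closure_subset by blast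
    qed
    moreover have "((\<lambda>t. (1 - t) *\<^sub>R y + t *\<^sub>R x) \<longlongrightarrow> (1 - 0) *\<^sub>R y + 0 *\<^sub>R x) (at_right 0)"
      by (intro tendsto_intros)
    ultimately show ?thesis
      using Lim_in_closed_set[of "closure (stratum l \<sigma>)" "\<lambda>t. (1 - t) *\<^sub>R y + t *\<^sub>R x" "at_right 0"] by simp
  qed
qed

definition type_up :: "('d set \<times> 's set) set \<Rightarrow> 'd set \<times> 's set \<Rightarrow> ('d set \<times> 's set) set" where
  "type_up T \<tau> = {\<rho> \<in> T. \<exists>\<sigma>\<in>T. type_sim \<tau> \<sigma> \<and> type_le \<sigma> \<rho>}"

definition type_region :: "real ^ 's \<Rightarrow> ('d set \<times> 's set) set \<Rightarrow> (real ^ 'd) set" where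
  "type_region l S = {y \<in> polytope_closed a l. face_type l y \<in> S}"

text \<open>A face is the closure of a finite union of strata, and closures of strata are governed
  by \<open>type_le\<close>. So the inclusions among faces depend on \<open>l\<close> only through
  \<open>face_types l\<close>.\<close>

lemma poly_faces_polytope:
  "poly_faces (polytope_closed a l) = type_region l ` type_up (face_types l) ` face_types l"
proof -
  have "closure {y \<in> polytope_closed a l. same_germ (polytope_closed a l) x y} =
      type_region l (type_up (face_types l) (face_type l x))" if x: "x \<in> polytope_closed a l" for x
  proof -
    let ?S = "{\<sigma> \<in> face_types l. type_sim (face_type l x) \<sigma>}"
    have "{y \<in> polytope_closed a l. same_germ (polytope_closed a l) x y} = (\<Union>\<sigma>\<in>?S. stratum l \<sigma>)"
      using same_germ_iff[OF x] by (auto simp: stratum_def face_types_def)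
    then have "closure {y \<in> polytope_closed a l. same_germ (polytope_closed a l) x y} = (\<Union>\<sigma>\<in>?S. closure (stratum l \<sigma>))"
      by (simp add: closure_finite_UN)
    also have "\<dots> = (\<Union>\<sigma>\<in>?S. {y \<in> polytope_closed a l. type_le \<sigma> (face_type l y)})"
    proof (rule SUP_cong[OF refl])
      fix \<sigma> assume "\<sigma> \<in> ?S"
      then obtain z where "z \<in> stratum l \<sigma>" by (auto simp: face_types_def stratum_def)
      then show "closure (stratum l \<sigma>) = {y \<in> polytope_closed a l. type_le \<sigma> (face_type l y)}"
        using closure_stratum_subset closure_stratum_supset by blast
    qed
    also have "\<dots> = type_region l (type_up (face_types l) (face_type l x))"
      by (auto simp: type_region_def type_up_def face_types_def)
    finally show ?thesis .
  qed
  then show ?thesis unfolding poly_faces_def face_types_def image_image by (auto intro!: image_cong)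
qed

lemma type_region_subset_iff:
  assumes "S \<subseteq> face_types l"
  shows "type_region l S \<subseteq> type_region l S' \<longleftrightarrow> S \<subseteq> S'"
proof
  assume *: "type_region l S \<subseteq> type_region l S'"
  show "S \<subseteq> S'"
  proof
    fix \<sigma> assume "\<sigma> \<in> S"
    moreover from this obtain x where "x \<in> polytope_closed a l" "\<sigma> = face_type l x"
      using assms by (auto simp: face_types_def)
    ultimately show "\<sigma> \<in> S'" using * by (auto simp: type_region_def)
  qed
qed (auto simp: type_region_def)

lemma same_combinatorial_type_if_face_types:
  assumes eq: "face_types l1 = face_types l2"
  shows "same_combinatorial_type (polytope_closed a l1) (polytope_closed a l2)"
proof -
  let ?\<U> = "type_up (face_types l1) ` face_types l1"
  have sub: "S \<subseteq> face_types l1" "S \<subseteq> face_types l2" if "S \<in> ?\<U>" for S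
    using that eq by (auto simp: type_up_def)
  have P1: "poly_faces (polytope_closed a l1) = type_region l1 ` ?\<U>" by (rule poly_faces_polytope)
  have P2: "poly_faces (polytope_closed a l2) = type_region l2 ` ?\<U>" using poly_faces_polytope[of l2] eq by simp
  have inj: "inj_on (type_region l1) ?\<U>" "inj_on (type_region l2) ?\<U>"
    using type_region_subset_iff[OF sub(1)] type_region_subset_iff[OF sub(2)]
    unfolding inj_on_def by (metis (no_types, lifting) order_refl subset_antisym)+
  define \<phi> where "\<phi> = type_region l2 \<circ> the_inv_into ?\<U> (type_region l1)"
  have \<phi>: "\<phi> (type_region l1 S) = type_region l2 S" if "S \<in> ?\<U>" for S
    using the_inv_into_f_f[OF inj(1) that] by (simp add: \<phi>_def)
  have "bij_betw \<phi> (type_region l1 ` ?\<U>) (type_region l2 ` ?\<U>)"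
    unfolding \<phi>_def
    by (rule bij_betw_trans[OF bij_betw_the_inv_into[OF inj_on_imp_bij_betw[OF inj(1)]] inj_on_imp_bij_betw[OF inj(2)]])
  moreover have "F \<subseteq> G \<longleftrightarrow> \<phi> F \<subseteq> \<phi> G" if F: "F \<in> type_region l1 ` ?\<U>" and G: "G \<in> type_region l1 ` ?\<U>" for F G
  proof -
    obtain S S' where S: "S \<in> ?\<U>" "F = type_region l1 S" "S' \<in> ?\<U>" "G = type_region l1 S'"
      using imageE[OF F] imageE[OF G] by metis
    show ?thesis unfolding S(2,4) \<phi>[OF S(1)] \<phi>[OF S(3)]
      using type_region_subset_iff[OF sub(1)[OF S(1)]] type_region_subset_iff[OF sub(2)[OF S(1)]] by simp
  qed
  ultimately show ?thesis unfolding same_combinatorial_type_def P1 P2 by blast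
qed

text \<open>Near the origin every zero set occurs together with a strict inequality. A type without
  strict inequalities amounts to a nonnegative point of the fibre over \<open>l\<close> with
  prescribed support, that is, to a relatively open cone containing \<open>l\<close>.\<close>

lemma face_types_eq:
  assumes "0 < l $ v0"
  shows "face_types l = {(I, {}) | I. True} \<union> {(I, V). V \<noteq> {} \<and> l \<in> ocone_of (- (Inl ` I \<union> Inr ` V))}"
proof (intro equalityI subsetI)
  fix \<sigma> assume "\<sigma> \<in> face_types l"
  then obtain x where x: "x \<in> polytope_closed a l" "\<sigma> = (zeros x, tight l x)"
    by (auto simp: face_types_def face_type_def)
  show "\<sigma> \<in> {(I, {}) | I. True} \<union> {(I, V). V \<noteq> {} \<and> l \<in> ocone_of (- (Inl ` I \<union> Inr ` V))}"
  proof (cases "tight l x = {}")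
    case False
    then have ns: "\<not> (\<exists>v. lin_comb a x $ v < l $ v)" unfolding tight_def by metis
    have x0: "0 \<le> x $ i" for i using x by (simp add: polytope_closed_eq less_eq_vec_def)
    have "l = comb (slack x l)" by simp
    moreover have "slack x l j = 0" if "j \<notin> - (Inl ` zeros x \<union> Inr ` tight l x)" for j
      using that polytope_nonstrict(1)[OF x(1) ns] by (auto simp: zeros_def)
    moreover have "0 < slack x l j" if "j \<in> - (Inl ` zeros x \<union> Inr ` tight l x)" for j
    proof (cases j)
      case (Inl i)
      then show ?thesis using that x0[of i] by (auto simp: zeros_def order.order_iff_strict)
    next
      case (Inr v)
      then show ?thesis using that polytope_nonstrict(1)[OF x(1) ns] ns by (auto simp: not_less order.order_iff_strict)
    qed
    ultimately have "l \<in> ocone_of (- (Inl ` zeros x \<union> Inr ` tight l x))"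
      unfolding ocone_of_def by (intro CollectI exI[of _ "slack x l"]) auto
    then show ?thesis using False x by auto
  qed (use x in auto)
next
  fix \<sigma> assume "\<sigma> \<in> {(I, {}) | I. True} \<union> {(I, V). V \<noteq> {} \<and> l \<in> ocone_of (- (Inl ` I \<union> Inr ` V))}"
  then consider I where "\<sigma> = (I, {})" | I V where "\<sigma> = (I, V)" "V \<noteq> {}" "l \<in> ocone_of (- (Inl ` I \<union> Inr ` V))"
    by auto
  then show "\<sigma> \<in> face_types l"
  proof cases
    case 1
    define S where "S = (\<Sum>i\<in>UNIV. a i $ v0)"
    have S: "0 < S" unfolding S_def by (intro sum_pos) (auto simp: a_pos)
    \<comment> \<open>Small enough that \<open>lin_comb\<close> stays at or below half of
      \<open>l $ v0\<close> in the coordinate \<open>v0\<close>.\<close>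
    define e where "e = l $ v0 / (2 * S)"
    have e: "0 < e" using S assms by (simp add: e_def)
    define x :: "real^'d" where "x = (\<chi> i. if i \<in> I then 0 else e)"
    have "lin_comb a x $ v0 \<le> (\<Sum>i\<in>UNIV. e * a i $ v0)"
      unfolding lin_comb_component using e a_pos
      by (intro sum_mono) (auto simp: x_def less_imp_le)
    also have "\<dots> = e * S" unfolding S_def sum_distrib_left ..
    also have "\<dots> = l $ v0 / 2" using S by (simp add: e_def)
    finally have lt: "lin_comb a x $ v0 < l $ v0" using assms by simp
    have "0 \<le> x" using e by (simp add: x_def less_eq_vec_def)
    then have "x \<in> polytope_closed a l" using lt assms by (auto simp: polytope_closed_eq intro: less_imp_le)
    moreover have "face_type l x = (I, {})" using lt e by (auto simp: face_type_def tight_def zeros_def x_def)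
    ultimately show ?thesis using 1 by (force simp: face_types_def)
  next
    case 2
    then obtain z where z: "l = comb z" "\<And>j. j \<in> - (Inl ` I \<union> Inr ` V) \<Longrightarrow> 0 < z j"
        "\<And>j. j \<notin> - (Inl ` I \<union> Inr ` V) \<Longrightarrow> z j = 0"
      unfolding ocone_of_def by blast
    define x where "x = xpart z"
    have s: "slack x l = z" unfolding x_def z(1) by (rule slack_xpart)
    have x: "x $ i = z (Inl i)" for i using fun_cong[OF s, of "Inl i"] by simp
    have y: "lin_comb a x $ v - l $ v = z (Inr v)" for v using fun_cong[OF s, of "Inr v"] by simp
    have nn: "0 \<le> z j" for j using z(2,3) by (cases "j \<in> - (Inl ` I \<union> Inr ` V)") (auto simp: less_imp_le)
    have mem: "Inl i \<in> - (Inl ` I \<union> Inr ` V) \<longleftrightarrow> i \<notin> I" "Inr v \<in> - (Inl ` I \<union> Inr ` V) \<longleftrightarrow> v \<notin> V" for i v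
      by auto
    have zI: "z (Inl i) = 0 \<longleftrightarrow> i \<in> I" for i using z(2,3)[of "Inl i", unfolded mem] by force
    have zV: "z (Inr v) = 0 \<longleftrightarrow> v \<in> V" for v using z(2,3)[of "Inr v", unfolded mem] by force
    have x0: "0 \<le> x" using nn by (simp add: less_eq_vec_def x)
    have ns: "\<not> (\<exists>v. lin_comb a x $ v < l $ v)" using nn[of "Inr _"] y by (metis diff_ge_0_iff_ge not_le)
    have t: "tight l x = V" using ns y zV unfolding tight_def by (auto simp: eq_iff_diff_eq_0[of "lin_comb a x $ _"])
    have "x \<noteq> 0"
    proof
      assume "x = 0"
      then have "lin_comb a x $ v0 = 0" by (simp add: lin_comb_component)
      then show False using ns assms by metis
    qed
    obtain v where v: "v \<in> V" using 2 by blast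
    then have "lin_comb a x $ v = l $ v" using y[of v] zV[of v] by simp
    then have "x \<in> polytope_closed a l"
      using x0 lin_comb_pos[OF x0 \<open>x \<noteq> 0\<close>, of v] by (auto simp: polytope_closed_eq intro!: exI[of _ v])
    moreover have "face_type l x = \<sigma>" using 2 t zI by (auto simp: face_type_def zeros_def x)
    ultimately show ?thesis by (auto simp: face_types_def)
  qed
qed

text \<open>These are the \<open>l\<close> with empty polytope, which \<open>face_types_eq\<close>
  does not cover; relatively open cones detect them too.\<close>

lemma nonpositive_iff_ocone: "(\<exists>Y\<subseteq>range Inr. l \<in> ocone_of Y) \<longleftrightarrow> (\<forall>v. l $ v \<le> 0)"
proof
  assume "\<exists>Y\<subseteq>range Inr. l \<in> ocone_of Y"
  then obtain Y z where z: "Y \<subseteq> range Inr" "l = comb z" "\<forall>j\<in>Y. 0 < z j" "\<forall>j. j \<notin> Y \<longrightarrow> z j = 0"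
    unfolding ocone_of_def by auto
  have "z (Inl i) = 0" for i using z(1,4) by (metis Inl_Inr_False imageE subsetD)
  then have "xpart z = 0" by (simp add: xpart_def vec_eq_iff)
  moreover have "0 \<le> z j" for j using z(3,4) by (cases "j \<in> Y") (auto simp: less_imp_le)
  ultimately show "\<forall>v. l $ v \<le> 0" using z(2) by (auto simp: comb_component lin_comb_component)
next
  assume l: "\<forall>v. l $ v \<le> 0"
  let ?Y = "{Inr v | v. l $ v < 0}"
  have "l \<in> ocone_of ?Y" unfolding ocone_of_def
  proof (intro CollectI exI[of _ "slack 0 l"] conjI ballI allI impI)
    show "slack 0 l j = 0" if "j \<notin> ?Y" for j
      using that l by (cases j) (auto simp: lin_comb_component not_less order.antisym)
  qed (auto simp: lin_comb_component)
  moreover have "?Y \<subseteq> range Inr" by auto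
  ultimately show "\<exists>Y\<subseteq>range Inr. l \<in> ocone_of Y" by (intro exI[of _ ?Y] conjI)
qed

lemma same_combinatorial_type_if_ocones:
  assumes "\<And>Y. l1 \<in> ocone_of Y \<longleftrightarrow> l2 \<in> ocone_of Y"
  shows "same_combinatorial_type (polytope_closed a l1) (polytope_closed a l2)"
proof (rule same_combinatorial_type_if_face_types)
  have iff: "(\<forall>v. l1 $ v \<le> 0) \<longleftrightarrow> (\<forall>v. l2 $ v \<le> 0)"
    unfolding nonpositive_iff_ocone[symmetric] using assms by simp
  show "face_types l1 = face_types l2"
  proof (cases "\<forall>v. l1 $ v \<le> 0")
    case True
    then have "polytope_closed a l1 = {}" "polytope_closed a l2 = {}"
      using iff by (auto simp: polytope_closed_eq not_less[symmetric])
    then show ?thesis by (simp add: face_types_def)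
  next
    case False
    then obtain v1 v2 where "0 < l1 $ v1" "0 < l2 $ v2" using iff by (meson not_le)
    then show ?thesis using face_types_eq assms by simp
  qed
qed

end

section \<open>Chamber quasipolynomials\<close>

lemma real_polynomial_function_eq_on_tail:
  fixes f g :: "real \<Rightarrow> real"
  assumes f: "real_polynomial_function f" and g: "real_polynomial_function g"
    and eq: "\<And>n::nat. T \<le> real n \<Longrightarrow> f (real n) = g (real n)"
  shows "f = g"
proof -
  have "real_polynomial_function (\<lambda>x. f x - g x)" using f g by (rule real_polynomial_function_diff)
  from real_polynomial_function_imp_sum[OF this]
  obtain c n where cn: "(\<lambda>x. f x - g x) = (\<lambda>x. \<Sum>i\<le>n. c i * x ^ i)" by blast
  then have c: "f x - g x = (\<Sum>i\<le>n. c i * x ^ i)" for x by (rule fun_cong)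
  define p where "p = (\<Sum>i\<le>n. monom (c i) i)"
  have p: "poly p x = f x - g x" for x by (simp add: p_def c poly_sum poly_monom)
  have "p = 0"
  proof (rule ccontr)
    assume "p \<noteq> 0"
    then have "finite {x. poly p x = 0}" by (rule poly_roots_finite)
    moreover have "real ` {nat \<lceil>T\<rceil>..} \<subseteq> {x. poly p x = 0}"
      using eq by (auto simp: p)
    ultimately have "finite (real ` {nat \<lceil>T\<rceil>..})" by (rule finite_subset[rotated])
    then show False by (subst (asm) finite_image_iff) (auto simp: infinite_Ici)
  qed
  then show ?thesis using p by (auto simp: fun_eq_iff)
qed

text \<open>Steps along \<open>p\<close> by a suitable common multiple stay in one coset for each
  quasipolynomial, so both become polynomials in the number of steps. They agree far out and hence
  at 0.\<close>

lemma quasipoly_unique_along_ray: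
  fixes M :: "(real ^ 'n) set"
  assumes M: "add_subgroup M" and q: "quasipolynomial_on M q1" "quasipolynomial_on M q2"
    and p: "p \<in> M" and y: "y \<in> M"
    and eq: "\<And>n::nat. T \<le> real n \<Longrightarrow> q1 (y + real n *\<^sub>R p) = q2 (y + real n *\<^sub>R p)"
  shows "q1 y = q2 y"
proof -
  have *: "\<exists>k::nat. 0 < k \<and> (\<forall>m. 0 < m \<and> k dvd m \<longrightarrow>
      (\<exists>f. real_polynomial_function f \<and> (\<forall>t::nat. q (y + real (t * m) *\<^sub>R p) = f (real t))))"
    if q: "quasipolynomial_on M q" for q
  proof -
    obtain N where N: "finite_index_subgroup N M"
        "\<forall>K\<in>cosets M N. \<exists>p. real_polynomial_function p \<and> (\<forall>x\<in>K. q x = p x)"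
      using q unfolding quasipolynomial_on_def by blast
    have sN: "add_subgroup N" using N(1) by (simp add: finite_index_subgroup_def)
    obtain k :: nat where k: "0 < k" "real k *\<^sub>R p \<in> N" using finite_index_multiple[OF N(1) M p] by blast
    have "(+) y ` N \<in> cosets M N" using y by (simp add: cosets_def)
    from bspec[OF N(2) this] obtain P where "real_polynomial_function P \<and> (\<forall>x\<in>(+) y ` N. q x = P x)" ..
    then have P: "real_polynomial_function P" "\<And>n. n \<in> N \<Longrightarrow> q (y + n) = P (y + n)" by simp_all
    have "\<exists>f. real_polynomial_function f \<and> (\<forall>t::nat. q (y + real (t * m) *\<^sub>R p) = f (real t))"
      if m: "0 < m" "k dvd m" for m
    proof -
      have "polynomial_function (\<lambda>t. y + (t * real m) *\<^sub>R p)"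
      proof (rule polynomial_function_add[of "\<lambda>_. y" "\<lambda>t. (t * real m) *\<^sub>R p"])
        show "polynomial_function (\<lambda>t. (t * real m) *\<^sub>R p)"
          by (rule polynomial_function_bounded_linear)
             (rule bounded_linear_compose[OF bounded_linear_scaleR_left[of p] bounded_linear_mult_left[of "real m"]])
      qed simp
      then have "real_polynomial_function (P \<circ> (\<lambda>t. y + (t * real m) *\<^sub>R p))"
        using P(1) by (rule real_polynomial_function_compose)
      moreover have "q (y + real (t * m) *\<^sub>R p) = (P \<circ> (\<lambda>t. y + (t * real m) *\<^sub>R p)) (real t)" for t
      proof -
        obtain j where "m = k * j" using m(2) by blast
        then have "real (t * m) *\<^sub>R p = real (t * j) *\<^sub>R real k *\<^sub>R p" by (simp add: mult_ac)
        also have "\<dots> \<in> N" by (rule add_subgroup_scale[OF sN k(2)])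
        finally have "real (t * m) *\<^sub>R p \<in> N" .
        then show ?thesis using P(2) by simp
      qed
      ultimately show ?thesis by blast
    qed
    then show ?thesis using k(1) by blast
  qed
  obtain k1 :: nat where k1: "0 < k1" "\<And>m. 0 < m \<Longrightarrow> k1 dvd m \<Longrightarrow>
      \<exists>f. real_polynomial_function f \<and> (\<forall>t::nat. q1 (y + real (t * m) *\<^sub>R p) = f (real t))" using *[OF q(1)] by blast
  obtain k2 :: nat where k2: "0 < k2" "\<And>m. 0 < m \<Longrightarrow> k2 dvd m \<Longrightarrow>
      \<exists>f. real_polynomial_function f \<and> (\<forall>t::nat. q2 (y + real (t * m) *\<^sub>R p) = f (real t))" using *[OF q(2)] by blast
  let ?m = "k1 * k2"
  have m: "0 < ?m" using k1(1) k2(1) by simp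
  obtain f1 where f1: "real_polynomial_function f1" "\<And>t::nat. q1 (y + real (t * ?m) *\<^sub>R p) = f1 (real t)"
    using k1(2)[OF m] by auto
  obtain f2 where f2: "real_polynomial_function f2" "\<And>t::nat. q2 (y + real (t * ?m) *\<^sub>R p) = f2 (real t)"
    using k2(2)[OF m] by auto
  have "f1 = f2"
  proof (rule real_polynomial_function_eq_on_tail[OF f1(1) f2(1)])
    fix n :: nat assume n: "T \<le> real n"
    have "real n \<le> real (n * ?m)" using m by (simp del: of_nat_mult)
    then have "T \<le> real (n * ?m)" using n by linarith
    then show "f1 (real n) = f2 (real n)" using eq f1(2) f2(2) by metis
  qed
  then show ?thesis using f1(2)[of 0] f2(2)[of 0] by simp
qed

text \<open>Finite index survives the intersection with \<open>S\<close>, since the cosets of the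
  intersection are cosets of \<open>scaled_int_vecs n\<close> cut with \<open>S\<close>.\<close>

lemma quasipolynomial_on_cosets:
  fixes f :: "real ^ 's \<Rightarrow> real"
  assumes L: "overlattice L'" and f: "poly_on_cosets n f" and S: "subspace S"
  shows "quasipolynomial_on (L' \<inter> S) f"
proof -
  let ?N = "scaled_int_vecs n \<inter> S"
  have n: "0 < n" using f by (simp add: poly_on_cosets_def)
  have sS: "add_subgroup S" using S by (auto simp: add_subgroup_def subspace_0 subspace_diff)
  have sN: "add_subgroup ?N"
    using add_subgroup_scaled[of n] sS unfolding add_subgroup_def by auto
  have fin: "finite_index_subgroup (scaled_int_vecs n) L'" by (rule finite_index_scaled[OF L n])
  have "cosets (L' \<inter> S) ?N \<subseteq> (\<lambda>K. K \<inter> S) ` cosets L' (scaled_int_vecs n)"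
    unfolding cosets_def
  proof clarify
    fix m assume m: "m \<in> L'" "m \<in> S"
    have "(+) m ` ?N = ((+) m ` scaled_int_vecs n) \<inter> S"
    proof (intro equalityI subsetI)
      fix x assume "x \<in> ((+) m ` scaled_int_vecs n) \<inter> S"
      then obtain y where "x = m + y" "y \<in> scaled_int_vecs n" "m + y \<in> S" by auto
      then show "x \<in> (+) m ` ?N" using subspace_diff[OF S, of "m + y" m] m(2) by auto
    qed (use m(2) subspace_add[OF S] in auto)
    then show "(+) m ` ?N \<in> (\<lambda>K. K \<inter> S) ` (\<lambda>m. (+) m ` scaled_int_vecs n) ` L'" using m(1) by blast
  qed
  then have "finite (cosets (L' \<inter> S) ?N)"
    using fin finite_subset unfolding finite_index_subgroup_def by blast
  then have "finite_index_subgroup ?N (L' \<inter> S)"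
    using sN fin unfolding finite_index_subgroup_def by blast
  moreover have "\<exists>p. real_polynomial_function p \<and> (\<forall>x\<in>K. f x = p x)" if K: "K \<in> cosets (L' \<inter> S) ?N" for K
  proof -
    obtain m where m: "K = (+) m ` ?N" using K by (auto simp: cosets_def)
    obtain p where "real_polynomial_function p" "\<forall>\<nu>\<in>scaled_int_vecs n. f (m + \<nu>) = p (m + \<nu>)"
      using f unfolding poly_on_cosets_def by blast
    then show ?thesis using m by blast
  qed
  ultimately show ?thesis unfolding quasipolynomial_on_def by blast
qed

lemma quasipolynomial_on_cong:
  assumes "quasipolynomial_on M f" "\<And>x. x \<in> M \<Longrightarrow> f x = g x" "add_subgroup M"
  shows "quasipolynomial_on M g"
proof -
  obtain N where N: "finite_index_subgroup N M"
      "\<forall>K\<in>cosets M N. \<exists>p. real_polynomial_function p \<and> (\<forall>x\<in>K. f x = p x)"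
    using assms(1) unfolding quasipolynomial_on_def by blast
  have "x \<in> M" if "K \<in> cosets M N" "x \<in> K" for K x
    using that N(1) add_subgroup_add[OF assms(3)] by (auto simp: cosets_def finite_index_subgroup_def)
  then have "\<forall>K\<in>cosets M N. \<exists>p. real_polynomial_function p \<and> (\<forall>x\<in>K. g x = p x)"
    using N(2) assms(2) by metis
  then show ?thesis using N(1) unfolding quasipolynomial_on_def by blast
qed

context lattice_cone begin

lemma basis_cones_eq: "basis_cones a = cone_of ` {B. ibasis B}"
proof -
  have X: "chamber_vectors a = range gen"
    unfolding chamber_vectors_def UNIV_sum image_Un image_image by simp
  show ?thesis
  proof (intro equalityI subsetI)
    fix K assume "K \<in> basis_cones a"
    then obtain S where S: "K = convex_cone hull S" "S \<subseteq> gen ` UNIV" "independent S" "span S = UNIV"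
      unfolding basis_cones_def X by auto
    then obtain B where "ibasis B" "gen ` B = S" using ibasis_of_basis by blast
    then show "K \<in> cone_of ` {B. ibasis B}" using S(1) cone_of_eq_hull by blast
  next
    fix K assume "K \<in> cone_of ` {B. ibasis B}"
    then obtain B where B: "ibasis B" "K = cone_of B" by blast
    then show "K \<in> basis_cones a"
      unfolding basis_cones_def X using ibasis_iff[of B] cone_of_eq_hull[of B]
      by (intro CollectI exI[of _ "gen ` B"]) auto
  qed
qed

lemma chambers_eq: "chambers a = closure ` cells"
  unfolding chambers_def cells_def walls_def basis_cones_eq by (simp add: image_image)

end

context polarized_cone begin

lemma count_T_card: "count_T a h l = real (card (truncated_orthant False h l))"
proof -
  have "{x \<in> int_vecs \<inter> polytope_open a l. cls (lin_comb a x) = h} = truncated_orthant False h l"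
    by (auto simp: polytope_open_def truncated_orthant_def lattice_class_def nonpos_def less_eq_vec_def not_le not_less)
  then show ?thesis by (simp add: count_T_def)
qed

lemma count_FT_card: "count_FT a h l = real (card (truncated_orthant True h l))"
proof -
  have "x \<in> polytope_closed a l - (\<Union>i. coord_facet a l i) \<longleftrightarrow> (\<forall>i. 0 < x $ i) \<and> (\<exists>v. lin_comb a x $ v \<le> l $ v)" for x
  proof
    assume x: "x \<in> polytope_closed a l - (\<Union>i. coord_facet a l i)"
    then have "x $ i \<noteq> 0" "0 \<le> x $ i" for i
      by (auto simp: coord_facet_def polytope_closed_eq less_eq_vec_def)
    then have "0 < x $ i" for i by (simp add: order.not_eq_order_implies_strict)
    then show "(\<forall>i. 0 < x $ i) \<and> (\<exists>v. lin_comb a x $ v \<le> l $ v)" using x by (auto simp: polytope_closed_eq)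
  next
    assume x: "(\<forall>i. 0 < x $ i) \<and> (\<exists>v. lin_comb a x $ v \<le> l $ v)"
    then obtain v where v: "lin_comb a x $ v \<le> l $ v" by blast
    have "0 \<le> x" "x \<noteq> 0" using x by (auto simp: less_eq_vec_def vec_eq_iff less_imp_le intro: exI[of _ undefined]) (metis less_irrefl)
    \<comment> \<open>On the open orthant \<open>lin_comb\<close> is positive, so the positivity
      demanded in \<open>polytope_closed_eq\<close> follows from the weak inequality.\<close>
    then have "0 < l $ v" using lin_comb_pos[of x v] v by simp
    then show "x \<in> polytope_closed a l - (\<Union>i. coord_facet a l i)"
      using x v \<open>0 \<le> x\<close> by (auto simp: coord_facet_def polytope_closed_eq) (metis less_irrefl)
  qed
  then have "{x \<in> int_vecs \<inter> (polytope_closed a l - (\<Union>i. coord_facet a l i)). cls (lin_comb a x) = h} = truncated_orthant True h l"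
    unfolding truncated_orthant_def lattice_class_def nonpos_def by (auto simp: not_le)
  then show ?thesis by (simp add: count_FT_def)
qed

definition count :: "bool \<Rightarrow> (real ^ 's) set \<Rightarrow> real ^ 's \<Rightarrow> real" where
  "count b = (if b then count_FT a else count_T a)"

lemma count_cell:
  assumes "U \<in> cells" "l \<in> closure U"
  shows "count b h l = cell_count b U h l R"
  using cell_count_eq_card[OF assms] by (cases b) (simp_all add: count_def count_T_card count_FT_card)

section \<open>Integral points in relatively open cones\<close>

definition cells_meet :: "(real ^ 's) set set \<Rightarrow> (real ^ 's) set" where
  "cells_meet F = \<Inter> (closure ` F)"

lemma cells_meet_iff:
  assumes "F \<subseteq> cells"
  shows "l \<in> cells_meet F \<longleftrightarrow> (\<forall>U\<in>F. \<forall>B\<in>cell_bases U. \<forall>j. 0 \<le> coord B l j)"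
proof -
  have "l \<in> closure U \<longleftrightarrow> (\<forall>B\<in>cell_bases U. \<forall>j. 0 \<le> coord B l j)" if "U \<in> F" for U
  proof -
    have "B \<in> cell_bases U \<Longrightarrow> l \<in> cone_of B \<longleftrightarrow> (\<forall>j. 0 \<le> coord B l j)" for B
      using cone_of_ibasis[of B] by (auto simp: cell_bases_def)
    then show ?thesis using closure_cell[of U] assms that by auto
  qed
  then show ?thesis by (auto simp: cells_meet_def)
qed

lemma cells_meet_lin:
  assumes "F \<subseteq> cells" "x \<in> cells_meet F" "y \<in> cells_meet F" "0 \<le> s" "0 \<le> t"
  shows "s *\<^sub>R x + t *\<^sub>R y \<in> cells_meet F"
  using assms unfolding cells_meet_iff[OF assms(1)]
  by (auto simp: cell_bases_def coord_lin)

lemma zero_cells_meet: "F \<subseteq> cells \<Longrightarrow> 0 \<in> cells_meet F"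
  by (auto simp: cells_meet_iff cell_bases_def coord_zero)

lemma convex_cells_meet: "F \<subseteq> cells \<Longrightarrow> convex (cells_meet F)"
  unfolding convex_def using cells_meet_lin by blast

lemma rel_interior_cells_meet_iff:
  assumes "F \<subseteq> cells"
  shows "z \<in> rel_interior (cells_meet F) \<longleftrightarrow> (\<forall>x\<in>cells_meet F. \<exists>e>1. (1 - e) *\<^sub>R x + e *\<^sub>R z \<in> cells_meet F)"
  using convex_rel_interior_iff[OF convex_cells_meet[OF assms]] zero_cells_meet[OF assms] by blast

lemma rel_interior_cells_meet_scale:
  assumes F: "F \<subseteq> cells" and x: "x \<in> rel_interior (cells_meet F)" and t: "0 < t"
  shows "t *\<^sub>R x \<in> rel_interior (cells_meet F)"
  unfolding rel_interior_cells_meet_iff[OF F]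
proof
  fix y assume y: "y \<in> cells_meet F"
  have "(1 / t) *\<^sub>R y \<in> cells_meet F" using cells_meet_lin[OF F y y, of "1 / t" 0] t by simp
  then obtain e where e: "1 < e" "(1 - e) *\<^sub>R (1 / t) *\<^sub>R y + e *\<^sub>R x \<in> cells_meet F"
    using x unfolding rel_interior_cells_meet_iff[OF F] by blast
  have "t *\<^sub>R ((1 - e) *\<^sub>R (1 / t) *\<^sub>R y + e *\<^sub>R x) \<in> cells_meet F"
    using cells_meet_lin[OF F e(2) e(2), of t 0] t by simp
  also have "t *\<^sub>R ((1 - e) *\<^sub>R (1 / t) *\<^sub>R y + e *\<^sub>R x) = (1 - e) *\<^sub>R y + e *\<^sub>R t *\<^sub>R x"
    using t by (simp add: scaleR_add_right mult.commute)
  finally show "\<exists>e>1. (1 - e) *\<^sub>R y + e *\<^sub>R t *\<^sub>R x \<in> cells_meet F" using e(1) by blast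
qed

lemma coord_int_vecs:
  assumes "ibasis B" "p \<in> int_vecs"
  shows "real M * coord B p j \<in> \<int>"
proof -
  have "slack 0 p j \<in> \<int>" for j
    using assms(2) by (cases j) (auto simp: int_vecs_def lin_comb_component)
  then have "coord B (real M *\<^sub>R comb (slack 0 p)) j \<in> \<int>" by (rule coord_scaled_int[OF assms(1)])
  then show ?thesis by (simp add: coord_scale[OF assms(1)])
qed

text \<open>A good simultaneous approximation of a point of the relative interior satisfies the same
  equations exactly, because their values are rational with bounded denominator.\<close>

lemma int_point_same_signs:
  "\<exists>p\<in>int_vecs. \<forall>B j. ibasis B \<longrightarrow> (coord B x j = 0 \<longrightarrow> coord B p j = 0) \<and> (0 < coord B x j \<longrightarrow> 0 < coord B p j)"
proof -
  define C where "C = (\<Sum>B\<in>UNIV. \<Sum>j\<in>UNIV. \<Sum>v\<in>UNIV. \<bar>coord B (axis v 1) j\<bar>)"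
  have C0: "0 \<le> C" unfolding C_def by (intro sum_nonneg) auto
  have C: "(\<Sum>v\<in>UNIV. \<bar>coord B (axis v 1) j\<bar>) \<le> C" for B j
  proof -
    have "(\<Sum>v\<in>UNIV. \<bar>coord B (axis v 1) j\<bar>) \<le> (\<Sum>j\<in>UNIV. \<Sum>v\<in>UNIV. \<bar>coord B (axis v 1) j\<bar>)"
      by (rule member_le_sum[of j UNIV "\<lambda>j. \<Sum>v\<in>UNIV. \<bar>coord B (axis v 1) j\<bar>"]) (auto intro: sum_nonneg)
    also have "\<dots> \<le> C" unfolding C_def
      by (rule member_le_sum[of B UNIV "\<lambda>B. \<Sum>j\<in>UNIV. \<Sum>v\<in>UNIV. \<bar>coord B (axis v 1) j\<bar>"]) (auto intro: sum_nonneg)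
    finally show ?thesis .
  qed
  \<comment> \<open>A lower bound for all positive coordinates of \<open>x\<close>: errors below it
    keep them positive.\<close>
  define \<delta> where "\<delta> = Min (insert 1 ((\<lambda>(B, j). coord B x j) ` {(B, j). 0 < coord B x j}))"
  have \<delta>0: "0 < \<delta>" unfolding \<delta>_def by (subst Min_gr_iff) auto
  have \<delta>: "\<delta> \<le> coord B x j" if "0 < coord B x j" for B j
    unfolding \<delta>_def using that by (intro Min_le) auto
  \<comment> \<open>Errors of coordinates are at most \<open>C / N\<close>; this choice makes them
    smaller than \<open>\<delta>\<close> and, after multiplication by \<open>M\<close>, smaller than
    1.\<close>
  obtain N :: nat where N: "real M * C + C / \<delta> + 1 < real N" using reals_Archimedean2 by blast
  have N0: "0 < N" "C / real N < \<delta>" "real M * (C / real N) < 1"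
  proof -
    have "0 \<le> C / \<delta>" "0 \<le> real M * C" using C0 \<delta>0 by auto
    then have *: "C / \<delta> < real N" "real M * C < real N" "0 < real N" using N by linarith+
    then show "0 < N" "C / real N < \<delta>" "real M * (C / real N) < 1"
      using \<delta>0 by (auto simp: field_simps)
  qed
  obtain q p where q: "0 < q" "\<And>v. \<bar>real q * x $ v - of_int (p v)\<bar> < 1 / real N"
    using dirichlet_approx_finite[OF N0(1), of "\<lambda>v. x $ v"] by blast
  define y :: "real^'s" where "y = (\<chi> v. of_int (p v))"
  define d where "d = y - real q *\<^sub>R x"
  have d: "\<bar>d $ v\<bar> \<le> 1 / real N" for v
    using q(2)[of v] by (simp add: d_def y_def abs_minus_commute)
  have cd: "\<bar>coord B d j\<bar> \<le> C / real N" if B: "ibasis B" for B j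
  proof -
    have "d = (\<Sum>v\<in>UNIV. d $ v *\<^sub>R axis v 1)" by (simp add: vec_eq_iff axis_def if_distrib cong: if_cong)
    then have "coord B d j = (\<Sum>v\<in>UNIV. d $ v * coord B (axis v 1) j)"
      by (metis (no_types, lifting) linear_sum[OF linear_coord[OF B]] coord_scale[OF B] sum.cong)
    then have "\<bar>coord B d j\<bar> \<le> (\<Sum>v\<in>UNIV. (1 / real N) * \<bar>coord B (axis v 1) j\<bar>)"
      by (auto intro!: order.trans[OF sum_abs] sum_mono simp only: abs_mult mult_right_mono[OF d] abs_ge_zero)
    also have "\<dots> = (1 / real N) * (\<Sum>v\<in>UNIV. \<bar>coord B (axis v 1) j\<bar>)" by (simp only: sum_distrib_left)
    also have "\<dots> \<le> (1 / real N) * C" by (intro mult_left_mono C) auto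
    finally show ?thesis by simp
  qed
  have y: "y \<in> int_vecs" by (simp add: y_def int_vecs_def)
  have split: "coord B y j = real q * coord B x j + coord B d j" if B: "ibasis B" for B j
    by (simp add: d_def coord_diff[OF B] coord_scale[OF B])
  have "(coord B x j = 0 \<longrightarrow> coord B y j = 0) \<and> (0 < coord B x j \<longrightarrow> 0 < coord B y j)" if B: "ibasis B" for B j
  proof (intro conjI impI)
    assume "coord B x j = 0"
    then have "\<bar>real M * coord B y j\<bar> \<le> real M * (C / real N)"
      using split[OF B, of j] cd[OF B, of j] by (simp add: abs_mult mult_left_mono del: times_divide_eq_right)
    then have "\<bar>real M * coord B y j\<bar> < 1" using N0(3) by linarith
    then have "real M * coord B y j = 0" using coord_int_vecs[OF B y, of j] by (metis Ints_nonzero_abs_less1)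
    then show "coord B y j = 0" using M_pos by simp
  next
    assume pos: "0 < coord B x j"
    have "1 * coord B x j \<le> real q * coord B x j" using q(1) pos by (intro mult_right_mono) auto
    then show "0 < coord B y j" using split[OF B, of j] cd[OF B, of j] \<delta>[OF pos] N0(2) by linarith
  qed
  then show ?thesis using y by blast
qed

text \<open>A point with the same vanishing and positive coordinates as \<open>x\<close> stays in
  the cone when the segment from \<open>x\<close> is prolonged slightly beyond it, hence it lies in
  the relative interior.\<close>

lemma int_point_rel_interior:
  assumes F: "F \<subseteq> cells"
  shows "\<exists>p\<in>int_vecs. p \<in> rel_interior (cells_meet F)"
proof -
  let ?K = "cells_meet F"
  have "rel_interior ?K \<noteq> {}"
    using rel_interior_eq_empty[OF convex_cells_meet[OF F]] zero_cells_meet[OF F] by blast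
  then obtain x where x: "x \<in> rel_interior ?K" by blast
  then have xK: "x \<in> ?K" using rel_interior_subset by blast
  obtain p where p: "p \<in> int_vecs" "\<And>B j. ibasis B \<Longrightarrow> coord B x j = 0 \<Longrightarrow> coord B p j = 0"
      "\<And>B j. ibasis B \<Longrightarrow> 0 < coord B x j \<Longrightarrow> 0 < coord B p j"
    using int_point_same_signs by blast
  have F_basis: "ibasis B" if "U \<in> F" "B \<in> cell_bases U" for U B using that by (simp add: cell_bases_def)
  have x0: "0 \<le> coord B x j" if "U \<in> F" "B \<in> cell_bases U" for U B j
    using xK that by (simp add: cells_meet_iff[OF F])
  have ev: "\<forall>\<^sub>F t in at_right 0. \<forall>B j. ibasis B \<and> 0 \<le> coord B x j \<longrightarrow> 0 \<le> coord B p j + t * (coord B p j - coord B x j)"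
  proof (intro eventually_all_finite)
    fix B j
    have lim: "((\<lambda>t. coord B p j + t * (coord B p j - coord B x j)) \<longlongrightarrow> coord B p j + 0 * (coord B p j - coord B x j)) (at_right 0)"
      by (intro tendsto_intros)
    consider "\<not> (ibasis B \<and> 0 \<le> coord B x j)" | "ibasis B" "coord B x j = 0" | "ibasis B" "0 < coord B x j" by linarith
    then show "\<forall>\<^sub>F t in at_right 0. ibasis B \<and> 0 \<le> coord B x j \<longrightarrow> 0 \<le> coord B p j + t * (coord B p j - coord B x j)"
    proof cases
      case 3
      then have "\<forall>\<^sub>F t in at_right 0. 0 < coord B p j + t * (coord B p j - coord B x j)"
        using p(3) by (intro order_tendstoD(1)[OF lim]) auto
      then show ?thesis by eventually_elim simp
    qed (auto simp: p(2))
  qed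
  have "\<forall>\<^sub>F t in at_right (0::real). 0 < t" by (rule eventually_at_right_less)
  from eventually_happens'[OF trivial_limit_at_right_real eventually_conj[OF this ev]]
  obtain t where t: "0 < t" "\<And>B j. ibasis B \<Longrightarrow> 0 \<le> coord B x j \<Longrightarrow> 0 \<le> coord B p j + t * (coord B p j - coord B x j)"
    by blast
  define y where "y = p + t *\<^sub>R (p - x)"
  have "y \<in> ?K"
    unfolding cells_meet_iff[OF F]
  proof (intro ballI allI)
    fix U B j assume UB: "U \<in> F" "B \<in> cell_bases U"
    note B = F_basis[OF UB]
    show "0 \<le> coord B y j" using t(2)[OF B x0[OF UB, of j]] by (simp add: y_def coord_add[OF B] coord_scale[OF B] coord_diff[OF B])
  qed
  \<comment> \<open>The ratio \<open>t / (1 + t)\<close> is the one at which the segment from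
    \<open>y\<close> to \<open>x\<close> passes through \<open>p\<close>.\<close>
  then have "y - (t / (1 + t)) *\<^sub>R (y - x) \<in> rel_interior ?K"
    using t(1) by (intro rel_interior_convex_shrink[OF convex_cells_meet[OF F] x]) auto
  moreover have "y - (t / (1 + t)) *\<^sub>R (y - x) = p"
  proof -
    have "y - x = (1 + t) *\<^sub>R (p - x)" by (simp add: y_def algebra_simps)
    then have "(t / (1 + t)) *\<^sub>R (y - x) = t *\<^sub>R (p - x)" using t(1) by simp
    then show ?thesis by (simp add: y_def)
  qed
  ultimately show ?thesis using p(1) by auto
qed

text \<open>The point is \<open>n\<close> times \<open>p + y / n\<close>, which lies in the span and
  close to \<open>p\<close>; the relative interior is invariant under positive scaling.\<close>

lemma ray_enters_rel_interior:
  assumes F: "F \<subseteq> cells" and p: "p \<in> rel_interior (cells_meet F)"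
    and y: "y \<in> span (rel_interior (cells_meet F))"
  shows "\<exists>T. \<forall>n::nat. T \<le> real n \<longrightarrow> y + real n *\<^sub>R p \<in> rel_interior (cells_meet F)"
proof -
  let ?K = "cells_meet F"
  have aff: "affine hull ?K = span ?K"
    using zero_cells_meet[OF F] by (intro affine_hull_span_0 hull_inc)
  obtain e where e: "0 < e" "ball p e \<inter> span ?K \<subseteq> ?K" using p unfolding mem_rel_interior_ball aff by blast
  have in_rel: "z \<in> rel_interior ?K" if "z \<in> ball p e" "z \<in> span ?K" for z
    unfolding mem_rel_interior_ball aff
  proof
    show "z \<in> ?K" using that e by blast
    have "ball z (e - dist p z) \<subseteq> ball p e"
    proof
      fix w assume "w \<in> ball z (e - dist p z)"
      then show "w \<in> ball p e" using dist_triangle[of p w z] by simp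
    qed
    then show "\<exists>e>0. ball z e \<inter> span ?K \<subseteq> ?K" using e(2) that(1) by (intro exI[of _ "e - dist p z"]) auto
  qed
  have yK: "y \<in> span ?K" using y span_mono[OF rel_interior_subset[of ?K]] by blast
  have pK: "p \<in> span ?K" using p rel_interior_subset[of ?K] by (auto intro: span_base)
  have "y + real n *\<^sub>R p \<in> rel_interior ?K" if n: "norm y / e + 1 \<le> real n" for n
  proof -
    have n0: "0 < real n" using n e(1) by (smt (verit) divide_nonneg_pos norm_ge_zero)
    have "norm y / e < real n" using n by linarith
    then have "norm y / real n < e" using n0 e(1) by (simp add: field_simps)
    then have "p + (1 / real n) *\<^sub>R y \<in> ball p e" using n0 by (simp add: dist_norm)
    moreover have "p + (1 / real n) *\<^sub>R y \<in> span ?K" using yK pK by (intro span_add span_scale)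
    ultimately have "real n *\<^sub>R (p + (1 / real n) *\<^sub>R y) \<in> rel_interior ?K"
      using in_rel rel_interior_cells_meet_scale[OF F _ n0] by blast
    then show ?thesis using n0 by (simp add: scaleR_add_right add.commute)
  qed
  then show ?thesis by blast
qed

text \<open>Every truncation level gives the same values on the closed chamber. The levels 0 and -1
  are exchanged by \<open>- R - 1\<close>, so reciprocity relates precisely the two chosen
  functions.\<close>

definition level :: "bool \<Rightarrow> int" where
  "level b = (if b then - 1 else 0)"

text \<open>\<open>cell_count\<close> of any one cell in \<open>F\<close> serves, as
  \<open>C\<close> lies in the closure of that cell. For uniqueness, rays in the direction of an
  integral point of \<open>C\<close> end up in \<open>C\<close>, where both candidates equal the
  count.\<close>

lemma abstract_quasipoly_meet:
  assumes F: "F \<subseteq> cells" "U \<in> F" and C: "C = rel_interior (cells_meet F)"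
  shows "is_abstract_quasipoly L' C (count b h) (restrict (\<lambda>l. cell_count b U h l (level b)) (L' \<inter> span C))"
    and "is_abstract_quasipoly L' C (count b h) q1 \<Longrightarrow> is_abstract_quasipoly L' C (count b h) q2 \<Longrightarrow> q1 = q2"
proof -
  have sub: "C \<subseteq> closure U" unfolding C using rel_interior_subset F(2) by (force simp: cells_meet_def)
  have M: "add_subgroup (L' \<inter> span C)"
    using add_subgroup_L' unfolding add_subgroup_def by (auto simp: span_zero span_diff)
  show "is_abstract_quasipoly L' C (count b h) (restrict (\<lambda>l. cell_count b U h l (level b)) (L' \<inter> span C))"
    unfolding is_abstract_quasipoly_def
  proof (intro conjI ballI)
    obtain n where n: "poly_on_cosets n (\<lambda>l. cell_count b U h l (level b))" using cell_count_quasipoly by blast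
    show "quasipolynomial_on (L' \<inter> span C) (restrict (\<lambda>l. cell_count b U h l (level b)) (L' \<inter> span C))"
      by (rule quasipolynomial_on_cong[OF quasipolynomial_on_cosets[OF overlattice n subspace_span]]) (auto simp: M)
    fix l assume l: "l \<in> L' \<inter> C"
    then have "l \<in> closure U" "l \<in> span C" using sub by (auto intro: span_base)
    then show "restrict (\<lambda>l. cell_count b U h l (level b)) (L' \<inter> span C) l = count b h l"
      using l count_cell[of U l b h "level b"] F by auto
  qed auto
  assume q: "is_abstract_quasipoly L' C (count b h) q1" "is_abstract_quasipoly L' C (count b h) q2"
  obtain p where p: "p \<in> int_vecs" "p \<in> C" using int_point_rel_interior[OF F(1)] C by blast
  have pM: "p \<in> L' \<inter> span C" using p int_vecs_L' by (auto intro: span_base)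
  show "q1 = q2"
  proof (rule extensionalityI)
    fix y assume y: "y \<in> L' \<inter> span C"
    obtain T where T: "\<And>n::nat. T \<le> real n \<Longrightarrow> y + real n *\<^sub>R p \<in> C"
      using ray_enters_rel_interior[OF F(1), of p y] p y C by blast
    show "q1 y = q2 y"
    proof (rule quasipoly_unique_along_ray[OF M _ _ pM y])
      fix n :: nat assume "T \<le> real n"
      then have "y + real n *\<^sub>R p \<in> L' \<inter> C"
        using T add_subgroup_add[OF add_subgroup_L'] add_subgroup_scale[OF add_subgroup_L'] y pM by blast
      then show "q1 (y + real n *\<^sub>R p) = q2 (y + real n *\<^sub>R p)"
        using q unfolding is_abstract_quasipoly_def by metis
    qed (use q in \<open>auto simp: is_abstract_quasipoly_def\<close>)
  qed (use q in \<open>auto simp: is_abstract_quasipoly_def\<close>)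
qed

lemma ex1_abstract_quasipoly:
  assumes "F \<subseteq> cells" "U \<in> F" "C = rel_interior (cells_meet F)"
  shows "\<exists>!q. is_abstract_quasipoly L' C (count b h) q"
  using abstract_quasipoly_meet[OF assms] by blast

lemma abstract_quasipoly_eq:
  assumes "F \<subseteq> cells" "U \<in> F" "C = rel_interior (cells_meet F)" "l \<in> L' \<inter> span C"
  shows "abstract_quasipoly L' C (count b h) l = cell_count b U h l (level b)"
proof -
  have "abstract_quasipoly L' C (count b h) = restrict (\<lambda>l. cell_count b U h l (level b)) (L' \<inter> span C)"
    unfolding abstract_quasipoly_def
    by (rule the1_equality[of "is_abstract_quasipoly L' C (count b h)",
          OF ex1_abstract_quasipoly[OF assms(1-3)] abstract_quasipoly_meet(1)[OF assms(1-3)]])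
  then show ?thesis using assms(4) by simp
qed

text \<open>The formula of a cell is exact on the whole closed chamber, which contains the closure
  of \<open>C\<close>; this is the source of all continuity statements.\<close>

lemma abstract_quasipoly_closure:
  assumes F: "F \<subseteq> cells" "U \<in> F" and C: "C = rel_interior (cells_meet F)" and l: "l \<in> L' \<inter> closure C"
  shows "abstract_quasipoly L' C (count b h) l = count b h l"
proof -
  have "C \<subseteq> closure U" unfolding C using rel_interior_subset F(2) by (force simp: cells_meet_def)
  then have "closure C \<subseteq> closure U" by (simp add: closure_minimal)
  moreover have "closure C \<subseteq> span C" by (simp add: closure_minimal closed_span span_superset)
  ultimately have "l \<in> closure U" "l \<in> L' \<inter> span C" using l by blast+
  then show ?thesis
    using abstract_quasipoly_eq[OF F C, of l b h] count_cell[of U l b h "level b"] F by auto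
qed

lemma open_cones_cases:
  assumes "C \<in> open_cones a"
  obtains F U where "F \<subseteq> cells" "U \<in> F" "C = rel_interior (cells_meet F)"
proof -
  obtain \<K> where K: "\<K> \<subseteq> closure ` cells" "\<K> \<noteq> {}" "C = rel_interior (\<Inter>\<K>)"
    using assms unfolding open_cones_def chambers_eq by blast
  then obtain F where "F \<subseteq> cells" "\<K> = closure ` F" by (meson subset_imageE)
  then show ?thesis using that K by (auto simp: cells_meet_def)
qed

lemma chamber_interior:
  assumes U: "U \<in> cells"
  shows "interior (closure U) = U" "U = rel_interior (cells_meet {U})" "U \<in> open_cones a" "span U = UNIV"
proof -
  show int: "interior (closure U) = U" by (rule interior_closure_cell[OF U])
  then have "interior (closure U) \<noteq> {}" using cell_nonempty[OF U] by simp
  from rel_interior_nonempty_interior[OF this] int show rel: "U = rel_interior (cells_meet {U})"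
    by (simp add: cells_meet_def)
  show "U \<in> open_cones a" unfolding open_cones_def chambers_eq using U rel
    by (intro CollectI exI[of _ "{closure U}"]) (auto simp: cells_meet_def)
  have "interior U \<noteq> {}" using open_cell[OF U] cell_nonempty[OF U] by (simp add: interior_open)
  from affine_hull_nonempty_interior[OF this] show "span U = UNIV" using affine_hull_subset_span[of U] by auto
qed

lemma combinatorially_stable:
  assumes "C \<in> open_cones a" "l1 \<in> C" "l2 \<in> C"
  shows "same_combinatorial_type (polytope_closed a l1) (polytope_closed a l2)"
proof -
  obtain F U where F: "F \<subseteq> cells" "U \<in> F" "C = rel_interior (cells_meet F)"
    using open_cones_cases[OF assms(1)] .
  have "cells_meet F \<subseteq> closure U" using F(2) by (auto simp: cells_meet_def)
  from rel_interior_same_ocone[OF convex_cells_meet[OF F(1)] this] show ?thesis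
    using F assms by (intro same_combinatorial_type_if_ocones) blast
qed

lemma count_simps: "count False = count_T a" "count True = count_FT a"
  by (simp_all add: count_def)

end

theorem theorem4p3p9:
  fixes a :: "'d::finite \<Rightarrow> real ^ 's::finite" and L' :: "(real ^ 's) set"
  assumes "overlattice L'"
    and "\<forall>i. a i \<in> L'"
    and "\<forall>i v. 0 < a i $ v"
  shows
    "(\<forall>C\<in>open_cones a.
        (\<forall>l1\<in>L' \<inter> C. \<forall>l2\<in>L' \<inter> C.
           same_combinatorial_type (polytope_closed a l1) (polytope_closed a l2)) \<and>
        (\<forall>h\<in>quotient_group L'.
           (\<exists>!q. is_abstract_quasipoly L' C (count_T a h) q) \<and>
           (\<exists>!q. is_abstract_quasipoly L' C (count_FT a h) q))) \<and>
     (\<forall>h\<in>quotient_group L'. \<forall>C\<in>open_cones a. \<forall>C'\<in>open_cones a. C' \<subseteq> closure C \<longrightarrow>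
        (\<forall>l\<in>L' \<inter> C'.
           abstract_quasipoly L' C' (count_T a h) l = abstract_quasipoly L' C (count_T a h) l \<and>
           abstract_quasipoly L' C' (count_FT a h) l = abstract_quasipoly L' C (count_FT a h) l)) \<and>
     (\<forall>h\<in>quotient_group L'. \<forall>C\<in>chambers a.
        interior C \<in> open_cones a \<and> L' \<inter> span (interior C) = L' \<and>
        (\<exists>!q. is_abstract_quasipoly L' (interior C) (count_T a h) q) \<and>
        (\<forall>l\<in>L' \<inter> C. abstract_quasipoly L' (interior C) (count_T a h) l = count_T a h l)) \<and>
     (\<forall>h\<in>quotient_group L'. \<forall>C1\<in>chambers a. \<forall>C2\<in>chambers a. \<forall>l\<in>L' \<inter> (C1 \<inter> C2).
        abstract_quasipoly L' (interior C1) (count_T a h) l =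
        abstract_quasipoly L' (interior C2) (count_T a h) l) \<and>
     (\<forall>h\<in>quotient_group L'. \<forall>C\<in>chambers a. \<forall>l\<in>L'.
        abstract_quasipoly L' (interior C) (count_T a h) l =
        (-1) ^ CARD('d) * abstract_quasipoly L' (interior C) (count_FT a (uminus ` h)) (- l))"
proof -
  interpret lattice_cone a L' using assms by unfold_locales auto
  obtain \<xi> where xi: "\<And>i. 0 < \<xi> i" "generic_cost (xi_cost \<xi>)" using ex_generic_cost by blast
  obtain M :: nat where M: "0 < M" "\<And>B j k. ibasis B \<Longrightarrow> real M * coord B (gen j) k \<in> \<int>"
    using coord_denominator by blast
  interpret polarized_cone a L' \<xi> M using xi M by unfold_locales auto
  have ex1: "\<exists>!q. is_abstract_quasipoly L' C (count b h) q" if "C \<in> open_cones a" for C b h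
    using that by (rule open_cones_cases) (rule ex1_abstract_quasipoly)
  have cl: "abstract_quasipoly L' C (count b h) l = count b h l" if "C \<in> open_cones a" "l \<in> L' \<inter> closure C" for C b h l
    using that(1) by (rule open_cones_cases) (rule abstract_quasipoly_closure[OF _ _ _ that(2)])
  have ch: "\<exists>U\<in>cells. C = closure U \<and> interior C = U" if "C \<in> chambers a" for C
    using that chamber_interior(1) unfolding chambers_eq by blast
  have ch_op: "interior C \<in> open_cones a" "span (interior C) = UNIV" if "C \<in> chambers a" for C
    using ch[OF that] chamber_interior(3,4) by auto
  have ch_cl: "abstract_quasipoly L' (interior C) (count b h) l = count b h l" if C: "C \<in> chambers a" "l \<in> L' \<inter> C" for C b h l
    using ch[OF C(1)] C(2) by (intro cl ch_op(1)[OF C(1)]) auto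
  \<comment> \<open>Both sides equal the actual count at \<open>l\<close>, which lies in both
    closures.\<close>
  have sub: "abstract_quasipoly L' C' (count b h) l = abstract_quasipoly L' C (count b h) l"
    if "C \<in> open_cones a" "C' \<in> open_cones a" "C' \<subseteq> closure C" "l \<in> L' \<inter> C'" for C C' b h l
  proof -
    have "l \<in> L' \<inter> closure C" "l \<in> L' \<inter> closure C'" using that(3,4) closure_subset[of C'] by blast+
    then show ?thesis using cl that(1,2) by simp
  qed
  have rec: "abstract_quasipoly L' (interior C) (count False h) l =
        (-1) ^ CARD('d) * abstract_quasipoly L' (interior C) (count True (uminus ` h)) (- l)"
    if C: "C \<in> chambers a" and l: "l \<in> L'" for C h l
  proof -
    obtain U where U: "U \<in> cells" "interior C = U" using ch[OF C] by blast
    have eq: "abstract_quasipoly L' U (count b h) l = cell_count b U h l (level b)" if "l \<in> L'" for b h l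
      using U chamber_interior(2,4)[OF U(1)] that by (intro abstract_quasipoly_eq[of "{U}"]) auto
    \<comment> \<open>Reciprocity from \<open>R = 0\<close> lands at level -1; the sign squares to 1
      when moved to the other side.\<close>
    have "(-1) ^ CARD('d) * cell_count True U (uminus ` h) (- l) (- 1) = ((-1) ^ CARD('d) * (-1) ^ CARD('d)) * cell_count False U h l 0"
      using cell_count_reciprocity[of False U h l 0] by simp
    also have "\<dots> = cell_count False U h l 0" by (simp flip: power_add)
    finally show ?thesis
      unfolding U(2) using eq[OF l, of False h] eq[OF add_subgroup_neg[OF add_subgroup_L' l], of True "uminus ` h"]
      by (simp add: level_def)
  qed
  note ex1T = ex1[of _ False, unfolded count_simps] and ex1F = ex1[of _ True, unfolded count_simps]
  note subT = sub[of _ _ _ False, unfolded count_simps] and subF = sub[of _ _ _ True, unfolded count_simps]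
  note ch_clT = ch_cl[of _ _ False, unfolded count_simps]
  show ?thesis
  proof (intro conjI ballI impI)
    fix C1 C2 h l assume "C1 \<in> chambers a" "C2 \<in> chambers a" "l \<in> L' \<inter> (C1 \<inter> C2)"
    then show "abstract_quasipoly L' (interior C1) (count_T a h) l = abstract_quasipoly L' (interior C2) (count_T a h) l"
      using ch_clT[of C1 l h] ch_clT[of C2 l h] by simp
  next
    fix C h l assume "C \<in> chambers a" "l \<in> L'"
    then show "abstract_quasipoly L' (interior C) (count_T a h) l =
        (-1) ^ CARD('d) * abstract_quasipoly L' (interior C) (count_FT a (uminus ` h)) (- l)"
      using rec unfolding count_simps by blast
  qed (use combinatorially_stable ex1T ex1F subT subF ch_clT ch_op in auto)
qed

end
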